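(* Let $X$ be a finite h-regular poset and let $M$ be an admissible Morse matching on its Hasse diagram $\mathcal{H}(X)$. Then the order complex $\mathcal{K}(X)$ is homotopy equivalent to a CW-complex with exactly one $p$-cell for each critical point of $X$ of height $p$ (for every $p\ge 0$).
   Context: All posets and complexes are finite. For a poset $X$ and $x\in X$, $\hat U_x=\{y\in X: y<x\}$ and $U_x=\{y\in X: y\le x\}$. The order complex $\mathcal{K}(X)$ is the simplicial complex of non-empty chains of $X$; a simplicial complex and its geometric realization are denoted by the same symbol. The height $h(X)$ of a poset is the maximum length of a chain, where the chain $x_0<x_1<\dots<x_n$ has length $n$; the height of an element is $h(x)=h(U_x)$. $X$ is h-regular if for every $x\in X$ the order complex $\mathcal{K}(\hat U_x)$ is homotopy equivalent to the sphere $S^{n-1}$, where $n=h(x)$ (with $S^{-1}=\emptyset$). Write $x\prec y$ if $x<y$ and there is no $z$ with $x<z<y$. The Hasse diagram $\mathcal{H}(X)$ is the directed graph with vertex set $X$ and edges the pairs $(x,y)$ with $x\prec y$ (directed from $x$ to $y$). An edge $(x,y)$ (so $x\prec y$) is admissible if $\mathcal{K}(\hat U_y\setminus\{x\})$ is contractible. A matching $M$ on $\mathcal{H}(X)$ is a set of edges no two of which share a vertex. $\mathcal{H}_M(X)$ is the directed graph obtained from $\mathcal{H}(X)$ by reversing the orientation of the edges that are not in $M$. $M$ is a Morse matching if $\mathcal{H}_M(X)$ has no directed cycles; a Morse matching is admissible if every edge in $M$ is admissible. The critical points are the elements of $X$ not incident to any edge of $M$. *)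

theory Defs
  imports "HOL-Analysis.Analysis"
begin

text \<open>A finite poset is a finite set \<open>X\<close> in a type of class \<open>order\<close>, with the induced order;
  every finite poset is isomorphic to one of this form.\<close>

definition order_complex :: "'a::order set \<Rightarrow> 'a set set" where
  "order_complex P = {C. C \<subseteq> P \<and> C \<noteq> {} \<and> finite C \<and> Complete_Partial_Order.chain (\<le>) C}"

text \<open>Barycentric coordinates, topologised as a subspace of a product of real lines.
  For a finite complex this is the usual topology.\<close>

definition realization :: "'a set set \<Rightarrow> ('a \<Rightarrow> real) topology" where
  "realization K = subtopology (powertop_real UNIV)
     {t. (\<forall>v. 0 \<le> t v) \<and> {v. t v \<noteq> 0} \<in> K \<and> (\<Sum>v\<in>{v. t v \<noteq> 0}. t v) = 1}"

definition poset_down :: "'a::order set \<Rightarrow> 'a \<Rightarrow> 'a set" where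
  "poset_down X x = {y\<in>X. y \<le> x}"

definition poset_strict_down :: "'a::order set \<Rightarrow> 'a \<Rightarrow> 'a set" where
  "poset_strict_down X x = {y\<in>X. y < x}"

text \<open>Only meaningful for non-empty finite \<open>P\<close>.\<close>

definition poset_height :: "'a::order set \<Rightarrow> nat" where
  "poset_height P = Max ((\<lambda>C. card C - 1) ` order_complex P)"

definition elem_height :: "'a::order set \<Rightarrow> 'a \<Rightarrow> nat" where
  "elem_height X x = poset_height (poset_down X x)"

text \<open>The sphere of dimension \<open>n - 1\<close>, which is empty for \<open>n = 0\<close>.\<close>

definition sphere_pred :: "nat \<Rightarrow> (nat \<Rightarrow> real) topology" where
  "sphere_pred n = (if n = 0 then trivial_topology else nsphere (n - 1))"

definition h_regular :: "'a::order set \<Rightarrow> bool" where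
  "h_regular X \<longleftrightarrow> (\<forall>x\<in>X.
     realization (order_complex (poset_strict_down X x))
       homotopy_equivalent_space sphere_pred (elem_height X x))"

definition hasse :: "'a::order set \<Rightarrow> ('a \<times> 'a) set" where
  "hasse X = {(x, y). x \<in> X \<and> y \<in> X \<and> x < y \<and> \<not> (\<exists>z\<in>X. x < z \<and> z < y)}"

text \<open>The library regards the empty space as contractible; here it is not.\<close>

definition admissible_edge :: "'a::order set \<Rightarrow> 'a \<times> 'a \<Rightarrow> bool" where
  "admissible_edge X = (\<lambda>(x, y). (x, y) \<in> hasse X \<and>
     (let R = realization (order_complex (poset_strict_down X y - {x}))
      in topspace R \<noteq> {} \<and> contractible_space R))"

definition hasse_matching :: "'a::order set \<Rightarrow> ('a \<times> 'a) set \<Rightarrow> bool" where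
  "hasse_matching X M \<longleftrightarrow> M \<subseteq> hasse X \<and>
     (\<forall>e\<in>M. \<forall>e'\<in>M. e \<noteq> e' \<longrightarrow> {fst e, snd e} \<inter> {fst e', snd e'} = {})"

definition hasse_reversed :: "'a::order set \<Rightarrow> ('a \<times> 'a) set \<Rightarrow> ('a \<times> 'a) set" where
  "hasse_reversed X M = (hasse X \<inter> M) \<union> (hasse X - M)\<inverse>"

definition morse_matching :: "'a::order set \<Rightarrow> ('a \<times> 'a) set \<Rightarrow> bool" where
  "morse_matching X M \<longleftrightarrow> hasse_matching X M \<and> acyclic (hasse_reversed X M)"

definition admissible_morse_matching :: "'a::order set \<Rightarrow> ('a \<times> 'a) set \<Rightarrow> bool" where
  "admissible_morse_matching X M \<longleftrightarrow> morse_matching X M \<and> (\<forall>e\<in>M. admissible_edge X e)"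

definition critical_points :: "'a::order set \<Rightarrow> ('a \<times> 'a) set \<Rightarrow> 'a set" where
  "critical_points X M = {x\<in>X. \<forall>e\<in>M. x \<noteq> fst e \<and> x \<noteq> snd e}"

text \<open>The closed unit disc in \<open>Euclidean_space n\<close>, its interior and its boundary sphere.
  For \<open>n = 0\<close> the disc and its interior are a point and the boundary is empty.\<close>

definition disc :: "nat \<Rightarrow> (nat \<Rightarrow> real) topology" where
  "disc n = subtopology (Euclidean_space n) {v. (\<Sum>i<n. (v i)\<^sup>2) \<le> 1}"

definition disc_interior :: "nat \<Rightarrow> (nat \<Rightarrow> real) set" where
  "disc_interior n = {v \<in> topspace (disc n). (\<Sum>i<n. (v i)\<^sup>2) < 1}"

definition disc_boundary :: "nat \<Rightarrow> (nat \<Rightarrow> real) set" where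
  "disc_boundary n = {v \<in> topspace (disc n). (\<Sum>i<n. (v i)\<^sup>2) = 1}"

text \<open>\<open>CW_complex Z I dm \<Phi>\<close>: the Hausdorff space \<open>Z\<close> is a CW-complex whose cells are
  indexed by \<open>I\<close>, the cell \<open>i\<close> having dimension \<open>dm i\<close> and characteristic map \<open>\<Phi> i\<close>.
  The last two conditions are closure-finiteness and the weak topology.  The open cells are
  non-empty and pairwise disjoint, so distinct indices give distinct cells.\<close>

definition CW_complex ::
  "'b topology \<Rightarrow> 'i set \<Rightarrow> ('i \<Rightarrow> nat) \<Rightarrow> ('i \<Rightarrow> (nat \<Rightarrow> real) \<Rightarrow> 'b) \<Rightarrow> bool" where
  "CW_complex Z I dm \<Phi> \<longleftrightarrow>
     (let cell = (\<lambda>i. \<Phi> i ` disc_interior (dm i)) in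
      Hausdorff_space Z \<and>
      (\<forall>i\<in>I. continuous_map (disc (dm i)) Z (\<Phi> i)) \<and>
      (\<forall>i\<in>I. homeomorphic_map (subtopology (disc (dm i)) (disc_interior (dm i)))
                (subtopology Z (cell i)) (\<Phi> i)) \<and>
      disjoint_family_on cell I \<and>
      (\<Union>i\<in>I. cell i) = topspace Z \<and>
      (\<forall>i\<in>I. \<exists>J\<subseteq>I. finite J \<and> (\<forall>j\<in>J. dm j < dm i) \<and>
                \<Phi> i ` disc_boundary (dm i) \<subseteq> (\<Union>j\<in>J. cell j)) \<and>
      (\<forall>A\<subseteq>topspace Z. closedin Z A \<longleftrightarrow> (\<forall>i\<in>I. closedin Z (A \<inter> Z closure_of cell i))))"

end

theory Submission
  imports Defs "HOL-Homology.Brouwer_Degree"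
begin

text \<open>Order the elements of \<open>X\<close> in blocks, a block being a critical point \<open>c\<close> or a matched pair
  \<open>x \<prec> y\<close>.  Adding \<open>y\<close>, and then \<open>x\<close>, to a down-set attaches a cone over a contractible complex (that of
  \<open>{z. z < y} - {x}\<close>, respectively a cone with apex \<open>y\<close>), which does not change the homotopy type;
  adding \<open>c\<close> attaches a cone over a homotopy sphere, which up to homotopy attaches a cell of
  dimension \<open>h c\<close>.  Homology of spheres forces \<open>h y = h x + 1\<close> on admissible edges.  Hence the
  blocks can be ordered by the rank \<open>2 h c\<close>, respectively \<open>2 h x + 1\<close>, acyclicity ordering the pairs
  of equal rank; then cells are attached in order of dimension and the result is a CW-complex
  without any cellular approximation.\<close>

section \<open>Homotopy equivalences and mapping cones\<close>

text \<open>The next cell is glued along a composite: a sphere maps to the link of \<open>c\<close>,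
  the link lies in the order complex built so far, and that complex maps to the cell complex
  \<open>Z\<close> by an equivalence \<open>f\<close>. Mapping cones must therefore be invariant
  under changing base and link up to homotopy, and the new equivalence must extend \<open>f\<close>
  strictly: otherwise it would be lost that elements of height below \<open>n\<close> go to cells of
  dimension below \<open>n\<close>, which makes the attaching map cellular.

  The parity of the rank gives the order of attachment. Elements below a critical point of height p
  have height at most p - 1, hence rank at most 2p - 1, less than 2p. Elements below the upper end
  of a pair with heights p and p + 1 have rank at most 2p + 1, with equality only for lower ends of
  height p. Such ties are the only place where rank does not decide, and a tie gives a directed path
  between the lower ends in the modified Hasse diagram. A single rank for both ends of a pair is
  possible only because their heights differ by exactly one; an edge of the Hasse diagram of an
  arbitrary poset may skip heights.\<close>

abbreviation I01 :: "real topology" where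
  "I01 \<equiv> top_of_set {0..1}"

abbreviation htp :: "'a topology \<Rightarrow> 'b topology \<Rightarrow> ('a \<Rightarrow> 'b) \<Rightarrow> ('a \<Rightarrow> 'b) \<Rightarrow> bool" where
  "htp \<equiv> homotopic_with (\<lambda>_. True)"

lemma htp_compose:
  assumes "htp X Y f f'" and "htp Y W g g'"
  shows "htp X W (g \<circ> f) (g' \<circ> f')"
proof -
  have "htp X W (g \<circ> f) (g \<circ> f')"
    by (rule homotopic_with_compose_continuous_map_left[OF assms(1)])
       (use homotopic_with_imp_continuous_maps[OF assms(2)] in simp_all)
  moreover have "htp X W (g \<circ> f') (g' \<circ> f')"
    by (rule homotopic_with_compose_continuous_map_right[OF assms(2)])
       (use homotopic_with_imp_continuous_maps[OF assms(1)] in simp_all)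
  ultimately show ?thesis by (rule homotopic_with_trans)
qed

lemma htp_eq:
  assumes "continuous_map X Y f" and "\<And>x. x \<in> topspace X \<Longrightarrow> f x = g x"
  shows "htp X Y f g"
  using assms by (simp add: homotopic_with_equal)

lemma htp_cong:
  assumes "htp X Y f g"
    and "\<And>x. x \<in> topspace X \<Longrightarrow> f x = f' x" and "\<And>x. x \<in> topspace X \<Longrightarrow> g x = g' x"
  shows "htp X Y f' g'"
proof -
  have "continuous_map X Y f" "continuous_map X Y g"
    using homotopic_with_imp_continuous_maps[OF assms(1)] by auto
  then have "htp X Y f f'" "htp X Y g g'"
    using assms by (simp_all add: htp_eq)
  then show ?thesis
    using assms(1) homotopic_with_symD homotopic_with_trans by metis
qed

text \<open>A property of a map and not only of two spaces, because later statements must say that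
  one equivalence extends another.\<close>

definition homotopy_equivalence :: "'a topology \<Rightarrow> 'b topology \<Rightarrow> ('a \<Rightarrow> 'b) \<Rightarrow> bool" where
  "homotopy_equivalence X Y f \<longleftrightarrow> continuous_map X Y f \<and>
     (\<exists>g. continuous_map Y X g \<and> htp X X (g \<circ> f) id \<and> htp Y Y (f \<circ> g) id)"

lemma homotopy_equivalent_space_iff:
  "X homotopy_equivalent_space Y \<longleftrightarrow> (\<exists>f. homotopy_equivalence X Y f)"
  unfolding homotopy_equivalent_space_def homotopy_equivalence_def by blast

text \<open>As with one-sided inverses in a category, \<open>g\<close> and \<open>k\<close> are both
  homotopic to \<open>g \<circ> f \<circ> k\<close>. The two inverses may thus come from unrelated
  constructions.\<close>

lemma homotopy_equivalence_left_right:
  assumes f: "continuous_map X Y f" and g: "continuous_map Y X g" and k: "continuous_map Y X k"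
    and gf: "htp X X (g \<circ> f) id" and fk: "htp Y Y (f \<circ> k) id"
  shows "homotopy_equivalence X Y f"
proof -
  have "htp Y X ((g \<circ> f) \<circ> k) (id \<circ> k)"
    by (rule htp_compose[OF _ gf]) (use k in simp)
  moreover have "htp Y X (g \<circ> (f \<circ> k)) (g \<circ> id)"
    by (rule htp_compose[OF fk]) (use g in simp)
  ultimately have "htp Y X (g \<circ> f \<circ> k) k" "htp Y X (g \<circ> f \<circ> k) g"
    by (simp_all add: o_assoc)
  then have "htp Y X g k"
    by (metis homotopic_with_symD homotopic_with_trans)
  then have "htp Y Y (f \<circ> g) (f \<circ> k)"
    by (rule htp_compose) (use f in simp)
  then have "htp Y Y (f \<circ> g) id"
    using fk by (rule homotopic_with_trans)
  then show ?thesis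
    unfolding homotopy_equivalence_def using f g gf by blast
qed

lemma homotopy_equivalence_homotopic:
  assumes "homotopy_equivalence X Y f" and h: "htp X Y f f'"
  shows "homotopy_equivalence X Y f'"
proof -
  from assms(1) obtain g where g: "continuous_map Y X g" "htp X X (g \<circ> f) id" "htp Y Y (f \<circ> g) id"
    unfolding homotopy_equivalence_def by blast
  have "htp X X (g \<circ> f') (g \<circ> f)"
    by (rule htp_compose[OF homotopic_with_symD[OF h]]) (use g in simp)
  then have "htp X X (g \<circ> f') id"
    using g(2) by (rule homotopic_with_trans)
  moreover have "htp Y Y (f' \<circ> g) (f \<circ> g)"
    by (rule htp_compose[OF _ homotopic_with_symD[OF h]]) (use g in simp)
  then have "htp Y Y (f' \<circ> g) id"
    using g(3) by (rule homotopic_with_trans)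
  ultimately show ?thesis
    unfolding homotopy_equivalence_def
    using g homotopic_with_imp_continuous_maps[OF h] by blast
qed

lemma homotopy_equivalence_compose:
  assumes "homotopy_equivalence X Y f" and "homotopy_equivalence Y W k"
  shows "homotopy_equivalence X W (k \<circ> f)"
proof -
  from assms obtain g m where f: "continuous_map X Y f" and g: "continuous_map Y X g"
      "htp X X (g \<circ> f) id" "htp Y Y (f \<circ> g) id" and k: "continuous_map Y W k"
    and m: "continuous_map W Y m" "htp Y Y (m \<circ> k) id" "htp W W (k \<circ> m) id"
    unfolding homotopy_equivalence_def by blast
  have "htp X X (g \<circ> ((m \<circ> k) \<circ> f)) (g \<circ> (id \<circ> f))"
    by (rule htp_compose[OF htp_compose[OF _ m(2)]]) (use f g in simp_all)
  moreover have "htp W W (k \<circ> ((f \<circ> g) \<circ> m)) (k \<circ> (id \<circ> m))"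
    by (rule htp_compose[OF htp_compose[OF _ g(3)]]) (use k m in simp_all)
  ultimately have "htp X X (g \<circ> m \<circ> (k \<circ> f)) (g \<circ> f)" "htp W W (k \<circ> f \<circ> (g \<circ> m)) (k \<circ> m)"
    by (simp_all add: o_assoc)
  then have "htp X X (g \<circ> m \<circ> (k \<circ> f)) id" "htp W W (k \<circ> f \<circ> (g \<circ> m)) id"
    using g(2) m(3) by (metis homotopic_with_trans)+
  then show ?thesis
    unfolding homotopy_equivalence_def
    using f g k m continuous_map_compose[OF f k] continuous_map_compose[OF m(1) g(1)] by blast
qed

text \<open>\<open>F\<close> is homotopic to every homotopy inverse of \<open>G\<close>.\<close>

lemma homotopy_equivalence_right_inverse:
  assumes "homotopy_equivalence X Y G" and F: "continuous_map Y X F" and GF: "htp Y Y (G \<circ> F) id"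
  shows "homotopy_equivalence Y X F"
proof -
  from assms obtain g where G: "continuous_map X Y G" and g: "continuous_map Y X g"
      "htp X X (g \<circ> G) id" "htp Y Y (G \<circ> g) id"
    unfolding homotopy_equivalence_def by blast
  have "htp Y X (g \<circ> (G \<circ> F)) (g \<circ> id)"
    by (rule htp_compose[OF GF]) (use g in simp)
  moreover have "htp Y X ((g \<circ> G) \<circ> F) (id \<circ> F)"
    by (rule htp_compose[OF _ g(2)]) (use F in simp)
  ultimately have "htp Y X (g \<circ> G \<circ> F) g" "htp Y X (g \<circ> G \<circ> F) F"
    by (simp_all add: o_assoc)
  then have "htp Y X g F"
    by (metis homotopic_with_symD homotopic_with_trans)
  moreover have "homotopy_equivalence Y X g"
    unfolding homotopy_equivalence_def using g G by blast
  ultimately show ?thesis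
    using homotopy_equivalence_homotopic by blast
qed

section \<open>Maps out of a Hausdorff space covered by compact images\<close>

lemma closedin_image_compact_preimage:
  assumes "Hausdorff_space Y" "compact_space K" "continuous_map K Y g" "continuous_map K W (f \<circ> g)"
    and "closedin W C"
  shows "closedin Y (g ` {x \<in> topspace K. f (g x) \<in> C})"
proof (rule compactin_imp_closedin[OF assms(1) image_compactin[OF closedin_compact_space]])
  show "closedin K {x \<in> topspace K. f (g x) \<in> C}"
    using assms(4,5) by (simp add: continuous_map_closedin)
qed (use assms in auto)

text \<open>Compact images are closed in a Hausdorff space, so finitely many of them covering
  \<open>Y\<close> determine its topology. The argument survives multiplication by the interval, so
  homotopies can be glued in the same way. The three pieces will be the base, the cone lines and the
  apex.\<close>

lemma continuous_map_from_compact_cover: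
  assumes Y: "Hausdorff_space Y"
    and K: "compact_space K1" "compact_space K2" "compact_space K3"
    and q: "continuous_map K1 Y q1" "continuous_map K2 Y q2" "continuous_map K3 Y q3"
    and cover: "topspace Y \<subseteq> q1 ` topspace K1 \<union> q2 ` topspace K2 \<union> q3 ` topspace K3"
    and f: "continuous_map K1 W (f \<circ> q1)" "continuous_map K2 W (f \<circ> q2)" "continuous_map K3 W (f \<circ> q3)"
  shows "continuous_map Y W f"
  unfolding continuous_map_closedin
proof (intro conjI allI impI)
  show "f \<in> topspace Y \<rightarrow> topspace W"
    using cover f[THEN continuous_map_image_subset_topspace] by (fastforce simp: image_subset_iff)
  fix C assume C: "closedin W C"
  have "{y \<in> topspace Y. f y \<in> C} = q1 ` {x \<in> topspace K1. f (q1 x) \<in> C} \<union>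
      (q2 ` {x \<in> topspace K2. f (q2 x) \<in> C} \<union> q3 ` {x \<in> topspace K3. f (q3 x) \<in> C})"
    using cover q[THEN continuous_map_image_subset_topspace] by (auto; blast)
  then show "closedin Y {x \<in> topspace Y. f x \<in> C}"
    using Y K q f C by (simp add: closedin_Un closedin_image_compact_preimage)
qed

text \<open>\<open>Y\<close> is the mapping cone of \<open>\<phi>\<close>: the base is embedded by \<open>i\<close>, and \<open>q (t, l)\<close> runs from
  \<open>i (\<phi> l)\<close> at \<open>t = 0\<close> to the apex \<open>p\<close> at \<open>t = 1\<close>.  The apex is a separate parameter because it
  exists even if \<open>L\<close> is empty.\<close>

locale mapping_cone =
  fixes Z :: "'z topology" and L :: "'l topology" and \<phi> :: "'l \<Rightarrow> 'z"
    and Y :: "'y topology" and i :: "'z \<Rightarrow> 'y" and q :: "real \<times> 'l \<Rightarrow> 'y" and p :: 'y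
  assumes compact_Z: "compact_space Z" and compact_L: "compact_space L" and Hausdorff: "Hausdorff_space Y"
    and cont_\<phi>: "continuous_map L Z \<phi>"
    and cont_i: "continuous_map Z Y i" and inj_i: "inj_on i (topspace Z)"
    and cont_q: "continuous_map (prod_topology I01 L) Y q"
    and q_0: "\<And>l. l \<in> topspace L \<Longrightarrow> q (0, l) = i (\<phi> l)"
    and q_1: "\<And>l. l \<in> topspace L \<Longrightarrow> q (1, l) = p"
    and p_in: "p \<in> topspace Y" and inj_q: "inj_on q ({0<..<1} \<times> topspace L)"
    and disjoint: "i ` topspace Z \<inter> q ` ({0<..<1} \<times> topspace L) = {}"
      "p \<notin> i ` topspace Z" "p \<notin> q ` ({0<..<1} \<times> topspace L)"
    and cover: "topspace Y \<subseteq> insert p (i ` topspace Z \<union> q ` ({0<..<1} \<times> topspace L))"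
begin

text \<open>Glues a map out of the cone from \<open>u\<close> on the base, \<open>v\<close> on the
  open cone lines and \<open>w\<close> at the apex. The values of \<open>v\<close> at the ends t = 0
  and t = 1 are not consulted; their agreement with \<open>u\<close> and \<open>w\<close> becomes a
  hypothesis where it matters.\<close>

definition ext :: "('z \<Rightarrow> 'w) \<Rightarrow> (real \<times> 'l \<Rightarrow> 'w) \<Rightarrow> 'w \<Rightarrow> 'y \<Rightarrow> 'w" where
  "ext u v w y = (if y \<in> i ` topspace Z then u (inv_into (topspace Z) i y)
     else if y = p then w else v (inv_into ({0<..<1} \<times> topspace L) q y))"

lemma ext_i: "z \<in> topspace Z \<Longrightarrow> ext u v w (i z) = u z"
  by (simp add: ext_def inj_i)

lemma \<phi>_in: "l \<in> topspace L \<Longrightarrow> \<phi> l \<in> topspace Z"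
  using cont_\<phi> continuous_map_image_subset_topspace by fast

lemma ext_p: "ext u v w p = w"
  using disjoint by (simp add: ext_def)

lemma ext_q:
  assumes "t \<in> {0..1}" "l \<in> topspace L" "v (0, l) = u (\<phi> l)" "v (1, l) = w"
  shows "ext u v w (q (t, l)) = v (t, l)"
proof -
  consider "t = 0" | "t = 1" | "t \<in> {0<..<1}" using assms(1) by fastforce
  then show ?thesis
  proof cases
    case 1
    then show ?thesis using assms q_0 ext_i[OF \<phi>_in] by simp
  next
    case 2
    then show ?thesis using assms q_1 ext_p by simp
  next
    case 3
    then have tl: "(t, l) \<in> {0<..<1} \<times> topspace L" using assms by simp
    then have "q (t, l) \<notin> i ` topspace Z" "q (t, l) \<noteq> p" using disjoint by blast+
    then show ?thesis using tl by (simp add: ext_def inv_into_f_f[OF inj_q])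
  qed
qed

lemma ext_cases:
  assumes "y \<in> topspace Y"
  obtains z where "z \<in> topspace Z" "y = i z"
  | t l where "t \<in> {0..1}" "l \<in> topspace L" "y = q (t, l)"
  | "y = p"
proof -
  consider "y = p" | "y \<in> i ` topspace Z" | "y \<in> q ` ({0<..<1} \<times> topspace L)"
    using assms cover by blast
  then show ?thesis
  proof cases
    case 3
    then obtain t l where "y = q (t, l)" "0 < t" "t < 1" "l \<in> topspace L" by auto
    then show ?thesis using that(2)[of t l] by simp
  qed (use that in auto)
qed

text \<open>The homotopy parameter \<open>s\<close> is built in, so that one gluing argument serves
  both for maps (constant families) and for homotopies out of the cone.\<close>

lemma continuous_map_homotopy_ext:
  assumes U: "continuous_map (prod_topology I01 Z) W (\<lambda>(s, z). U s z)"
    and V: "continuous_map (prod_topology I01 (prod_topology I01 L)) W (\<lambda>(s, x). V s x)"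
    and w: "continuous_map I01 W w"
    and V0: "\<And>s l. s \<in> {0..1} \<Longrightarrow> l \<in> topspace L \<Longrightarrow> V s (0, l) = U s (\<phi> l)"
    and V1: "\<And>s l. s \<in> {0..1} \<Longrightarrow> l \<in> topspace L \<Longrightarrow> V s (1, l) = w s"
  shows "continuous_map (prod_topology I01 Y) W (\<lambda>(s, y). ext (U s) (V s) (w s) y)"
proof -
  let ?e = "\<lambda>(s, y). ext (U s) (V s) (w s) y"
  let ?q1 = "\<lambda>x. (fst x, i (snd x))" and ?q2 = "\<lambda>x. (fst x, q (snd x))" and ?q3 = "\<lambda>s. (s, p)"
  have I: "compact_space I01" "Hausdorff_space I01"
    by (auto simp: compact_space_subtopology Hausdorff_space_subtopology)
  show ?thesis
  proof (rule continuous_map_from_compact_cover[where ?K1.0 = "prod_topology I01 Z"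
        and ?K2.0 = "prod_topology I01 (prod_topology I01 L)" and ?K3.0 = I01
        and ?q1.0 = ?q1 and ?q2.0 = ?q2 and ?q3.0 = ?q3])
  show "Hausdorff_space (prod_topology I01 Y)"
    using I Hausdorff by (simp add: Hausdorff_space_prod_topology)
  show "compact_space (prod_topology I01 Z)" "compact_space (prod_topology I01 (prod_topology I01 L))"
    "compact_space I01"
    using I compact_Z compact_L by (simp_all add: compact_space_prod_topology)
  show "continuous_map (prod_topology I01 Z) (prod_topology I01 Y) ?q1"
    "continuous_map (prod_topology I01 (prod_topology I01 L)) (prod_topology I01 Y) ?q2"
    "continuous_map I01 (prod_topology I01 Y) ?q3"
    using p_in continuous_map_compose[OF continuous_map_snd cont_i]
      continuous_map_compose[OF continuous_map_snd cont_q]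
    by (simp_all add: continuous_map_paired continuous_map_fst o_def del: topspace_prod_topology)
  show "topspace (prod_topology I01 Y) \<subseteq> ?q1 ` topspace (prod_topology I01 Z)
     \<union> ?q2 ` topspace (prod_topology I01 (prod_topology I01 L)) \<union> ?q3 ` topspace I01"
  proof
    fix x assume "x \<in> topspace (prod_topology I01 Y)"
    then obtain s y where x: "x = (s, y)" "s \<in> {0..1}" "y \<in> topspace Y" by auto
    from x(3) show "x \<in> ?q1 ` topspace (prod_topology I01 Z)
       \<union> ?q2 ` topspace (prod_topology I01 (prod_topology I01 L)) \<union> ?q3 ` topspace I01"
    proof (cases rule: ext_cases)
      case (1 z)
      then have "x = ?q1 (s, z)" "(s, z) \<in> topspace (prod_topology I01 Z)" using x by auto
      then show ?thesis by blast
    next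
      case (2 t l)
      then have "x = ?q2 (s, t, l)" "(s, t, l) \<in> topspace (prod_topology I01 (prod_topology I01 L))"
        using x by auto
      then show ?thesis by blast
    qed (use x in simp)
  qed
  show "continuous_map (prod_topology I01 Z) W (?e \<circ> ?q1)"
    by (rule continuous_map_eq[OF U]) (auto simp: ext_i)
  show "continuous_map (prod_topology I01 (prod_topology I01 L)) W (?e \<circ> ?q2)"
    by (rule continuous_map_eq[OF V]) (auto simp: ext_q V0 V1)
  show "continuous_map I01 W (?e \<circ> ?q3)"
    by (rule continuous_map_eq[OF w]) (auto simp: ext_p)
  qed
qed

lemma continuous_map_ext:
  assumes u: "continuous_map Z W u" and v: "continuous_map (prod_topology I01 L) W v"
    and w: "w \<in> topspace W"
    and v0: "\<And>l. l \<in> topspace L \<Longrightarrow> v (0, l) = u (\<phi> l)" and v1: "\<And>l. l \<in> topspace L \<Longrightarrow> v (1, l) = w"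
  shows "continuous_map Y W (ext u v w)"
proof -
  have "continuous_map (prod_topology I01 Y) W (\<lambda>(s, y). ext u v w y)"
  proof (rule continuous_map_homotopy_ext[where U = "\<lambda>_. u" and V = "\<lambda>_. v" and w = "\<lambda>_. w"])
    show "continuous_map (prod_topology I01 Z) W (\<lambda>(s, z). u z)"
      using continuous_map_compose[OF continuous_map_snd u] by (simp add: o_def case_prod_unfold)
    show "continuous_map (prod_topology I01 (prod_topology I01 L)) W (\<lambda>(s, x). v x)"
      using continuous_map_compose[OF continuous_map_snd v] by (simp add: o_def case_prod_unfold)
  qed (use assms in auto)
  then have "continuous_map Y W ((\<lambda>(s, y). ext u v w y) \<circ> Pair (0::real))"
    by (rule continuous_map_o_Pair) simp
  then show ?thesis by (simp add: o_def)
qed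

lemma homotopicI:
  assumes U: "continuous_map (prod_topology I01 Z) W (\<lambda>(s, z). U s z)"
    and V: "continuous_map (prod_topology I01 (prod_topology I01 L)) W (\<lambda>(s, x). V s x)"
    and w: "continuous_map I01 W w"
    and V0: "\<And>s l. s \<in> {0..1} \<Longrightarrow> l \<in> topspace L \<Longrightarrow> V s (0, l) = U s (\<phi> l)"
    and V1: "\<And>s l. s \<in> {0..1} \<Longrightarrow> l \<in> topspace L \<Longrightarrow> V s (1, l) = w s"
    and a: "\<And>z. z \<in> topspace Z \<Longrightarrow> a (i z) = U 0 z"
      "\<And>t l. t \<in> {0..1} \<Longrightarrow> l \<in> topspace L \<Longrightarrow> a (q (t, l)) = V 0 (t, l)" "a p = w 0"
    and b: "\<And>z. z \<in> topspace Z \<Longrightarrow> b (i z) = U 1 z"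
      "\<And>t l. t \<in> {0..1} \<Longrightarrow> l \<in> topspace L \<Longrightarrow> b (q (t, l)) = V 1 (t, l)" "b p = w 1"
  shows "htp Y W a b"
proof -
  have e: "htp Y W (ext (U 0) (V 0) (w 0)) (ext (U 1) (V 1) (w 1))"
    unfolding homotopic_with_def using continuous_map_homotopy_ext[OF U V w V0 V1]
    by (intro exI[of _ "\<lambda>(s, y). ext (U s) (V s) (w s) y"]) simp_all
  show ?thesis
  proof (rule htp_cong[OF e])
    show "ext (U 0) (V 0) (w 0) y = a y" if "y \<in> topspace Y" for y
      using that by (rule ext_cases) (auto simp: ext_i ext_q ext_p a V0 V1)
    show "ext (U 1) (V 1) (w 1) y = b y" if "y \<in> topspace Y" for y
      using that by (rule ext_cases) (auto simp: ext_i ext_q ext_p b V0 V1)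
  qed
qed

text \<open>Lets a cone serve as the base of the next one.\<close>

lemma compact_space: "compact_space Y"
proof -
  have "compactin Y (i ` topspace Z)" "compactin Y (q ` topspace (prod_topology I01 L))" "compactin Y {p}"
    using image_compactin[OF _ cont_i] image_compactin[OF _ cont_q] compact_Z compact_L p_in
    by (simp_all add: compact_space_prod_topology compact_space_subtopology del: topspace_prod_topology
        flip: compact_space_def)
  then have "compactin Y (i ` topspace Z \<union> q ` topspace (prod_topology I01 L) \<union> {p})"
    by (intro compactin_Un)
  moreover have "topspace Y \<subseteq> i ` topspace Z \<union> q ` topspace (prod_topology I01 L) \<union> {p}"
  proof
    fix y assume "y \<in> topspace Y"
    then show "y \<in> i ` topspace Z \<union> q ` topspace (prod_topology I01 L) \<union> {p}"
      by (cases rule: ext_cases) auto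
  qed
  moreover have "i ` topspace Z \<union> q ` topspace (prod_topology I01 L) \<union> {p} \<subseteq> topspace Y"
    using calculation(1) by (rule compactin_subset_topspace)
  ultimately show ?thesis unfolding compact_space_def by (metis subset_antisym)
qed

end

lemma (in mapping_cone) eq_onI:
  assumes "\<And>z. z \<in> topspace Z \<Longrightarrow> a (i z) = b (i z)"
    and "\<And>t l. t \<in> {0..1} \<Longrightarrow> l \<in> topspace L \<Longrightarrow> a (q (t, l)) = b (q (t, l))"
    and "a p = b p" and "y \<in> topspace Y"
  shows "a y = b y"
  using assms(4) by (rule ext_cases) (simp_all add: assms(1-3))

lemma (in mapping_cone) q_in: "t \<in> {0..1} \<Longrightarrow> l \<in> topspace L \<Longrightarrow> q (t, l) \<in> topspace Y"
  using continuous_map_image_subset_topspace[OF cont_q] by (auto simp: image_subset_iff)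

section \<open>Reparametrizing and concatenating along cone lines\<close>

lemma continuous_map_square_interval:
  assumes "continuous_on ({0..1} \<times> {0..1}) \<theta>" and "\<theta> ` ({0..1} \<times> {0..1}) \<subseteq> {0..1::real}"
  shows "continuous_map (prod_topology I01 (prod_topology I01 L)) I01 (\<lambda>(s, t, l). \<theta> (s, t))"
proof -
  have sq: "prod_topology I01 I01 = top_of_set ({0..1::real} \<times> {0..1::real})"
    using subtopology_Times[of euclideanreal euclideanreal "{0..1}" "{0..1}"]
    by (simp only: prod_topology_euclidean)
  have "continuous_map (prod_topology I01 (prod_topology I01 L)) I01 (fst \<circ> snd)"
    by (rule continuous_map_compose[OF continuous_map_snd continuous_map_fst])
  from continuous_map_pairedI[OF continuous_map_fst this]
  have "continuous_map (prod_topology I01 (prod_topology I01 L)) (top_of_set ({0..1} \<times> {0..1})) (\<lambda>x. (fst x, fst (snd x)))"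
    unfolding sq o_def .
  moreover have "continuous_map (top_of_set ({0..1} \<times> {0..1})) I01 \<theta>"
    using assms by (auto simp: continuous_map_in_subtopology)
  ultimately have "continuous_map (prod_topology I01 (prod_topology I01 L)) I01 (\<theta> \<circ> (\<lambda>x. (fst x, fst (snd x))))"
    by (rule continuous_map_compose)
  then show ?thesis by (simp only: o_def case_prod_unfold)
qed

lemma continuous_map_reparametrize:
  assumes v: "continuous_map (prod_topology I01 L) W v"
    and "continuous_on ({0..1} \<times> {0..1}) \<theta>" "\<theta> ` ({0..1} \<times> {0..1}) \<subseteq> {0..1::real}"
  shows "continuous_map (prod_topology I01 (prod_topology I01 L)) W (\<lambda>(s, t, l). v (\<theta> (s, t), l))"
proof -
  have "continuous_map (prod_topology I01 (prod_topology I01 L)) L (snd \<circ> snd)"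
    by (rule continuous_map_compose[OF continuous_map_snd continuous_map_snd])
  from continuous_map_compose[OF continuous_map_pairedI[OF continuous_map_square_interval[OF assms(2,3)] this] v]
  show ?thesis by (simp only: o_def case_prod_unfold)
qed

lemma continuous_map_reparametrize1:
  assumes v: "continuous_map (prod_topology I01 L) W v"
    and \<theta>: "continuous_on {0..1} \<theta>" "\<theta> ` {0..1} \<subseteq> {0..1::real}"
  shows "continuous_map (prod_topology I01 L) W (\<lambda>(t, l). v (\<theta> t, l))"
proof -
  have "continuous_map I01 I01 \<theta>"
    using \<theta> by (auto simp: continuous_map_in_subtopology)
  from continuous_map_compose[OF continuous_map_pairedI[OF continuous_map_compose[OF continuous_map_fst this]
      continuous_map_snd] v]
  show ?thesis by (simp only: o_def case_prod_unfold)
qed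

definition join :: "(real \<times> 'l \<Rightarrow> 'w) \<Rightarrow> (real \<times> 'l \<Rightarrow> 'w) \<Rightarrow> real \<times> 'l \<Rightarrow> 'w" where
  "join u v = (\<lambda>(t, l). if t \<le> 1/2 then u (2 * t, l) else v (2 * t - 1, l))"

lemma continuous_map_join:
  assumes u: "continuous_map (prod_topology I01 L) W u" and v: "continuous_map (prod_topology I01 L) W v"
    and uv: "\<And>l. l \<in> topspace L \<Longrightarrow> u (1, l) = v (0, l)"
  shows "continuous_map (prod_topology I01 L) W (join u v)"
proof -
  \<comment> \<open>The clamps \<open>min 1\<close> and \<open>max 0\<close> keep the parameter in
    the unit interval, so that each branch is continuous on the whole product; on its own half it
    agrees with \<open>join\<close>.\<close>
  have "continuous_map (prod_topology I01 L) W
     (\<lambda>x. if fst x \<le> 1/2 then (\<lambda>(t, l). u (min 1 (2 * t), l)) x else (\<lambda>(t, l). v (max 0 (2 * t - 1), l)) x)"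
  proof (rule continuous_map_cases_le)
    show "continuous_map (prod_topology I01 L) euclideanreal fst"
      using continuous_map_fst continuous_map_into_fulltopology by blast
    show "continuous_map (subtopology (prod_topology I01 L) {x \<in> topspace (prod_topology I01 L). fst x \<le> 1/2}) W
        (\<lambda>(t, l). u (min 1 (2 * t), l))"
      by (intro continuous_map_from_subtopology continuous_map_reparametrize1[OF u] continuous_intros) auto
    show "continuous_map (subtopology (prod_topology I01 L) {x \<in> topspace (prod_topology I01 L). 1/2 \<le> fst x}) W
        (\<lambda>(t, l). v (max 0 (2 * t - 1), l))"
      by (intro continuous_map_from_subtopology continuous_map_reparametrize1[OF v] continuous_intros) auto
  qed (auto simp: uv)
  then show ?thesis
    by (rule continuous_map_eq) (auto simp: join_def)
qed

lemma htp_obtain: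
  assumes "htp X Y f g"
  obtains h where "continuous_map (prod_topology I01 X) Y h" "\<And>x. h (0, x) = f x" "\<And>x. h (1, x) = g x"
  using assms unfolding homotopic_with_def by blast

text \<open>With \<open>c\<close> contracting the link to \<open>a\<close>, the retraction sends the
  point at height t over \<open>l\<close> to \<open>\<phi> (c (t, l))\<close>. The base stays fixed,
  and the apex has the well-defined image \<open>\<phi> a\<close>.\<close>

theorem mapping_cone_contractible:
  assumes "mapping_cone Z L \<phi> Y i q p"
    and L: "contractible_space L" "topspace L \<noteq> {}"
  obtains r where "homotopy_equivalence Y Z r" "\<And>z. z \<in> topspace Z \<Longrightarrow> r (i z) = z"
proof -
  interpret mapping_cone Z L \<phi> Y i q p by fact
  obtain a where "htp L L id (\<lambda>x. a)"
    using L(1) unfolding contractible_space_def by blast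
  then obtain c where c: "continuous_map (prod_topology I01 L) L c" and c0: "\<And>x. c (0, x) = x" and c1: "\<And>x. c (1, x) = a"
    by (rule htp_obtain) simp
  \<comment> \<open>The constant \<open>a\<close> supplied by contractibility is known to lie in
    \<open>L\<close> only through a point that is moved to it.\<close>
  obtain l' where l': "l' \<in> topspace L" using L(2) by blast
  have c_in: "c (t, l) \<in> topspace L" if "t \<in> {0..1}" "l \<in> topspace L" for t l
    using continuous_map_image_subset_topspace[OF c] that by (auto simp: image_subset_iff)
  have a: "a \<in> topspace L"
    using c_in[of 1 l'] l' c1 by simp
  define r where "r = ext id (\<lambda>x. \<phi> (c x)) (\<phi> a)"
  have r: "continuous_map Y Z r"
    unfolding r_def using continuous_map_compose[OF c cont_\<phi>] a
    by (intro continuous_map_ext) (simp_all add: o_def c0 c1 \<phi>_in)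
  have ri: "r (i z) = z" if "z \<in> topspace Z" for z
    unfolding r_def using that by (simp add: ext_i)
  have rq: "r (q (t, l)) = \<phi> (c (t, l))" if "t \<in> {0..1}" "l \<in> topspace L" for t l
    unfolding r_def using that by (subst ext_q) (simp_all add: c0 c1)
  have rp: "r p = \<phi> a" unfolding r_def by (rule ext_p)
  \<comment> \<open>For \<open>s\<close> up to 1/2 the height t stays and the link point moves along
    \<open>c\<close> up to time t; afterwards the height shrinks to 0. At t = 1 the track is first
    constantly the apex and then descends the line over \<open>a\<close>, independently of
    \<open>l\<close>.\<close>
  have "htp Y Y id (i \<circ> r)"
  proof (rule homotopicI[where U = "\<lambda>s z. i z" and w = "\<lambda>s. q (min 1 (2 - 2 * s), a)"
        and V = "\<lambda>s (t, l). q (t * min 1 (2 - 2 * s), c (t * min 1 (2 * s), l))"])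
    show "continuous_map (prod_topology I01 Z) Y (\<lambda>(s, z). i z)"
      using continuous_map_compose[OF continuous_map_snd cont_i] by (simp add: o_def case_prod_unfold)
    have m: "0 \<le> t * b \<and> t * b \<le> 1" if "0 \<le> t" "t \<le> 1" "0 \<le> b" "b \<le> 1" for t b :: real
      using that by (simp add: mult_le_one)
    have c': "continuous_map (prod_topology I01 (prod_topology I01 L)) L (\<lambda>(s, t, l). c ((\<lambda>(s, t). t * min 1 (2 * s)) (s, t), l))"
      by (rule continuous_map_reparametrize[OF c])
         (auto intro!: continuous_intros m[THEN conjunct1] m[THEN conjunct2] simp: case_prod_unfold)
    have b': "continuous_map (prod_topology I01 (prod_topology I01 L)) I01 (\<lambda>(s, t, l). (\<lambda>(s, t). t * min 1 (2 - 2 * s)) (s, t))"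
      by (rule continuous_map_square_interval)
         (auto intro!: continuous_intros m[THEN conjunct1] m[THEN conjunct2] simp: case_prod_unfold)
    show "continuous_map (prod_topology I01 (prod_topology I01 L)) Y
        (\<lambda>(s, x). (\<lambda>(t, l). q (t * min 1 (2 - 2 * s), c (t * min 1 (2 * s), l))) x)"
      using continuous_map_compose[OF continuous_map_pairedI[OF b' c'] cont_q]
      by (simp add: o_def case_prod_unfold)
    have "continuous_map I01 (prod_topology I01 L) (\<lambda>s. (min 1 (2 - 2 * s), a))"
      by (auto intro!: continuous_intros simp: continuous_map_paired a continuous_map_in_subtopology)
    from continuous_map_compose[OF this cont_q]
    show "continuous_map I01 Y (\<lambda>s. q (min 1 (2 - 2 * s), a))" by (simp add: o_def)
    show "(\<lambda>(t, l). q (t * min 1 (2 - 2 * s), c (t * min 1 (2 * s), l))) (1, l) = q (min 1 (2 - 2 * s), a)"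
      if "s \<in> {0..1}" "l \<in> topspace L" for s l
      using that a c_in[of "2 * s" l] q_1 c1 by (cases "s \<le> 1/2") (auto simp: min_def)
  qed (auto simp: c0 c1 ri rq rp a q_0 q_1 c_in)
  then have "homotopy_equivalence Y Z r"
    unfolding homotopy_equivalence_def using r cont_i htp_eq[of Z Z id] ri
    by (metis (mono_tags, lifting) comp_apply continuous_map_id homotopic_with_symD id_apply)
  then show ?thesis using ri that by blast
qed

section \<open>Homotopy invariance of mapping cones\<close>

lemma continuous_map_snd_compose:
  "continuous_map X W f \<Longrightarrow> continuous_map (prod_topology T X) W (\<lambda>(s, x). f x)"
  using continuous_map_compose[OF continuous_map_snd, of X W f T] by (simp only: o_def case_prod_unfold)

lemma continuous_map_map_snd:
  assumes "continuous_map (prod_topology I01 Z) W a" "continuous_map L Z f"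
  shows "continuous_map (prod_topology I01 L) W (\<lambda>(t, l). a (t, f l))"
proof -
  from continuous_map_compose[OF continuous_map_pairedI[OF continuous_map_fst
      continuous_map_compose[OF continuous_map_snd assms(2)]] assms(1)]
  show ?thesis by (simp only: o_def case_prod_unfold)
qed

lemma continuous_map_reverse:
  assumes "continuous_map (prod_topology I01 L) W h"
  shows "continuous_map (prod_topology I01 L) W (\<lambda>(t, l). h (1 - t, l))"
  by (rule continuous_map_reparametrize1[OF assms]) (auto intro!: continuous_intros)

lemma interpolate_in_interval:
  assumes "s \<in> {0..1}" "a \<in> {0..1}" "b \<in> {0..1::real}"
  shows "(1 - s) * a + s * b \<in> {0..1}"
proof -
  have "(1 - s) * a + s * b \<le> (1 - s) * 1 + s * 1"
    using assms by (intro add_mono mult_left_mono) auto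
  then show ?thesis using assms by simp
qed

lemma continuous_map_interpolate:
  assumes v: "continuous_map (prod_topology I01 L) W v"
    and a: "continuous_on {0..1} a" "a ` {0..1} \<subseteq> {0..1::real}"
    and b: "continuous_on {0..1} b" "b ` {0..1} \<subseteq> {0..1::real}"
  shows "continuous_map (prod_topology I01 (prod_topology I01 L)) W
    (\<lambda>(s, t, l). v ((1 - s) * a t + s * b t, l))"
proof -
  have "continuous_map (prod_topology I01 (prod_topology I01 L)) W
    (\<lambda>(s, t, l). v ((\<lambda>x. (1 - fst x) * a (snd x) + fst x * b (snd x)) (s, t), l))"
  proof (rule continuous_map_reparametrize[OF v])
    show "continuous_on ({0..1} \<times> {0..1}) (\<lambda>x. (1 - fst x) * a (snd x) + fst x * b (snd x))"
      by (intro continuous_intros continuous_on_compose2[OF a(1)] continuous_on_compose2[OF b(1)]) auto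
    show "(\<lambda>x. (1 - fst x) * a (snd x) + fst x * b (snd x)) ` ({0..1} \<times> {0..1}) \<subseteq> {0..1}"
      using a(2) b(2) by (auto simp: image_subset_iff intro!: interpolate_in_interval simp del: atLeastAtMost_iff)
  qed
  then show ?thesis by (simp only: fst_conv snd_conv)
qed

text \<open>The composites shown homotopic to the identity here have the form \<open>q (t, l) \<mapsto> e (\<mu> t, l)\<close> on the cone lines, where \<open>e\<close> is
  the cone of the target preceded by the track of a homotopy in its base; they are deformed by
  interpolating \<open>\<mu>\<close> linearly to the parametrization of the upper half of \<open>e\<close>.\<close>

lemma transport_retraction:
  assumes "mapping_cone Z L \<phi> Y i q p" and "mapping_cone Z L \<phi>' Y' i' q' p'"
    and h: "continuous_map (prod_topology I01 L) Z h"
    and h0: "\<And>l. l \<in> topspace L \<Longrightarrow> h (0, l) = \<phi> l" and h1: "\<And>l. l \<in> topspace L \<Longrightarrow> h (1, l) = \<phi>' l"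
    and a: "\<And>z. z \<in> topspace Z \<Longrightarrow> a (i z) = i' z"
      "\<And>t l. t \<in> {0..1} \<Longrightarrow> l \<in> topspace L \<Longrightarrow> a (q (t, l)) = join (i' \<circ> h) q' (t, l)" "a p = p'"
    and b: "\<And>z. z \<in> topspace Z \<Longrightarrow> b (i' z) = i z"
      "\<And>t l. t \<in> {0..1} \<Longrightarrow> l \<in> topspace L \<Longrightarrow>
         b (q' (t, l)) = join (i \<circ> (\<lambda>(t, l). h (1 - t, l))) q (t, l)" "b p' = p"
  shows "htp Y Y (b \<circ> a) id"
proof -
  interpret mapping_cone Z L \<phi> Y i q p by fact
  interpret C': mapping_cone Z L \<phi>' Y' i' q' p' by fact
  define e where "e = join (i \<circ> (\<lambda>(t, l). h (1 - t, l))) q"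
  have e: "continuous_map (prod_topology I01 L) Y e"
    unfolding e_def
    by (intro continuous_map_join continuous_map_compose[OF continuous_map_reverse[OF h] cont_i] cont_q)
       (simp add: h0 q_0)
  have h_in: "h (t, l) \<in> topspace Z" if "t \<in> {0..1}" "l \<in> topspace L" for t l
    using continuous_map_image_subset_topspace[OF h] that by (auto simp: image_subset_iff)
  \<comment> \<open>On a cone line, \<open>b \<circ> a\<close> follows \<open>e\<close> backwards
    from 1/2 to 0 while t \<le> 1/2 (the track of \<open>h\<close>, undone) and then forwards from 0
    to 1; both halves are recorded by \<open>max (1/2 - t) (2 * t - 1)\<close>. The identity is
    \<open>e\<close> at 1/2 + t/2. Both parameters start at 1/2 and end at 1, so interpolating them
    fixes base and apex.\<close>
  show ?thesis
  proof (rule homotopicI[where U = "\<lambda>s z. i z" and w = "\<lambda>s. p"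
        and V = "\<lambda>s (t, l). e ((1 - s) * max (1/2 - t) (2 * t - 1) + s * (1/2 + t/2), l)"])
    show "continuous_map (prod_topology I01 Z) Y (\<lambda>(s, z). i z)"
      by (rule continuous_map_snd_compose[OF cont_i])
    show "continuous_map (prod_topology I01 (prod_topology I01 L)) Y
        (\<lambda>(s, x). (\<lambda>(t, l). e ((1 - s) * max (1/2 - t) (2 * t - 1) + s * (1/2 + t/2), l)) x)"
      by (rule continuous_map_interpolate[OF e]) (auto intro!: continuous_intros)
    show "(b \<circ> a) (q (t, l)) = (\<lambda>(t, l). e ((1 - 0) * max (1/2 - t) (2 * t - 1) + 0 * (1/2 + t/2), l)) (t, l)"
      if "t \<in> {0..1}" "l \<in> topspace L" for t l
    proof (cases "t = 1/2")
      case True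
      show ?thesis unfolding True using that by (simp add: a b e_def join_def h_in)
    qed (use that in \<open>auto simp: a b e_def join_def h_in max_def\<close>)
    show "id (q (t, l)) = (\<lambda>(t, l). e ((1 - 1) * max (1/2 - t) (2 * t - 1) + 1 * (1/2 + t/2), l)) (t, l)"
      if "t \<in> {0..1}" "l \<in> topspace L" for t l
      using that by (auto simp: e_def join_def h0 q_0)
    fix s :: real and l assume "s \<in> {0..1}" "l \<in> topspace L"
    have "(1 - s) * max (1/2 - 0) (2 * 0 - 1) + s * (1/2 + 0/2) = 1/2"
      by (simp add: field_simps)
    then show "(\<lambda>(t, l). e ((1 - s) * max (1/2 - t) (2 * t - 1) + s * (1/2 + t/2), l)) (0, l) = i (\<phi> l)"
      using \<open>l \<in> topspace L\<close> by (simp only: case_prod_conv) (simp add: e_def join_def h0)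
  qed (use p_in in \<open>auto simp: e_def join_def a b h0 q_0 q_1\<close>)
qed

text \<open>A cone line is sent first along the track of \<open>h\<close> inside the base and then
  up the target cone; this repairs the mismatch between the two attaching maps while extending the
  identity of the base.\<close>

lemma transport_exists:
  assumes "mapping_cone Z L \<phi> Y i q p" and "mapping_cone Z L \<phi>' Y' i' q' p'"
    and h: "continuous_map (prod_topology I01 L) Z h"
    and h0: "\<And>l. l \<in> topspace L \<Longrightarrow> h (0, l) = \<phi> l" and h1: "\<And>l. l \<in> topspace L \<Longrightarrow> h (1, l) = \<phi>' l"
  obtains a where "continuous_map Y Y' a" "\<And>z. z \<in> topspace Z \<Longrightarrow> a (i z) = i' z"
      "\<And>t l. t \<in> {0..1} \<Longrightarrow> l \<in> topspace L \<Longrightarrow> a (q (t, l)) = join (i' \<circ> h) q' (t, l)" "a p = p'"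
proof -
  interpret mapping_cone Z L \<phi> Y i q p by fact
  interpret C': mapping_cone Z L \<phi>' Y' i' q' p' by fact
  let ?a = "ext i' (join (i' \<circ> h) q') p'"
  show ?thesis
  proof
    show "continuous_map Y Y' ?a"
    proof (rule continuous_map_ext)
      show "continuous_map (prod_topology I01 L) Y' (join (i' \<circ> h) q')"
        by (intro continuous_map_join continuous_map_compose[OF h C'.cont_i] C'.cont_q)
          (simp add: h1 C'.q_0)
    qed (use C'.cont_i C'.p_in C'.q_1 h0 in \<open>auto simp: join_def\<close>)
    show "?a (q (t, l)) = join (i' \<circ> h) q' (t, l)" if "t \<in> {0..1}" "l \<in> topspace L" for t l
      using that C'.q_1 h0 by (intro ext_q) (auto simp: join_def)
  qed (auto simp: ext_i ext_p)
qed

text \<open>The inverse is transport along the reversed homotopy. Reversing twice gives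
  \<open>h\<close> again, so the same retraction lemma applies on both sides.\<close>

theorem mapping_cone_homotopic:
  assumes Y: "mapping_cone Z L \<phi> Y i q p" and Y': "mapping_cone Z L \<phi>' Y' i' q' p'"
    and h: "continuous_map (prod_topology I01 L) Z h"
    and h0: "\<And>l. l \<in> topspace L \<Longrightarrow> h (0, l) = \<phi> l" and h1: "\<And>l. l \<in> topspace L \<Longrightarrow> h (1, l) = \<phi>' l"
    and cont: "continuous_map Y Y' a"
    and a: "\<And>z. z \<in> topspace Z \<Longrightarrow> a (i z) = i' z"
      "\<And>t l. t \<in> {0..1} \<Longrightarrow> l \<in> topspace L \<Longrightarrow> a (q (t, l)) = join (i' \<circ> h) q' (t, l)" "a p = p'"
  shows "homotopy_equivalence Y Y' a"
proof -
  let ?h = "\<lambda>(t, l). h (1 - t, l)"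
  have h': "continuous_map (prod_topology I01 L) Z ?h"
    by (rule continuous_map_reverse[OF h])
  have h'0: "\<And>l. l \<in> topspace L \<Longrightarrow> ?h (0, l) = \<phi>' l" and h'1: "\<And>l. l \<in> topspace L \<Longrightarrow> ?h (1, l) = \<phi> l"
    using h0 h1 by simp_all
  obtain b where cont': "continuous_map Y' Y b" and b: "\<And>z. z \<in> topspace Z \<Longrightarrow> b (i' z) = i z"
      "\<And>t l. t \<in> {0..1} \<Longrightarrow> l \<in> topspace L \<Longrightarrow> b (q' (t, l)) = join (i \<circ> ?h) q (t, l)" "b p' = p"
    by (rule transport_exists[OF Y' Y h' h'0 h'1]) simp_all
  have "htp Y Y (b \<circ> a) id"
    by (rule transport_retraction[OF Y Y' h h0 h1 a b])
  moreover have "htp Y' Y' (a \<circ> b) id"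
  proof (rule transport_retraction[OF Y' Y h' h'0 h'1 b])
    show "a (q (t, l)) = join (i' \<circ> (\<lambda>(t, l). ?h (1 - t, l))) q' (t, l)"
      if "t \<in> {0..1}" "l \<in> topspace L" for t l
      using a(2)[OF that] by (simp add: join_def)
  qed (use a in simp_all)
  ultimately show ?thesis
    unfolding homotopy_equivalence_def using cont cont' by blast
qed

text \<open>The retraction of the cone over \<open>Z'\<close> factors through the
  cone of the same shape over \<open>Z\<close>, which gives it a homotopy inverse on the other side as well.\<close>

lemma base_change_retraction:
  assumes "mapping_cone Z L \<phi> Y i q p" and "mapping_cone Z' L (f \<circ> \<phi>) Y' i' q' p'"
    and f: "continuous_map Z Z' f"
    and \<alpha>: "continuous_map (prod_topology I01 Z) Z \<alpha>"
    and \<alpha>0: "\<And>z. z \<in> topspace Z \<Longrightarrow> \<alpha> (0, z) = g (f z)" and \<alpha>1: "\<And>z. z \<in> topspace Z \<Longrightarrow> \<alpha> (1, z) = z"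
    and a: "\<And>z. z \<in> topspace Z \<Longrightarrow> a (i z) = i' (f z)"
      "\<And>t l. t \<in> {0..1} \<Longrightarrow> l \<in> topspace L \<Longrightarrow> a (q (t, l)) = q' (t, l)" "a p = p'"
    and b: "\<And>z. z \<in> topspace Z' \<Longrightarrow> b (i' z) = i (g z)"
      "\<And>t l. t \<in> {0..1} \<Longrightarrow> l \<in> topspace L \<Longrightarrow>
         b (q' (t, l)) = join (\<lambda>(t, l). i (\<alpha> (t, \<phi> l))) q (t, l)" "b p' = p"
  shows "htp Y Y (b \<circ> a) id"
proof -
  interpret mapping_cone Z L \<phi> Y i q p by fact
  define e where "e = join (\<lambda>(t, l). i (\<alpha> (t, \<phi> l))) q"
  have e: "continuous_map (prod_topology I01 L) Y e"
    unfolding e_def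
    using continuous_map_compose[OF continuous_map_map_snd[OF \<alpha> cont_\<phi>] cont_i]
    by (intro continuous_map_join cont_q) (simp_all add: \<alpha>1 q_0 \<phi>_in o_def case_prod_unfold)
  have f_in: "f z \<in> topspace Z'" if "z \<in> topspace Z" for z
    using continuous_map_image_subset_topspace[OF f] that by fast
  \<comment> \<open>At t = 0 the parameter of \<open>e\<close> is s/2, where \<open>e\<close> equals
    \<open>i (\<alpha> (s, \<phi> l))\<close>: the feet of the cone lines move with the base during
    the homotopy.\<close>
  show ?thesis
  proof (rule homotopicI[where U = "\<lambda>s z. i (\<alpha> (s, z))" and w = "\<lambda>s. p"
        and V = "\<lambda>s (t, l). e ((1 - s) * t + s * (1/2 + t/2), l)"])
    show "continuous_map (prod_topology I01 Z) Y (\<lambda>(s, z). i (\<alpha> (s, z)))"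
      using continuous_map_compose[OF \<alpha> cont_i] by (simp add: o_def case_prod_unfold)
    show "continuous_map (prod_topology I01 (prod_topology I01 L)) Y
        (\<lambda>(s, x). (\<lambda>(t, l). e ((1 - s) * t + s * (1/2 + t/2), l)) x)"
      by (rule continuous_map_interpolate[OF e]) (auto intro!: continuous_intros)
    show "id (q (t, l)) = (\<lambda>(t, l). e ((1 - 1) * t + 1 * (1/2 + t/2), l)) (t, l)"
      if "t \<in> {0..1}" "l \<in> topspace L" for t l
      using that by (auto simp: e_def join_def \<alpha>1 q_0 \<phi>_in)
  qed (use p_in in \<open>auto simp: e_def join_def a b f_in \<phi>_in \<alpha>0 \<alpha>1 q_0 q_1\<close>)
qed

lemma base_change_exists:
  assumes "mapping_cone Z L \<phi> Y i q p" and "mapping_cone Z' L (f \<circ> \<phi>) Y' i' q' p'"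
    and f: "continuous_map Z Z' f"
  obtains a where "continuous_map Y Y' a" "\<And>z. z \<in> topspace Z \<Longrightarrow> a (i z) = i' (f z)"
    "\<And>t l. t \<in> {0..1} \<Longrightarrow> l \<in> topspace L \<Longrightarrow> a (q (t, l)) = q' (t, l)" "a p = p'"
proof -
  interpret mapping_cone Z L \<phi> Y i q p by fact
  interpret C': mapping_cone Z' L "f \<circ> \<phi>" Y' i' q' p' by fact
  let ?a = "ext (i' \<circ> f) q' p'"
  show ?thesis
  proof
    show "continuous_map Y Y' ?a"
      by (intro continuous_map_ext continuous_map_compose[OF f C'.cont_i] C'.cont_q C'.p_in)
        (simp_all add: C'.q_0 C'.q_1)
    show "?a (q (t, l)) = q' (t, l)" if "t \<in> {0..1}" "l \<in> topspace L" for t l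
      using that by (intro ext_q) (auto simp: C'.q_0 C'.q_1)
  qed (auto simp: ext_i ext_p)
qed

text \<open>\<open>Y2\<close> is attached by \<open>g \<circ> f \<circ> \<phi>\<close> and differs
  from \<open>Y\<close> only by a homotopy of attaching maps, giving the equivalence
  \<open>A\<close> with inverse \<open>B\<close>. The map \<open>A \<circ> F'\<close> back to
  \<open>Y\<close> has \<open>F\<close> as right inverse and \<open>?G \<circ> B\<close> as left
  inverse, so it is an equivalence, and then so is \<open>F\<close>.\<close>

lemma homotopy_equivalence_base_change:
  assumes Y: "mapping_cone Z L \<phi> Y i q p" and Y': "mapping_cone Z' L (f \<circ> \<phi>) Y' i' q' p'"
    and Y2: "mapping_cone Z L (g \<circ> (f \<circ> \<phi>)) Y2 i2 q2 p2"
    and f: "continuous_map Z Z' f" and g: "continuous_map Z' Z g"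
    and gf: "htp Z Z (g \<circ> f) id" and fg: "htp Z' Z' (f \<circ> g) id"
    and F: "continuous_map Y Y' F" "\<And>z. z \<in> topspace Z \<Longrightarrow> F (i z) = i' (f z)"
    "\<And>t l. t \<in> {0..1} \<Longrightarrow> l \<in> topspace L \<Longrightarrow> F (q (t, l)) = q' (t, l)" "F p = p'"
  shows "homotopy_equivalence Y Y' F"
proof -
  interpret mapping_cone Z L \<phi> Y i q p by fact
  interpret C': mapping_cone Z' L "f \<circ> \<phi>" Y' i' q' p' by fact
  interpret C2: mapping_cone Z L "g \<circ> (f \<circ> \<phi>)" Y2 i2 q2 p2 by fact
  obtain \<alpha> where \<alpha>: "continuous_map (prod_topology I01 Z) Z \<alpha>"
    and \<alpha>0: "\<And>x. \<alpha> (0, x) = (g \<circ> f) x" and \<alpha>1: "\<And>x. \<alpha> (1, x) = id x"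
    by (rule htp_obtain[OF gf]) blast
  obtain \<beta> where \<beta>: "continuous_map (prod_topology I01 Z') Z' \<beta>"
    and \<beta>0: "\<And>x. \<beta> (0, x) = (f \<circ> g) x" and \<beta>1: "\<And>x. \<beta> (1, x) = id x"
    by (rule htp_obtain[OF fg]) blast
  let ?h = "\<lambda>(t, l). \<alpha> (t, \<phi> l)"
  have h: "continuous_map (prod_topology I01 L) Z ?h"
    by (rule continuous_map_map_snd[OF \<alpha> cont_\<phi>])
  have h0: "?h (0, l) = (g \<circ> (f \<circ> \<phi>)) l" and h1: "?h (1, l) = \<phi> l" for l
    by (simp_all add: \<alpha>0 \<alpha>1)
  obtain A where A: "continuous_map Y2 Y A" "\<And>z. z \<in> topspace Z \<Longrightarrow> A (i2 z) = i z"
      "\<And>t l. t \<in> {0..1} \<Longrightarrow> l \<in> topspace L \<Longrightarrow> A (q2 (t, l)) = join (i \<circ> ?h) q (t, l)" "A p2 = p"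
    by (rule transport_exists[OF Y2 Y h h0 h1]) simp_all
  have "homotopy_equivalence Y2 Y A"
    by (rule mapping_cone_homotopic[OF Y2 Y h h0 h1 A])
  then obtain B where B: "continuous_map Y Y2 B" "htp Y2 Y2 (B \<circ> A) id"
    unfolding homotopy_equivalence_def by blast
  obtain F' where F': "continuous_map Y' Y2 F'" "\<And>z. z \<in> topspace Z' \<Longrightarrow> F' (i' z) = i2 (g z)"
    "\<And>t l. t \<in> {0..1} \<Longrightarrow> l \<in> topspace L \<Longrightarrow> F' (q' (t, l)) = q2 (t, l)" "F' p' = p2"
    by (rule base_change_exists[OF Y' Y2 g]) simp_all
  let ?h' = "\<lambda>(t, l). \<beta> (t, (f \<circ> \<phi>) l)"
  have h': "continuous_map (prod_topology I01 L) Z' ?h'"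
    by (rule continuous_map_map_snd[OF \<beta> C'.cont_\<phi>])
  \<comment> \<open>\<open>F'\<close> turns the attaching map \<open>f \<circ> \<phi>\<close> into
    \<open>g \<circ> f \<circ> \<phi>\<close>. Applying \<open>f\<close> again yields
    \<open>f \<circ> g \<circ> f \<circ> \<phi>\<close>, and \<open>\<beta>\<close> leads this back
    to \<open>f \<circ> \<phi>\<close>.\<close>
  let ?G = "C2.ext (i' \<circ> f) (join (i' \<circ> ?h') q') p'"
  have G: "continuous_map Y2 Y' ?G"
  proof (rule C2.continuous_map_ext[OF continuous_map_compose[OF f C'.cont_i]])
    show "continuous_map (prod_topology I01 L) Y' (join (i' \<circ> ?h') q')"
      by (intro continuous_map_join continuous_map_compose[OF h' C'.cont_i] C'.cont_q)
        (simp add: \<beta>1 C'.q_0)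
  qed (auto simp: C'.p_in C'.q_1 join_def \<beta>0)
  have GF': "htp Y' Y' (?G \<circ> F') id"
  proof (rule base_change_retraction[OF Y' Y2 g \<beta>, where g = f])
    show "?G (q2 (t, l)) = join (\<lambda>(t, l). i' (\<beta> (t, (f \<circ> \<phi>) l))) q' (t, l)"
      if "t \<in> {0..1}" "l \<in> topspace L" for t l
      using that by (subst C2.ext_q) (auto simp: join_def \<beta>0 C'.q_1)
  qed (simp_all add: \<beta>0 \<beta>1 F' C2.ext_i C2.ext_p)
  have g_in: "g z \<in> topspace Z" if "z \<in> topspace Z'" for z
    using continuous_map_image_subset_topspace[OF g] that by fast
  have AF: "htp Y Y ((A \<circ> F') \<circ> F) id"
  proof (rule base_change_retraction[OF Y Y' f \<alpha>, where g = g])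
    show "(A \<circ> F') (q' (t, l)) = join (\<lambda>(t, l). i (\<alpha> (t, \<phi> l))) q (t, l)"
      if "t \<in> {0..1}" "l \<in> topspace L" for t l
      using that by (simp add: F' A join_def)
  qed (simp_all add: \<alpha>0 \<alpha>1 F F' A g_in)
  have "htp Y' Y' (?G \<circ> (B \<circ> A) \<circ> F') (?G \<circ> id \<circ> F')"
    by (rule htp_compose[OF _ htp_compose[OF B(2)]]) (use G F' in simp_all)
  then have "htp Y' Y' ((?G \<circ> B) \<circ> (A \<circ> F')) (?G \<circ> F')"
    by (simp add: o_assoc)
  then have "htp Y' Y' ((?G \<circ> B) \<circ> (A \<circ> F')) id"
    using GF' by (rule homotopic_with_trans)
  then have "homotopy_equivalence Y' Y (A \<circ> F')"
    by (rule homotopy_equivalence_left_right[OF continuous_map_compose[OF F'(1) A(1)]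
        continuous_map_compose[OF B(1) G] F(1) _ AF])
  then show ?thesis
    by (rule homotopy_equivalence_right_inverse[OF _ F(1) AF])
qed

section \<open>Changing the link up to homotopy\<close>

lemma link_change_retraction:
  assumes "mapping_cone Z L \<phi> Y i q p" and "mapping_cone Z L' (\<phi> \<circ> g) Y' i' q' p'"
    and g': "continuous_map L L' g'"
    and \<delta>: "continuous_map (prod_topology I01 L) L \<delta>"
    and \<delta>0: "\<And>l. l \<in> topspace L \<Longrightarrow> \<delta> (0, l) = g (g' l)" and \<delta>1: "\<And>l. l \<in> topspace L \<Longrightarrow> \<delta> (1, l) = l"
    and a: "\<And>z. z \<in> topspace Z \<Longrightarrow> a (i z) = i' z"
      "\<And>t l. t \<in> {0..1} \<Longrightarrow> l \<in> topspace L \<Longrightarrow>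
         a (q (t, l)) = join (\<lambda>(t, l). i' (\<phi> (\<delta> (1 - t, l)))) (\<lambda>(t, l). q' (t, g' l)) (t, l)" "a p = p'"
    and b: "\<And>z. z \<in> topspace Z \<Longrightarrow> b (i' z) = i z"
      "\<And>t l. t \<in> {0..1} \<Longrightarrow> l \<in> topspace L' \<Longrightarrow> b (q' (t, l)) = q (t, g l)" "b p' = p"
  shows "htp Y Y (b \<circ> a) id"
proof -
  interpret mapping_cone Z L \<phi> Y i q p by fact
  have g'_in: "g' l \<in> topspace L'" if "l \<in> topspace L" for l
    using continuous_map_image_subset_topspace[OF g'] that by fast
  have \<delta>_in: "\<delta> (t, l) \<in> topspace L" if "t \<in> {0..1}" "l \<in> topspace L" for t l
    using continuous_map_image_subset_topspace[OF \<delta>] that by (auto simp: image_subset_iff)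
  \<comment> \<open>For s = 0 the height \<open>?d\<close> stays 0 while the link point goes back
    along \<open>\<delta>\<close> from \<open>l\<close> to \<open>g (g' l)\<close>, and then rises
    over the latter: this is \<open>b \<circ> a\<close>. For s = 1 the link point is
    \<open>l\<close> and the height t. At t = 0 the pair is always (0, 1) and at t = 1 the height is
    1, so base and apex stay fixed.\<close>
  let ?c = "\<lambda>x. (1 - fst x) * max 0 (1 - 2 * snd x) + fst x * (1::real)"
  let ?d = "\<lambda>x. (1 - fst x) * max 0 (2 * snd x - 1) + fst x * (snd x::real)"
  show ?thesis
  proof (rule homotopicI[where U = "\<lambda>s z. i z" and w = "\<lambda>s. p"
        and V = "\<lambda>s (t, l). q (?d (s, t), \<delta> (?c (s, t), l))"])
    show "continuous_map (prod_topology I01 Z) Y (\<lambda>(s, z). i z)"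
      by (rule continuous_map_snd_compose[OF cont_i])
    have c': "continuous_map (prod_topology I01 (prod_topology I01 L)) L (\<lambda>(s, t, l). \<delta> (?c (s, t), l))"
    proof (rule continuous_map_reparametrize[OF \<delta>])
      show "?c ` ({0..1} \<times> {0..1}) \<subseteq> {0..1}"
        using interpolate_in_interval[of _ _ 1] by (auto simp: image_subset_iff simp del: atLeastAtMost_iff) auto
    qed (auto intro!: continuous_intros)
    have d': "continuous_map (prod_topology I01 (prod_topology I01 L)) I01 (\<lambda>(s, t, l). ?d (s, t))"
    proof (rule continuous_map_square_interval)
      show "?d ` ({0..1} \<times> {0..1}) \<subseteq> {0..1}"
      proof (clarsimp simp del: atLeastAtMost_iff)
        fix s t :: real assume "s \<in> {0..1}" "t \<in> {0..1}"
        then show "(1 - s) * max 0 (2 * t - 1) + s * t \<in> {0..1}"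
          by (intro interpolate_in_interval) auto
      qed
    qed (auto intro!: continuous_intros)
    show "continuous_map (prod_topology I01 (prod_topology I01 L)) Y
        (\<lambda>(s, x). (\<lambda>(t, l). q (?d (s, t), \<delta> (?c (s, t), l))) x)"
      using continuous_map_compose[OF continuous_map_pairedI[OF d' c'] cont_q]
      by (simp only: o_def case_prod_unfold fst_conv snd_conv)
    show "(b \<circ> a) (q (t, l)) = (\<lambda>(t, l). q (?d (0, t), \<delta> (?c (0, t), l))) (t, l)"
      if "t \<in> {0..1}" "l \<in> topspace L" for t l
    proof (cases "t = 1/2")
      case True
      have "g (g' l) \<in> topspace L" using \<delta>_in[of 0 l] \<delta>0 that by simp
      then show ?thesis unfolding True using that by (simp add: a b join_def \<delta>0 \<phi>_in g'_in q_0)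
    qed (use that in \<open>auto simp: a b join_def \<delta>0 \<phi>_in \<delta>_in g'_in q_0 max_def\<close>)
    show "(\<lambda>(t, l). q (?d (s, t), \<delta> (?c (s, t), l))) (1, l) = p" if "s \<in> {0..1}" "l \<in> topspace L" for s l
      using that by (auto simp: q_1 \<delta>_in)
  qed (use p_in in \<open>auto simp: a b \<delta>1 q_0 q_1\<close>)
qed

lemma link_change_exists:
  assumes "mapping_cone Z L \<phi> Y i q p" and "mapping_cone Z L' (\<phi> \<circ> g) Y' i' q' p'"
    and g': "continuous_map L L' g'"
    and \<delta>: "continuous_map (prod_topology I01 L) L \<delta>"
    and \<delta>0: "\<And>l. l \<in> topspace L \<Longrightarrow> \<delta> (0, l) = g (g' l)" and \<delta>1: "\<And>l. l \<in> topspace L \<Longrightarrow> \<delta> (1, l) = l"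
  obtains a where "continuous_map Y Y' a" "\<And>z. z \<in> topspace Z \<Longrightarrow> a (i z) = i' z"
      "\<And>t l. t \<in> {0..1} \<Longrightarrow> l \<in> topspace L \<Longrightarrow>
         a (q (t, l)) = join (\<lambda>(t, l). i' (\<phi> (\<delta> (1 - t, l)))) (\<lambda>(t, l). q' (t, g' l)) (t, l)" "a p = p'"
proof -
  interpret mapping_cone Z L \<phi> Y i q p by fact
  interpret C': mapping_cone Z L' "\<phi> \<circ> g" Y' i' q' p' by fact
  have g'_in: "g' l \<in> topspace L'" if "l \<in> topspace L" for l
    using continuous_map_image_subset_topspace[OF g'] that by fast
  let ?v = "join (\<lambda>(t, l). i' (\<phi> (\<delta> (1 - t, l)))) (\<lambda>(t, l). q' (t, g' l))"
  let ?a = "ext i' ?v p'"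
  have v1: "?v (0, l) = i' (\<phi> l)" "?v (1, l) = p'" if "l \<in> topspace L" for l
    using that by (auto simp: join_def \<delta>1 C'.q_1 g'_in)
  show ?thesis
  proof
    show "continuous_map Y Y' ?a"
    proof (rule continuous_map_ext)
      show "continuous_map (prod_topology I01 L) Y' ?v"
        using continuous_map_compose[OF continuous_map_compose[OF continuous_map_reverse[OF \<delta>] cont_\<phi>] C'.cont_i]
        by (intro continuous_map_join continuous_map_map_snd[OF C'.cont_q g'])
          (simp_all add: \<delta>0 C'.q_0 g'_in o_def case_prod_unfold)
    qed (simp_all add: C'.cont_i C'.p_in v1)
    show "?a (q (t, l)) = ?v (t, l)" if "t \<in> {0..1}" "l \<in> topspace L" for t l
      using that by (intro ext_q) (simp_all add: v1)
  qed (auto simp: ext_i ext_p)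
qed

lemma link_projection_exists:
  assumes "mapping_cone Z L \<phi> Y i q p" and "mapping_cone Z L' (\<phi> \<circ> g) Y' i' q' p'"
    and g: "continuous_map L' L g"
  obtains b where "continuous_map Y' Y b" "\<And>z. z \<in> topspace Z \<Longrightarrow> b (i' z) = i z"
      "\<And>t l. t \<in> {0..1} \<Longrightarrow> l \<in> topspace L' \<Longrightarrow> b (q' (t, l)) = q (t, g l)" "b p' = p"
proof -
  interpret mapping_cone Z L \<phi> Y i q p by fact
  interpret C': mapping_cone Z L' "\<phi> \<circ> g" Y' i' q' p' by fact
  have g_in: "g l \<in> topspace L" if "l \<in> topspace L'" for l
    using continuous_map_image_subset_topspace[OF g] that by fast
  let ?v = "\<lambda>(t, l). q (t, g l)"
  show ?thesis
  proof
    show "continuous_map Y' Y (C'.ext i ?v p)"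
      by (rule C'.continuous_map_ext[OF cont_i continuous_map_map_snd[OF cont_q g] p_in])
        (simp_all add: q_0 q_1 g_in)
    show "C'.ext i ?v p (q' (t, l)) = q (t, g l)" if "t \<in> {0..1}" "l \<in> topspace L'" for t l
      using that by (subst C'.ext_q) (simp_all add: q_0 q_1 g_in)
  qed (auto simp: C'.ext_i C'.ext_p)
qed

text \<open>The map \<open>a\<close> factors as \<open>b' \<circ> A\<close>, where \<open>A\<close>
  is transport from \<open>Y\<close> to the cone \<open>Y2\<close> with attaching map
  \<open>\<phi> \<circ> g \<circ> g'\<close>, hence an equivalence. The map \<open>b'\<close> has
  right inverse \<open>a'\<close>; conjugating b b' A \<simeq> id by \<open>A\<close> gives it the
  left inverse \<open>A \<circ> b\<close>.\<close>

lemma homotopy_equivalence_link_change: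
  assumes Y: "mapping_cone Z L \<phi> Y i q p" and Y': "mapping_cone Z L' (\<phi> \<circ> g) Y' i' q' p'"
    and Y2: "mapping_cone Z L (\<phi> \<circ> g \<circ> g') Y2 i2 q2 p2"
    and g: "continuous_map L' L g" and g': "continuous_map L L' g'"
    and gg': "htp L L (g \<circ> g') id" and g'g: "htp L' L' (g' \<circ> g) id"
  obtains a where "homotopy_equivalence Y Y' a" "\<And>z. z \<in> topspace Z \<Longrightarrow> a (i z) = i' z"
proof -
  interpret mapping_cone Z L \<phi> Y i q p by fact
  interpret C': mapping_cone Z L' "\<phi> \<circ> g" Y' i' q' p' by fact
  interpret C2: mapping_cone Z L "\<phi> \<circ> g \<circ> g'" Y2 i2 q2 p2 by fact
  have g'_in: "g' l \<in> topspace L'" if "l \<in> topspace L" for l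
    using continuous_map_image_subset_topspace[OF g'] that by fast
  obtain \<delta> where \<delta>: "continuous_map (prod_topology I01 L) L \<delta>"
    and \<delta>0: "\<And>x. \<delta> (0, x) = (g \<circ> g') x" and \<delta>1: "\<And>x. \<delta> (1, x) = id x"
    by (rule htp_obtain[OF gg']) blast
  obtain \<epsilon> where \<epsilon>: "continuous_map (prod_topology I01 L') L' \<epsilon>"
    and \<epsilon>0: "\<And>x. \<epsilon> (0, x) = (g' \<circ> g) x" and \<epsilon>1: "\<And>x. \<epsilon> (1, x) = id x"
    by (rule htp_obtain[OF g'g]) blast
  obtain a where a: "continuous_map Y Y' a" "\<And>z. z \<in> topspace Z \<Longrightarrow> a (i z) = i' z"
      "\<And>t l. t \<in> {0..1} \<Longrightarrow> l \<in> topspace L \<Longrightarrow>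
         a (q (t, l)) = join (\<lambda>(t, l). i' (\<phi> (\<delta> (1 - t, l)))) (\<lambda>(t, l). q' (t, g' l)) (t, l)" "a p = p'"
    by (rule link_change_exists[OF Y Y' g' \<delta>]) (simp_all add: \<delta>0 \<delta>1)
  obtain b where b: "continuous_map Y' Y b" "\<And>z. z \<in> topspace Z \<Longrightarrow> b (i' z) = i z"
      "\<And>t l. t \<in> {0..1} \<Longrightarrow> l \<in> topspace L' \<Longrightarrow> b (q' (t, l)) = q (t, g l)" "b p' = p"
    by (rule link_projection_exists[OF Y Y' g]) blast
  have ba: "htp Y Y (b \<circ> a) id"
    by (rule link_change_retraction[OF Y Y' g' \<delta> _ _ a(2-4) b(2-4)]) (simp_all add: \<delta>0 \<delta>1)
  obtain a' where a': "continuous_map Y' Y2 a'" "\<And>z. z \<in> topspace Z \<Longrightarrow> a' (i' z) = i2 z"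
      "\<And>t l. t \<in> {0..1} \<Longrightarrow> l \<in> topspace L' \<Longrightarrow>
         a' (q' (t, l)) = join (\<lambda>(t, l). i2 ((\<phi> \<circ> g) (\<epsilon> (1 - t, l)))) (\<lambda>(t, l). q2 (t, g l)) (t, l)" "a' p' = p2"
    by (rule link_change_exists[OF Y' Y2 g \<epsilon>]) (simp_all add: \<epsilon>0 \<epsilon>1)
  obtain b' where b': "continuous_map Y2 Y' b'" "\<And>z. z \<in> topspace Z \<Longrightarrow> b' (i2 z) = i' z"
      "\<And>t l. t \<in> {0..1} \<Longrightarrow> l \<in> topspace L \<Longrightarrow> b' (q2 (t, l)) = q' (t, g' l)" "b' p2 = p'"
    by (rule link_projection_exists[OF Y' Y2 g']) blast
  have b'a': "htp Y' Y' (b' \<circ> a') id"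
    by (rule link_change_retraction[OF Y' Y2 g \<epsilon> _ _ a'(2-4) b'(2-4)]) (simp_all add: \<epsilon>0 \<epsilon>1)
  let ?h = "\<lambda>(t, l). \<phi> (\<delta> (1 - t, l))"
  have h: "continuous_map (prod_topology I01 L) Z ?h"
    using continuous_map_compose[OF continuous_map_reverse[OF \<delta>] cont_\<phi>]
    by (simp add: o_def case_prod_unfold)
  have h0: "?h (0, l) = \<phi> l" and h1: "?h (1, l) = (\<phi> \<circ> g \<circ> g') l" for l
    by (simp_all add: \<delta>0 \<delta>1)
  obtain A where A: "continuous_map Y Y2 A" "\<And>z. z \<in> topspace Z \<Longrightarrow> A (i z) = i2 z"
      "\<And>t l. t \<in> {0..1} \<Longrightarrow> l \<in> topspace L \<Longrightarrow> A (q (t, l)) = join (i2 \<circ> ?h) q2 (t, l)" "A p = p2"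
    by (rule transport_exists[OF Y Y2 h h0 h1]) simp_all
  have heA: "homotopy_equivalence Y Y2 A"
    by (rule mapping_cone_homotopic[OF Y Y2 h h0 h1 A])
  then obtain B where B: "continuous_map Y2 Y B" "htp Y2 Y2 (A \<circ> B) id"
    unfolding homotopy_equivalence_def by blast
  have eq: "a y = (b' \<circ> A) y" if "y \<in> topspace Y" for y
  proof (rule eq_onI[OF _ _ _ that])
    have d: "\<phi> (\<delta> (t, l)) \<in> topspace Z" if "t \<in> {0..1}" "l \<in> topspace L" for t l
      using continuous_map_image_subset_topspace[OF \<delta>] that
      by (intro \<phi>_in) (auto simp: image_subset_iff)
    show "a (q (t, l)) = (b' \<circ> A) (q (t, l))" if "t \<in> {0..1}" "l \<in> topspace L" for t l
      using that by (simp add: a A b' join_def d)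
  qed (simp_all add: a A b')
  then have bbA: "htp Y Y (b \<circ> b' \<circ> A) id"
    by (intro htp_cong[OF ba]) auto
  have "htp Y2 Y2 (A \<circ> (b \<circ> b' \<circ> A) \<circ> B) (A \<circ> id \<circ> B)"
    by (rule htp_compose[OF _ htp_compose[OF bbA]]) (use A B in simp_all)
  moreover have "htp Y2 Y2 ((A \<circ> b \<circ> b') \<circ> (A \<circ> B)) ((A \<circ> b \<circ> b') \<circ> id)"
    by (rule htp_compose[OF B(2)])
       (use continuous_map_compose[OF b'(1) continuous_map_compose[OF b(1) A(1)]] in \<open>simp add: o_assoc\<close>)
  ultimately have "htp Y2 Y2 (A \<circ> b \<circ> b') id"
    using B(2) by (simp add: o_assoc) (metis homotopic_with_symD homotopic_with_trans)
  then have "homotopy_equivalence Y2 Y' b'"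
    by (rule homotopy_equivalence_left_right[OF b'(1) continuous_map_compose[OF b(1) A(1)] a'(1) _ b'a'])
  from homotopy_equivalence_compose[OF heA this] have "homotopy_equivalence Y Y' a"
    by (rule homotopy_equivalence_homotopic) (use eq a(1) in \<open>auto intro!: homotopic_with_symD[OF htp_eq]\<close>)
  then show ?thesis using a(2) that by blast
qed

section \<open>Existence of mapping cones\<close>

text \<open>The embeddings of the base and of the open cone lines are prescribed, so that the cone
  can be built inside a chosen type; with \<open>i = id\<close> the old space is literally a subset
  of the new one, and attaching can be iterated without changing the type.\<close>

theorem mapping_cone_exists:
  fixes Z :: "'z topology" and L :: "'l topology" and i :: "'z \<Rightarrow> 'y" and j :: "real \<times> 'l \<Rightarrow> 'y"
  assumes Z: "compact_space Z" "Hausdorff_space Z" and L: "compact_space L" "Hausdorff_space L"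
    and \<phi>: "continuous_map L Z \<phi>"
    and i: "inj_on i (topspace Z)" and j: "inj_on j ({0<..<1} \<times> topspace L)"
    and ij: "i ` topspace Z \<inter> j ` ({0<..<1} \<times> topspace L) = {}"
    and p: "p \<notin> i ` topspace Z" "p \<notin> j ` ({0<..<1} \<times> topspace L)"
  obtains Y where
    "mapping_cone Z L \<phi> Y i (\<lambda>(t, l). if t = 0 then i (\<phi> l) else if t = 1 then p else j (t, l)) p"
    "topspace Y = insert p (i ` topspace Z \<union> j ` ({0<..<1} \<times> topspace L))"
proof -
  define q where "q = (\<lambda>(t, l). if t = 0 then i (\<phi> l) else if t = 1 then p else j (t, l))"
  define S where "S = insert p (i ` topspace Z \<union> j ` ({0<..<1} \<times> topspace L))"
  define IL where "IL = prod_topology I01 L"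
  \<comment> \<open>The quotient topology on the pieces: a set is open if its preimages in the base
    and in the cylinder are.\<close>
  define opn where "opn = (\<lambda>U. U \<subseteq> S \<and> openin Z {z \<in> topspace Z. i z \<in> U} \<and> openin IL {x \<in> topspace IL. q x \<in> U})"
  have \<phi>_in: "\<phi> l \<in> topspace Z" if "l \<in> topspace L" for l
    using continuous_map_image_subset_topspace[OF \<phi>] that by fast
  have IL: "topspace IL = {0..1} \<times> topspace L" by (simp add: IL_def)
  have q_in: "q x \<in> S" if "x \<in> topspace IL" for x
    using that \<phi>_in by (auto simp: q_def S_def IL)
  have "istopology opn"
    unfolding istopology_def
  proof (intro conjI allI impI)
    fix U V assume UV: "opn U" "opn V"
    have eq: "{z \<in> topspace Z. i z \<in> U \<inter> V} = {z \<in> topspace Z. i z \<in> U} \<inter> {z \<in> topspace Z. i z \<in> V}"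
      "{x \<in> topspace IL. q x \<in> U \<inter> V} = {x \<in> topspace IL. q x \<in> U} \<inter> {x \<in> topspace IL. q x \<in> V}"
      by blast+
    show "opn (U \<inter> V)"
      using UV unfolding opn_def eq by (simp only: openin_Int le_infI1 simp_thms)
  next
    fix K assume K: "\<forall>U\<in>K. opn U"
    have eq: "{z \<in> topspace Z. i z \<in> \<Union>K} = (\<Union>U\<in>K. {z \<in> topspace Z. i z \<in> U})"
      "{x \<in> topspace IL. q x \<in> \<Union>K} = (\<Union>U\<in>K. {x \<in> topspace IL. q x \<in> U})"
      by blast+
    have "\<Union>K \<subseteq> S" using K unfolding opn_def by blast
    moreover have "openin Z (\<Union>U\<in>K. {z \<in> topspace Z. i z \<in> U})" "openin IL (\<Union>U\<in>K. {x \<in> topspace IL. q x \<in> U})"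
      using K unfolding opn_def by (blast intro: openin_Union)+
    ultimately show "opn (\<Union>K)" unfolding opn_def eq by blast
  qed
  define Y where "Y = topology opn"
  have open_Y: "openin Y U \<longleftrightarrow> opn U" for U
    unfolding Y_def using \<open>istopology opn\<close> by simp
  have "{z \<in> topspace Z. i z \<in> S} = topspace Z" "{x \<in> topspace IL. q x \<in> S} = topspace IL"
    using q_in by (auto simp: S_def)
  then have "openin Y S" unfolding open_Y opn_def by simp
  then have Y: "topspace Y = S"
    unfolding topspace_def open_Y opn_def by blast
  have cont_i: "continuous_map Z Y i" and cont_q: "continuous_map IL Y q"
    unfolding continuous_map_def open_Y opn_def Y using q_in by (auto simp: S_def)
  \<comment> \<open>The height along cone lines, 0 on the base and 1 at the apex. It is continuous
    and separates points of different heights; what remains is two base points, or two points at the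
    same height strictly between 0 and 1.\<close>
  define \<tau> where "\<tau> = (\<lambda>y. if y \<in> i ` topspace Z then 0 else if y = p then 1
    else fst (inv_into ({0<..<1} \<times> topspace L) j y))"
  have \<tau>_i: "\<tau> (i z) = 0" if "z \<in> topspace Z" for z using that by (simp add: \<tau>_def)
  have \<tau>_p: "\<tau> p = 1" using p by (simp add: \<tau>_def)
  have \<tau>_j: "\<tau> (j (t, l)) = t" if "0 < t" "t < 1" "l \<in> topspace L" for t l
  proof -
    have m: "(t, l) \<in> {0<..<1} \<times> topspace L" using that by simp
    then have "j (t, l) \<notin> i ` topspace Z" "j (t, l) \<noteq> p" using ij p by blast+
    then show ?thesis by (simp add: \<tau>_def inv_into_f_f[OF j m])
  qed
  have \<tau>_q: "\<tau> (q x) = fst x" if "x \<in> topspace IL" for x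
    using that \<phi>_in by (auto simp: q_def IL \<tau>_i \<tau>_p \<tau>_j)
  have open_fst: "openin IL {x \<in> topspace IL. fst x \<in> U}" if "open U" for U
  proof -
    have "continuous_map IL euclideanreal fst"
      unfolding IL_def using continuous_map_fst continuous_map_into_fulltopology by blast
    then show ?thesis using that by (auto simp: continuous_map_def)
  qed
  have open_snd: "openin IL {x \<in> topspace IL. snd x \<in> V}" if "openin L V" for V
    using continuous_map_snd[of I01 L] that unfolding IL_def continuous_map_def by blast
  have open_\<tau>: "openin Y {y \<in> S. \<tau> y \<in> U}" if "open U" for U
    unfolding open_Y opn_def
  proof (intro conjI)
    have "{z \<in> topspace Z. i z \<in> {y \<in> S. \<tau> y \<in> U}} = (if 0 \<in> U then topspace Z else {})"
      by (auto simp: S_def \<tau>_i)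
    then show "openin Z {z \<in> topspace Z. i z \<in> {y \<in> S. \<tau> y \<in> U}}" by simp
    have "{x \<in> topspace IL. q x \<in> {y \<in> S. \<tau> y \<in> U}} = {x \<in> topspace IL. fst x \<in> U}"
      using q_in \<tau>_q by auto
    then show "openin IL {x \<in> topspace IL. q x \<in> {y \<in> S. \<tau> y \<in> U}}" using open_fst[OF that] by simp
  qed blast
  have "Hausdorff_space Y"
    unfolding Hausdorff_space_def
  proof (intro allI impI, elim conjE)
    fix x y assume xy: "x \<in> topspace Y" "y \<in> topspace Y" "x \<noteq> y"
    consider "\<tau> x \<noteq> \<tau> y" | z z' where "x = i z" "y = i z'" "z \<in> topspace Z" "z' \<in> topspace Z"
      | t l l' where "x = j (t, l)" "y = j (t, l')" "0 < t" "t < 1" "l \<in> topspace L" "l' \<in> topspace L"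
      using xy by (auto simp: Y S_def \<tau>_i \<tau>_p \<tau>_j) metis
    then show "\<exists>U V. openin Y U \<and> openin Y V \<and> x \<in> U \<and> y \<in> V \<and> disjnt U V"
    proof cases
      case 1
      then obtain A B where AB: "open A" "open B" "\<tau> x \<in> A" "\<tau> y \<in> B" "A \<inter> B = {}"
        using hausdorff by metis
      show ?thesis
        using AB xy open_\<tau>[OF AB(1)] open_\<tau>[OF AB(2)] unfolding Y
        by (intro exI[of _ "{y \<in> S. \<tau> y \<in> A}"] exI[of _ "{y \<in> S. \<tau> y \<in> B}"]) (auto simp: disjnt_def)
    next
      case (2 z z')
      then obtain A B where AB: "openin Z A" "openin Z B" "z \<in> A" "z' \<in> B" "disjnt A B"
        using xy Z(2) unfolding Hausdorff_space_def by metis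
      \<comment> \<open>An open set \<open>V\<close> of the base is thickened by the parts below
        height 1/2 of the cone lines that start in it; without them it would not be open in the
        cone. Any bound in the open unit interval would do.\<close>
      define N where "N = (\<lambda>V. i ` V \<union> j ` ({0<..<1/2} \<times> {l \<in> topspace L. \<phi> l \<in> V}))"
      have N: "openin Y (N V)" if V: "openin Z V" for V
        unfolding open_Y opn_def
      proof (intro conjI)
        have VZ: "V \<subseteq> topspace Z" using V by (rule openin_subset)
        have sub: "{0<..<1/2} \<times> {l \<in> topspace L. \<phi> l \<in> V} \<subseteq> {0<..<1::real} \<times> topspace L" by auto
        show "N V \<subseteq> S" using VZ by (auto simp: N_def S_def)
        have iN: "i z \<in> N V \<longleftrightarrow> z \<in> V" if "z \<in> topspace Z" for z
          using that ij sub inj_onD[OF i, of z] VZ unfolding N_def by blast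
        then have "{z \<in> topspace Z. i z \<in> N V} = V" using VZ by blast
        then show "openin Z {z \<in> topspace Z. i z \<in> N V}" using V by simp
        have jN: "j (t, l) \<in> N V \<longleftrightarrow> t < 1/2 \<and> \<phi> l \<in> V" if "0 < t" "t < 1" "l \<in> topspace L" for t l
        proof -
          have m: "(t, l) \<in> {0<..<1} \<times> topspace L" using that by simp
          then have "j (t, l) \<in> N V \<longleftrightarrow> j (t, l) \<in> j ` ({0<..<1/2} \<times> {l \<in> topspace L. \<phi> l \<in> V})"
            using ij VZ unfolding N_def by blast
          also have "\<dots> \<longleftrightarrow> (t, l) \<in> {0<..<1/2} \<times> {l \<in> topspace L. \<phi> l \<in> V}"
            by (rule inj_on_image_mem_iff[OF j m sub])
          finally show ?thesis using that by simp
        qed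
        have "p \<notin> N V" using p VZ sub unfolding N_def by blast
        then have "{x \<in> topspace IL. q x \<in> N V} = {x \<in> topspace IL. fst x \<in> {..<1/2}} \<inter>
            {x \<in> topspace IL. snd x \<in> {l \<in> topspace L. \<phi> l \<in> V}}"
          by (auto simp: IL q_def iN jN \<phi>_in split: if_splits)
        moreover have "openin L {l \<in> topspace L. \<phi> l \<in> V}"
          using \<phi> V by (simp add: continuous_map_def)
        ultimately show "openin IL {x \<in> topspace IL. q x \<in> N V}"
          using open_fst[of "{..<1/2}"] open_snd by (simp only: openin_Int open_lessThan)
      qed
      have "disjnt (N A) (N B)"
      proof -
        have "A \<subseteq> topspace Z" "B \<subseteq> topspace Z" using AB openin_subset by auto
        then have "i ` A \<inter> i ` B = {}"
          using inj_on_image_Int[OF i, of A B] AB(5) by (simp add: disjnt_def)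
        moreover have "j ` ({0<..<1/2} \<times> {l \<in> topspace L. \<phi> l \<in> A}) \<inter> j ` ({0<..<1/2} \<times> {l \<in> topspace L. \<phi> l \<in> B}) = {}"
          using AB(5) by (subst inj_on_image_Int[OF j, symmetric]) (auto simp: disjnt_def)
        moreover have "j ` ({0<..<1/2} \<times> {l \<in> topspace L. \<phi> l \<in> V}) \<subseteq> j ` ({0<..<1} \<times> topspace L)" for V
          by auto
        moreover have "(I1 \<union> J1) \<inter> (I2 \<union> J2) = {}" if "I1 \<inter> I2 = {}" "J1 \<inter> J2 = {}"
          "I1 \<subseteq> i ` topspace Z" "I2 \<subseteq> i ` topspace Z" "J1 \<subseteq> j ` ({0<..<1} \<times> topspace L)"
          "J2 \<subseteq> j ` ({0<..<1} \<times> topspace L)" for I1 I2 J1 J2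
          using that ij by blast
        ultimately show ?thesis
          using \<open>A \<subseteq> topspace Z\<close> \<open>B \<subseteq> topspace Z\<close> unfolding N_def disjnt_def
          by (simp add: image_mono)
      qed
      moreover have "x \<in> N A" "y \<in> N B" using 2 AB by (auto simp: N_def)
      ultimately show ?thesis using N AB by blast
    next
      case (3 t l l')
      then obtain A B where AB: "openin L A" "openin L B" "l \<in> A" "l' \<in> B" "disjnt A B"
        using xy L(2) unfolding Hausdorff_space_def by metis
      \<comment> \<open>Within the open cone lines the link coordinate alone separates the two
        points.\<close>
      define N where "N = (\<lambda>V. j ` ({0<..<1} \<times> V))"
      have N: "openin Y (N V)" if V: "openin L V" for V
        unfolding open_Y opn_def
      proof (intro conjI)
        have VL: "V \<subseteq> topspace L" using V by (rule openin_subset)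
        then have sub: "{0<..<1} \<times> V \<subseteq> {0<..<1::real} \<times> topspace L" by auto
        then show "N V \<subseteq> S" by (auto simp: N_def S_def)
        have iN: "i z \<notin> N V" if "z \<in> topspace Z" for z
          using that ij sub unfolding N_def by blast
        then have "{z \<in> topspace Z. i z \<in> N V} = {}" by blast
        then show "openin Z {z \<in> topspace Z. i z \<in> N V}" by (simp only: openin_empty)
        have jN: "j (t, l) \<in> N V \<longleftrightarrow> l \<in> V" if "0 < t" "t < 1" "l \<in> topspace L" for t l
        proof -
          have m: "(t, l) \<in> {0<..<1} \<times> topspace L" using that by simp
          show ?thesis using inj_on_image_mem_iff[OF j m sub] that by (simp add: N_def)
        qed
        have "p \<notin> N V" using p sub unfolding N_def by blast
        then have "{x \<in> topspace IL. q x \<in> N V} = {x \<in> topspace IL. fst x \<in> {0<..<1}} \<inter>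
            {x \<in> topspace IL. snd x \<in> V}"
          by (auto simp: IL q_def iN jN \<phi>_in split: if_splits)
        then show "openin IL {x \<in> topspace IL. q x \<in> N V}"
          using open_fst[of "{0<..<1}"] open_snd[OF V] by (simp only: openin_Int open_greaterThanLessThan)
      qed
      have "disjnt (N A) (N B)"
        using AB(5) openin_subset[OF AB(1)] openin_subset[OF AB(2)] unfolding N_def disjnt_def
        by (subst inj_on_image_Int[OF j, symmetric]) auto
      moreover have "x \<in> N A" "y \<in> N B" using 3 AB by (auto simp: N_def)
      ultimately show ?thesis using N AB by blast
    qed
  qed
  moreover have jq: "q x = j x" if "x \<in> {0<..<1} \<times> topspace L" for x using that by (auto simp: q_def)
  ultimately have "mapping_cone Z L \<phi> Y i q p"
    using Z L \<phi> i j ij p cont_i cont_q inj_on_cong[of "{0<..<1} \<times> topspace L" q j]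
    by unfold_locales
      (simp_all add: jq image_cong[OF refl jq] IL_def Y S_def, simp_all add: q_def)
  then show ?thesis using that Y unfolding q_def S_def by blast
qed

corollary mapping_cone_exists_sum:
  fixes Z :: "'z topology" and L :: "'l topology"
  assumes "compact_space Z" "Hausdorff_space Z" "compact_space L" "Hausdorff_space L" "continuous_map L Z \<phi>"
  obtains Y :: "('z + (real \<times> 'l) + unit) topology" and i q p where "mapping_cone Z L \<phi> Y i q p"
proof -
  let ?i = "Inl :: 'z \<Rightarrow> 'z + (real \<times> 'l) + unit" and ?j = "Inr \<circ> Inl :: real \<times> 'l \<Rightarrow> 'z + (real \<times> 'l) + unit"
  show ?thesis
    by (rule mapping_cone_exists[OF assms, of ?i ?j "Inr (Inr ())"]) (auto simp: inj_on_def intro: that)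
qed

text \<open>Change of base followed by change of link, through the cone \<open>Y1\<close> over
  \<open>Z'\<close> with the old link. That \<open>F\<close> extends \<open>f\<close> is as
  important as its being an equivalence: it preserves the control over images of
  subcomplexes.\<close>

theorem mapping_cone_homotopy_equivalence:
  fixes Z :: "'z topology" and L :: "'l topology" and Z' :: "'v topology"
  assumes Y: "mapping_cone Z L \<phi> Y i q p" and Y': "mapping_cone Z' L' (f \<circ> \<phi> \<circ> g) Y' i' q' p'"
    and f: "homotopy_equivalence Z Z' f" and g: "homotopy_equivalence L' L g" and L: "Hausdorff_space L"
  obtains F where "homotopy_equivalence Y Y' F" "\<And>z. z \<in> topspace Z \<Longrightarrow> F (i z) = i' (f z)"
proof -
  interpret mapping_cone Z L \<phi> Y i q p by fact
  interpret C': mapping_cone Z' L' "f \<circ> \<phi> \<circ> g" Y' i' q' p' by fact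
  have HZ: "Hausdorff_space Z" "Hausdorff_space Z'"
    using Hausdorff cont_i inj_i C'.Hausdorff C'.cont_i C'.inj_i Hausdorff_space_injective_preimage by blast+
  obtain f' where f': "continuous_map Z Z' f" "continuous_map Z' Z f'" "htp Z Z (f' \<circ> f) id" "htp Z' Z' (f \<circ> f') id"
    using f unfolding homotopy_equivalence_def by blast
  obtain g' where g': "continuous_map L' L g" "continuous_map L L' g'" "htp L' L' (g' \<circ> g) id" "htp L L (g \<circ> g') id"
    using g unfolding homotopy_equivalence_def by blast
  have c1: "continuous_map L Z' (f \<circ> \<phi>)" using cont_\<phi> f' continuous_map_compose by blast
  have c2: "continuous_map L Z (f' \<circ> (f \<circ> \<phi>))" using c1 f' continuous_map_compose by blast
  have c3: "continuous_map L Z' (f \<circ> \<phi> \<circ> g \<circ> g')" using g' C'.cont_\<phi> continuous_map_compose by blast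
  obtain Y1 :: "('v + (real \<times> 'l) + unit) topology" and i1 q1 p1 where Y1: "mapping_cone Z' L (f \<circ> \<phi>) Y1 i1 q1 p1"
    by (rule mapping_cone_exists_sum[OF C'.compact_Z HZ(2) compact_L L c1])
  obtain Y2 :: "('z + (real \<times> 'l) + unit) topology" and i2 q2 p2 where Y2: "mapping_cone Z L (f' \<circ> (f \<circ> \<phi>)) Y2 i2 q2 p2"
    by (rule mapping_cone_exists_sum[OF compact_Z HZ(1) compact_L L c2])
  obtain Y3 :: "('v + (real \<times> 'l) + unit) topology" and i3 q3 p3 where Y3: "mapping_cone Z' L (f \<circ> \<phi> \<circ> g \<circ> g') Y3 i3 q3 p3"
    by (rule mapping_cone_exists_sum[OF C'.compact_Z HZ(2) compact_L L c3])
  obtain F where F: "continuous_map Y Y1 F" "\<And>z. z \<in> topspace Z \<Longrightarrow> F (i z) = i1 (f z)"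
    "\<And>t l. t \<in> {0..1} \<Longrightarrow> l \<in> topspace L \<Longrightarrow> F (q (t, l)) = q1 (t, l)" "F p = p1"
    by (rule base_change_exists[OF Y Y1 f'(1)]) blast
  have F': "homotopy_equivalence Y Y1 F"
    by (rule homotopy_equivalence_base_change[OF Y Y1 Y2 f' F])
  obtain a where a: "homotopy_equivalence Y1 Y' a" "\<And>z. z \<in> topspace Z' \<Longrightarrow> a (i1 z) = i' z"
    by (rule homotopy_equivalence_link_change[OF Y1 Y' Y3 g'(1,2,4,3)]) blast
  show ?thesis
  proof
    show "homotopy_equivalence Y Y' (a \<circ> F)"
      using F' a(1) by (rule homotopy_equivalence_compose)
    show "(a \<circ> F) (i z) = i' (f z)" if "z \<in> topspace Z" for z
      using that F(2) a(2) continuous_map_image_subset_topspace[OF f'(1)] by (auto simp: image_subset_iff)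
  qed
qed

section \<open>Order complexes\<close>

abbreviation (input) poset_space :: "'a::order set \<Rightarrow> ('a \<Rightarrow> real) topology" where
  "poset_space P \<equiv> realization (order_complex P)"

text \<open>The support condition is phrased as a vanishing product for every incomparable pair, and
  the sum runs over the fixed set \<open>P\<close>, so that each condition is visibly
  closed.\<close>

definition poset_points :: "'a::order set \<Rightarrow> ('a \<Rightarrow> real) set" where
  "poset_points P = {t. (\<forall>v. 0 \<le> t v) \<and> (\<forall>v. v \<notin> P \<longrightarrow> t v = 0) \<and>
     (\<forall>u v. t u * t v \<noteq> 0 \<longrightarrow> u \<le> v \<or> v \<le> u) \<and> sum t P = 1}"

lemma poset_points_iff:
  assumes "finite P"
  shows "(\<forall>v. 0 \<le> t v) \<and> {v. t v \<noteq> 0} \<in> order_complex P \<and> (\<Sum>v\<in>{v. t v \<noteq> 0}. t v) = 1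
    \<longleftrightarrow> t \<in> poset_points P"
proof (cases "{v. t v \<noteq> 0} \<subseteq> P")
  case True
  have "(\<Sum>v\<in>{v. t v \<noteq> 0}. t v) = sum t P"
    using True assms by (intro sum.mono_neutral_left) auto
  moreover have "{v. t v \<noteq> 0} \<noteq> {}" if "sum t P = 1"
  proof
    assume "{v. t v \<noteq> 0} = {}"
    then have "sum t P = 0" by (intro sum.neutral) auto
    with that show False by simp
  qed
  moreover have "\<forall>v. v \<notin> P \<longrightarrow> t v = 0" using True by blast
  ultimately show ?thesis
    unfolding poset_points_def order_complex_def chain_def
    using True finite_subset[OF True assms] by auto
qed (auto simp: poset_points_def order_complex_def)

lemma poset_space_eq:
  assumes "finite P"
  shows "poset_space P = top_of_set (poset_points P)"
  unfolding realization_def using poset_points_iff[OF assms] by (simp add: euclidean_product_topology)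

lemma poset_points_mono:
  assumes "finite Q" "P \<subseteq> Q"
  shows "poset_points P \<subseteq> poset_points Q"
proof
  fix t assume t: "t \<in> poset_points P"
  then have "sum t P = sum t Q"
    using assms by (intro sum.mono_neutral_left) (auto simp: poset_points_def)
  then show "t \<in> poset_points Q" using t assms by (auto simp: poset_points_def)
qed

lemma poset_points_le_1:
  assumes "finite P" "t \<in> poset_points P"
  shows "t v \<le> 1"
proof (cases "v \<in> P")
  case True
  then have "t v \<le> sum t P" using assms by (intro member_le_sum) (auto simp: poset_points_def)
  then show ?thesis using assms by (simp add: poset_points_def)
qed (use assms in \<open>auto simp: poset_points_def\<close>)

lemma continuous_on_coordinate [continuous_intros]: "continuous_on S (\<lambda>t :: 'a \<Rightarrow> real. t v)"
  by (rule continuous_on_subset[OF continuous_on_product_coordinates]) simp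

lemma closed_poset_points: "closed (poset_points P)"
proof -
  have "closed {t :: 'a \<Rightarrow> real. t u * t v \<noteq> 0 \<longrightarrow> u \<le> v \<or> v \<le> u}" for u v
  proof (cases "u \<le> v \<or> v \<le> u")
    case False
    have "closed {t :: 'a \<Rightarrow> real. t u * t v = 0}"
      by (intro closed_Collect_eq continuous_intros)
    then show ?thesis using False by simp
  qed simp
  moreover have "closed {t :: 'a \<Rightarrow> real. v \<notin> P \<longrightarrow> t v = 0}" for v
    by (cases "v \<in> P") (simp_all add: closed_Collect_eq continuous_intros)
  ultimately show ?thesis
    unfolding poset_points_def
    by (intro closed_Collect_conj closed_Collect_all closed_Collect_eq closed_Collect_le continuous_intros)
qed

text \<open>The ambient vertex type may be infinite, so compactness comes from the product of unit
  intervals.\<close>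

lemma compact_poset_space:
  assumes "finite P"
  shows "compact_space (poset_space P)"
proof -
  have "compactin (powertop_real UNIV) (\<Pi>\<^sub>E v\<in>(UNIV :: 'a set). {0..1})"
    by (simp add: compactin_PiE)
  then have "compact (\<Pi>\<^sub>E v\<in>(UNIV :: 'a set). {0..1::real})"
    by (simp add: euclidean_product_topology)
  then have "compact ((\<Pi>\<^sub>E v\<in>UNIV. {0..1}) \<inter> poset_points P)"
    using closed_poset_points by (rule compact_Int_closed)
  moreover have "poset_points P \<subseteq> (\<Pi>\<^sub>E v\<in>UNIV. {0..1})"
    using poset_points_le_1[OF assms] by (auto simp: poset_points_def)
  ultimately have "compact (poset_points P)" by (simp add: Int_absorb1)
  then show ?thesis using assms by (simp add: poset_space_eq compact_space_subtopology)
qed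

lemma Hausdorff_poset_space: "Hausdorff_space (poset_space P)"
  unfolding realization_def by (intro Hausdorff_space_subtopology) (simp add: Hausdorff_space_product_topology)

text \<open>The end point \<open>e\<close> is left open: a vertex gives the cones in order
  complexes, the origin the radii of a disc.\<close>

lemma continuous_on_cone_segment:
  "continuous_on S (\<lambda>x. (\<lambda>v. (1 - fst x) * snd x v + fst x * e v) :: 'a \<Rightarrow> real)"
proof (rule continuous_on_coordinatewise_then_product)
  fix v
  have "continuous_on S (\<lambda>x. snd x v :: real)"
    by (rule continuous_on_compose2[OF continuous_on_coordinate[of UNIV v] continuous_on_snd[OF continuous_on_id]]) simp
  then show "continuous_on S (\<lambda>x. (1 - fst x) * snd x v + fst x * e v)"
    by (intro continuous_intros)
qed

text \<open>A vertex in barycentric coordinates; it serves again as a standard basis vector, namely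
  the pole of a sphere.\<close>

definition vertex :: "'a \<Rightarrow> 'a \<Rightarrow> real" where
  "vertex y = (\<lambda>v. if v = y then 1 else 0)"

lemma cone_segment_in:
  assumes P: "finite P" "y \<in> P" and Q: "Q \<subseteq> P" "\<And>z. z \<in> Q \<Longrightarrow> z \<le> y \<or> y \<le> z"
    and t: "t \<in> {0..1}" and l: "l \<in> poset_points Q"
  shows "(\<lambda>v. (1 - t) * l v + t * vertex y v) \<in> poset_points P"
proof -
  have lP: "l \<in> poset_points P" using l poset_points_mono[OF P(1) Q(1)] by blast
  have "sum (vertex y) P = 1" using P by (simp add: vertex_def)
  then have "(\<Sum>v\<in>P. (1 - t) * l v + t * vertex y v) = 1"
    using lP by (simp add: sum.distrib poset_points_def flip: sum_distrib_left)
  moreover have "u \<le> v \<or> v \<le> u"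
    if "((1 - t) * l u + t * vertex y u) * ((1 - t) * l v + t * vertex y v) \<noteq> 0" for u v
  proof -
    have "l u \<noteq> 0 \<or> u = y" "l v \<noteq> 0 \<or> v = y" using that by (auto simp: vertex_def split: if_splits)
    moreover have "w \<in> Q" if "l w \<noteq> 0" for w using l that by (auto simp: poset_points_def)
    ultimately show ?thesis using Q(2) l by (auto simp: poset_points_def)
  qed
  ultimately show ?thesis using lP t P by (auto simp: poset_points_def vertex_def)
qed

text \<open>A chain stays a chain when \<open>y\<close> is added, so the straight segments to the
  vertex \<open>y\<close> stay in the complex.\<close>

lemma contractible_poset_space_cone:
  assumes P: "finite P" "y \<in> P" and cmp: "\<And>z. z \<in> P \<Longrightarrow> z \<le> y \<or> y \<le> z"
  shows "contractible_space (poset_space P)"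
proof -
  have "continuous_on ({0..1} \<times> poset_points P) (\<lambda>x. (\<lambda>v. (1 - fst x) * snd x v + fst x * vertex y v))"
    by (rule continuous_on_cone_segment)
  moreover have "(\<lambda>x. (\<lambda>v. (1 - fst x) * snd x v + fst x * vertex y v)) ` ({0..1} \<times> poset_points P) \<subseteq> poset_points P"
    using cone_segment_in[OF P subset_refl cmp] by auto
  ultimately have "contractible (poset_points P)"
    unfolding contractible_def homotopic_with_def
    by (intro exI[of _ "vertex y"] exI[of _ "\<lambda>x. (\<lambda>v. (1 - fst x) * snd x v + fst x * vertex y v)"])
      (auto simp: continuous_map_in_subtopology image_subset_iff_funcset subtopology_Times[symmetric])
  then show ?thesis using P by (simp add: poset_space_eq)
qed

lemma vertex_in_poset_points: "finite P \<Longrightarrow> y \<in> P \<Longrightarrow> vertex y \<in> poset_points P"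
  by (auto simp: poset_points_def vertex_def split: if_splits)

text \<open>A chain containing \<open>y\<close> consists of \<open>y\<close> and a chain in its link
  \<open>L\<close>. The cone parameter is the barycentric coordinate of \<open>y\<close>: it is 0 on
  the base, 1 at the apex and strictly between on open cone lines, which gives the disjointness
  conditions.\<close>

theorem mapping_cone_insert:
  assumes P: "finite P" "y \<notin> P" and L: "L = {z \<in> P. z < y \<or> y < z}"
  shows "mapping_cone (poset_space P) (poset_space L) id (poset_space (insert y P)) id
    (\<lambda>(t, l) v. (1 - t) * l v + t * vertex y v) (vertex y)"
proof -
  let ?q = "\<lambda>(t, l) v. (1 - t) * l v + t * vertex y v"
  let ?P = "poset_points P" and ?L = "poset_points L" and ?Y = "poset_points (insert y P)"
  have fin: "finite L" "finite (insert y P)" using P L by auto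
  have PL: "?L \<subseteq> ?P" "?P \<subseteq> ?Y" 
    using poset_points_mono[OF P(1), of L] poset_points_mono[OF fin(2), of P] L by auto
  have y0: "w y = 0" if "w \<in> ?P" for w using that P by (auto simp: poset_points_def)
  have qy: "?q (t, l) y = t" if "l \<in> ?L" for t l using y0 that PL by (auto simp: vertex_def)
  have q_in: "?q x \<in> ?Y" if "x \<in> {0..1} \<times> ?L" for x
  proof -
    have "(\<lambda>v. (1 - fst x) * snd x v + fst x * vertex y v) \<in> ?Y"
      by (rule cone_segment_in[OF fin(2), of y L]) (use that L in auto)
    then show ?thesis by (simp add: case_prod_unfold)
  qed
  show ?thesis
  proof
    show "compact_space (poset_space P)" "compact_space (poset_space L)"
      using P fin by (auto intro: compact_poset_space)
    show "Hausdorff_space (poset_space (insert y P))" by (rule Hausdorff_poset_space)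
    show "continuous_map (poset_space L) (poset_space P) id" "continuous_map (poset_space P) (poset_space (insert y P)) id"
      using P fin PL by (auto simp: poset_space_eq continuous_map_in_subtopology)
    have "prod_topology I01 (top_of_set ?L) = top_of_set ({0..1} \<times> ?L)"
      using subtopology_Times[of euclideanreal euclidean "{0..1}" ?L] by (simp only: prod_topology_euclidean)
    then show "continuous_map (prod_topology I01 (poset_space L)) (poset_space (insert y P)) ?q"
      using fin q_in continuous_on_cone_segment[of "{0..1} \<times> ?L" "vertex y"]
      by (simp add: poset_space_eq continuous_map_in_subtopology case_prod_unfold)
    show "?q (0, l) = id (id l)" "?q (1, l) = vertex y" for l by (auto simp: fun_eq_iff)
    show "vertex y \<in> topspace (poset_space (insert y P))"
      using fin by (simp add: poset_space_eq vertex_in_poset_points)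
    show "inj_on ?q ({0<..<1} \<times> topspace (poset_space L))"
    proof (rule inj_onI)
      fix x x' assume x: "x \<in> {0<..<1} \<times> topspace (poset_space L)" "x' \<in> {0<..<1} \<times> topspace (poset_space L)"
        and eq: "?q x = ?q x'"
      obtain t l t' l' where [simp]: "x = (t, l)" "x' = (t', l')" by fastforce
      have ll: "l \<in> ?L" "l' \<in> ?L" "t < 1" using x fin by (auto simp: poset_space_eq)
      have "t = t'" using qy[OF ll(1), of t] qy[OF ll(2), of t'] fun_cong[OF eq, of y] by simp
      moreover have "l v = l' v" for v
        using fun_cong[OF eq, of v] ll \<open>t = t'\<close> by simp
      ultimately show "x = x'" by auto
    qed
    have wy: "w y \<in> {0<..<1}" if "w \<in> ?q ` ({0<..<1} \<times> topspace (poset_space L))" for w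
    proof -
      obtain t l where "t \<in> {0<..<1}" "l \<in> ?L" "w = ?q (t, l)"
        using \<open>w \<in> _\<close> fin by (auto simp: poset_space_eq)
      then show ?thesis using qy by simp
    qed
    show "id ` topspace (poset_space P) \<inter> ?q ` ({0<..<1} \<times> topspace (poset_space L)) = {}"
    proof (rule equals0I)
      fix w assume w: "w \<in> id ` topspace (poset_space P) \<inter> ?q ` ({0<..<1} \<times> topspace (poset_space L))"
      then have "w \<in> ?P" using P by (simp add: poset_space_eq)
      moreover have "w y \<in> {0<..<1}" by (rule wy[OF IntD2[OF w]])
      ultimately show False using y0[of w] by simp
    qed
    show "vertex y \<notin> id ` topspace (poset_space P)"
      using y0[of "vertex y"] P by (auto simp: poset_space_eq vertex_def)
    show "vertex y \<notin> ?q ` ({0<..<1} \<times> topspace (poset_space L))"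
    proof
      assume "vertex y \<in> ?q ` ({0<..<1} \<times> topspace (poset_space L))"
      then have "vertex y y \<in> {0<..<1}" by (rule wy)
      then show False by (simp add: vertex_def)
    qed
    show "topspace (poset_space (insert y P)) \<subseteq>
      insert (vertex y) (id ` topspace (poset_space P) \<union> ?q ` ({0<..<1} \<times> topspace (poset_space L)))"
    proof
      fix w assume "w \<in> topspace (poset_space (insert y P))"
      then have w: "w \<in> ?Y" using fin by (simp add: poset_space_eq)
      then have sum: "w y + sum w P = 1" and nn: "\<And>v. 0 \<le> w v" and out: "\<And>v. v \<notin> insert y P \<Longrightarrow> w v = 0"
        and cmp: "\<And>u v. w u \<noteq> 0 \<Longrightarrow> w v \<noteq> 0 \<Longrightarrow> u \<le> v \<or> v \<le> u"
        using P by (auto simp: poset_points_def)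
      have w1: "w y \<le> 1" using poset_points_le_1[OF fin(2) w] .
      consider "w y = 0" | "w y = 1" | "0 < w y" "w y < 1" using nn[of y] w1 by fastforce
      then show "w \<in> insert (vertex y) (id ` topspace (poset_space P) \<union> ?q ` ({0<..<1} \<times> topspace (poset_space L)))"
      proof cases
        case 1
        then have "w \<in> ?P" using sum nn out cmp by (auto simp: poset_points_def) metis
        then show ?thesis using P by (simp add: poset_space_eq)
      next
        case 2
        then have "\<forall>v\<in>P. w v = 0" using sum nn sum_nonneg_eq_0_iff[OF P(1), of w] by simp
        then have "w = vertex y" using 2 out by (auto simp: vertex_def fun_eq_iff)
        then show ?thesis by simp
      next
        case 3
        \<comment> \<open>The projection from the vertex \<open>y\<close> to the opposite face;
          dividing by \<open>1 - w y\<close> restores the coordinate sum 1.\<close>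
        define l where "l = (\<lambda>v. if v = y then 0 else w v / (1 - w y))"
        have out': "w v = 0" if "v \<notin> L" "v \<noteq> y" for v
        proof (rule ccontr)
          assume "w v \<noteq> 0"
          then have "v \<in> P" using out that by auto
          moreover have "v \<le> y \<or> y \<le> v" using cmp[of v y] \<open>w v \<noteq> 0\<close> 3 by auto
          ultimately show False using that L by auto
        qed
        have "sum w P = sum w L"
          using P L out' by (intro sum.mono_neutral_right) auto
        moreover have "sum l L = sum w L / (1 - w y)"
          unfolding sum_divide_distrib using P L by (intro sum.cong) (auto simp: l_def)
        moreover have "sum w P = 1 - w y" using sum by simp
        ultimately have "sum l L = 1" using 3 by simp
        moreover have "u \<le> v \<or> v \<le> u" if "l u * l v \<noteq> 0" for u v
          using that cmp by (auto simp: l_def split: if_splits)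
        ultimately have "l \<in> ?L" using nn 3 out' P L by (auto simp: poset_points_def l_def)
        moreover have "?q (w y, l) = w" using 3 by (auto simp: l_def vertex_def fun_eq_iff)
        ultimately have "w \<in> ?q ` ({0<..<1} \<times> topspace (poset_space L))"
          using 3 fin by (intro image_eqI[of _ _ "(w y, l)"]) (auto simp: poset_space_eq)
        then show ?thesis by blast
      qed
    qed
  qed auto
qed

section \<open>Spheres and discs\<close>

text \<open>Indexed by the number of coordinates, so the dimension is \<open>n - 1\<close>. For
  \<open>n = 0\<close> the empty sum is not 1 and the set is empty, in accordance with
  \<open>sphere_pred\<close>.\<close>

definition sphere_points :: "nat \<Rightarrow> (nat \<Rightarrow> real) set" where
  "sphere_points n = {x. (\<Sum>k<n. (x k)\<^sup>2) = 1 \<and> (\<forall>k\<ge>n. x k = 0)}"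

definition disc_points :: "nat \<Rightarrow> (nat \<Rightarrow> real) set" where
  "disc_points n = {x. (\<Sum>k<n. (x k)\<^sup>2) \<le> 1 \<and> (\<forall>k\<ge>n. x k = 0)}"

lemma nsphere_eq: "nsphere n = top_of_set (sphere_points (Suc n))"
  by (simp add: nsphere sphere_points_def euclidean_product_topology lessThan_Suc_atMost Suc_le_eq)

lemma sphere_pred_eq: "sphere_pred n = top_of_set (sphere_points n)"
proof (cases n)
  case 0
  then show ?thesis by (simp add: sphere_pred_def sphere_points_def)
qed (simp add: sphere_pred_def nsphere_eq)

lemma disc_eq: "disc n = top_of_set (disc_points n)"
  unfolding disc_def Euclidean_space_def disc_points_def subtopology_subtopology
  by (simp add: euclidean_product_topology Int_def conj_commute)

lemma disc_boundary_eq: "disc_boundary n = sphere_points n"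
  by (auto simp: disc_boundary_def disc_eq disc_points_def sphere_points_def)

lemma disc_interior_eq: "disc_interior n = disc_points n - sphere_points n"
  by (auto simp: disc_interior_def disc_eq disc_points_def sphere_points_def)

lemma sphere_subset_disc: "sphere_points n \<subseteq> disc_points n"
  by (auto simp: disc_points_def sphere_points_def)

lemma disc_points_bound:
  assumes "x \<in> disc_points n"
  shows "x k \<in> {-1..1}"
proof (cases "k < n")
  case True
  then have "(x k)\<^sup>2 \<le> (\<Sum>k<n. (x k)\<^sup>2)" by (intro member_le_sum) auto
  also have "\<dots> \<le> 1" using assms by (simp add: disc_points_def)
  finally show ?thesis by (simp add: abs_square_le_1 abs_le_iff)
qed (use assms in \<open>simp add: disc_points_def\<close>)

lemma closed_sphere_points: "closed (sphere_points n)" and closed_disc_points: "closed (disc_points n)"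
proof -
  have "closed {x :: nat \<Rightarrow> real. n \<le> k \<longrightarrow> x k = 0}" for k
    by (cases "n \<le> k") (simp_all add: closed_Collect_eq continuous_intros)
  then show "closed (sphere_points n)" "closed (disc_points n)"
    unfolding sphere_points_def disc_points_def
    by (intro closed_Collect_conj closed_Collect_all closed_Collect_eq closed_Collect_le continuous_intros; simp)+
qed

lemma compact_disc_points: "compact (disc_points n)"
proof -
  have "compactin (powertop_real UNIV) (\<Pi>\<^sub>E k\<in>(UNIV :: nat set). {-1..1})"
    by (simp add: compactin_PiE)
  then have "compact (\<Pi>\<^sub>E k\<in>(UNIV :: nat set). {-1..1::real})"
    by (simp add: euclidean_product_topology)
  then have "compact ((\<Pi>\<^sub>E k\<in>UNIV. {-1..1}) \<inter> disc_points n)"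
    using closed_disc_points by (rule compact_Int_closed)
  moreover have "disc_points n \<subseteq> (\<Pi>\<^sub>E k\<in>UNIV. {-1..1})"
    using disc_points_bound by fastforce
  ultimately show ?thesis by (simp add: Int_absorb1)
qed

lemma compact_sphere_points: "compact (sphere_points n)"
  using compact_Int_closed[OF compact_disc_points closed_sphere_points, of n n] sphere_subset_disc[of n]
  by (simp add: Int_absorb1)

lemma Hausdorff_top_of_set_fun: "Hausdorff_space (top_of_set (S :: ('a \<Rightarrow> real) set))"
proof -
  have "Hausdorff_space (powertop_real (UNIV :: 'a set))"
    by (simp add: Hausdorff_space_product_topology)
  then show ?thesis by (intro Hausdorff_space_subtopology) (simp add: euclidean_product_topology)
qed

lemma Hausdorff_sphere_pred: "Hausdorff_space (sphere_pred n)"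
  unfolding sphere_pred_eq by (rule Hausdorff_top_of_set_fun)

lemma compact_sphere_pred: "compact_space (sphere_pred n)"
  by (simp add: sphere_pred_eq compact_space_subtopology compact_sphere_points)

lemma prod_I01_top_of_set: "prod_topology I01 (top_of_set S) = top_of_set ({0..1} \<times> S)"
  using subtopology_Times[of euclideanreal euclidean "{0..1}" S] by (simp only: prod_topology_euclidean)

text \<open>Radii are the cone lines and the parameter is 1 minus the norm. For \<open>n = 0\<close>
  the sphere is empty and the disc is the apex alone.\<close>

theorem disc_mapping_cone:
  "mapping_cone (sphere_pred n) (sphere_pred n) id (disc n) id (\<lambda>(t, x) k. (1 - t) * x k) (\<lambda>_. 0)"
proof -
  let ?q = "\<lambda>(t :: real, x :: nat \<Rightarrow> real) k. (1 - t) * x k"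
  let ?S = "sphere_points n" and ?D = "disc_points n"
  have norm_q: "(\<Sum>k<n. (?q (t, x) k)\<^sup>2) = (1 - t)\<^sup>2" if "x \<in> ?S" for t x
    using that by (simp add: sphere_points_def power_mult_distrib flip: sum_distrib_left)
  have tail_q: "?q (t, x) k = 0" if "x \<in> ?S" "n \<le> k" for t x k
    using that by (simp add: sphere_points_def)
  have q_in: "?q x \<in> ?D" if "x \<in> {0..1} \<times> ?S" for x
  proof -
    obtain t v where tv: "x = (t, v)" "t \<in> {0..1}" "v \<in> ?S" using \<open>x \<in> _\<close> by auto
    then have "(1 - t)\<^sup>2 \<le> 1" by (simp add: abs_square_le_1)
    then show ?thesis using norm_q[OF tv(3), of t] tail_q[OF tv(3), of _ t] tv(1) by (simp add: disc_points_def)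
  qed
  have norm_open: "0 < (\<Sum>k<n. (w k)\<^sup>2) \<and> (\<Sum>k<n. (w k)\<^sup>2) < 1" if w: "w \<in> ?q ` ({0<..<1} \<times> ?S)" for w
  proof -
    obtain t v where tv: "w = ?q (t, v)" "t \<in> {0<..<1}" "v \<in> ?S" using w by auto
    then show ?thesis using norm_q[OF tv(3), of t] by (simp add: abs_square_less_1)
  qed
  show ?thesis
  proof
    show "Hausdorff_space (disc n)" unfolding disc_eq by (rule Hausdorff_top_of_set_fun)
    show "continuous_map (sphere_pred n) (sphere_pred n) id" by simp
    show "continuous_map (sphere_pred n) (disc n) id"
      using sphere_subset_disc[of n] by (auto simp: sphere_pred_eq disc_eq continuous_map_in_subtopology)
    have "continuous_on ({0..1} \<times> ?S) ?q"
      using continuous_on_cone_segment[of "{0..1} \<times> ?S" "\<lambda>_. 0"] by (simp add: case_prod_unfold)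
    then show "continuous_map (prod_topology I01 (sphere_pred n)) (disc n) ?q"
      using q_in unfolding sphere_pred_eq disc_eq prod_I01_top_of_set
      by (simp add: continuous_map_in_subtopology)
    show "?q (0, l) = id (id l)" "?q (1, l) = (\<lambda>_. 0)" for l by (auto simp: fun_eq_iff)
    show "(\<lambda>_. 0) \<in> topspace (disc n)" by (simp add: disc_eq disc_points_def)
    show "inj_on ?q ({0<..<1} \<times> topspace (sphere_pred n))"
    proof (rule inj_onI)
      fix x x' assume x: "x \<in> {0<..<1} \<times> topspace (sphere_pred n)" "x' \<in> {0<..<1} \<times> topspace (sphere_pred n)"
        and eq: "?q x = ?q x'"
      obtain t l t' l' where [simp]: "x = (t, l)" "x' = (t', l')" by fastforce
      have ll: "l \<in> ?S" "l' \<in> ?S" "t < 1" "t' < 1" using x by (auto simp: sphere_pred_eq)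
      have "(1 - t)\<^sup>2 = (1 - t')\<^sup>2"
        using norm_q[OF ll(1), of t] norm_q[OF ll(2), of t'] arg_cong[OF eq, of "\<lambda>w. \<Sum>k<n. (w k)\<^sup>2"]
        by simp
      then have "t = t'" using ll by (simp add: power2_eq_iff)
      moreover have "l v = l' v" for v
        using fun_cong[OF eq, of v] ll \<open>t = t'\<close> by simp
      ultimately show "x = x'" by auto
    qed
    show "id ` topspace (sphere_pred n) \<inter> ?q ` ({0<..<1} \<times> topspace (sphere_pred n)) = {}"
    proof -
      have "w \<notin> ?S" if "w \<in> ?q ` ({0<..<1} \<times> ?S)" for w
        using norm_open[OF that] by (simp add: sphere_points_def)
      then show ?thesis unfolding sphere_pred_eq by auto
    qed
    show "(\<lambda>_. 0) \<notin> id ` topspace (sphere_pred n)"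
      by (simp add: sphere_pred_eq sphere_points_def)
    show "(\<lambda>_. 0) \<notin> ?q ` ({0<..<1} \<times> topspace (sphere_pred n))"
    proof
      assume "(\<lambda>_. 0) \<in> ?q ` ({0<..<1} \<times> topspace (sphere_pred n))"
      then have "(\<lambda>_. 0) \<in> ?q ` ({0<..<1} \<times> ?S)" by (simp add: sphere_pred_eq)
      from norm_open[OF this] show False by simp
    qed
    show "topspace (disc n) \<subseteq> insert (\<lambda>_. 0) (id ` topspace (sphere_pred n) \<union>
        ?q ` ({0<..<1} \<times> topspace (sphere_pred n)))"
    proof
      fix w assume "w \<in> topspace (disc n)"
      then have w: "w \<in> ?D" by (simp add: disc_eq)
      define r where "r = sqrt (\<Sum>k<n. (w k)\<^sup>2)"
      have r2: "r\<^sup>2 = (\<Sum>k<n. (w k)\<^sup>2)" by (simp add: r_def sum_nonneg)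
      have "0 \<le> r" "r \<le> 1" using w by (auto simp: r_def disc_points_def sum_nonneg)
      then consider "r = 0" | "r = 1" | "0 < r" "r < 1" by fastforce
      then show "w \<in> insert (\<lambda>_. 0) (id ` topspace (sphere_pred n) \<union>
        ?q ` ({0<..<1} \<times> topspace (sphere_pred n)))"
      proof cases
        case 1
        then have "\<forall>k<n. w k = 0" using r2 by (simp add: sum_nonneg_eq_0_iff)
        then have "w k = 0" for k using w by (cases "k < n") (auto simp: disc_points_def)
        then show ?thesis by (simp add: fun_eq_iff)
      next
        case 2
        then have "w \<in> ?S" using r2 w by (simp add: sphere_points_def disc_points_def)
        then show ?thesis by (simp add: sphere_pred_eq)
      next
        case 3
        have "(\<Sum>k<n. (w k / r)\<^sup>2) = 1"
          using 3 by (simp add: power_divide r2[symmetric] flip: sum_divide_distrib)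
        then have "(\<lambda>k. w k / r) \<in> ?S" using w by (simp add: sphere_points_def disc_points_def)
        moreover have "w = ?q (1 - r, \<lambda>k. w k / r)" using 3 by (simp add: fun_eq_iff)
        ultimately have "w \<in> ?q ` ({0<..<1} \<times> topspace (sphere_pred n))"
          using 3 by (intro image_eqI[of _ _ "(1 - r, \<lambda>k. w k / r)"]) (auto simp: sphere_pred_eq)
        then show ?thesis by blast
      qed
    qed
  qed (auto simp: compact_sphere_pred)
qed

text \<open>The cone parameter is the latitude.\<close>

theorem nsphere_mapping_cone:
  "mapping_cone (discrete_topology {()}) (sphere_pred n) (\<lambda>_. ()) (nsphere n) (\<lambda>_. vertex n)
    (\<lambda>(t, x) k. if k < n then sin (pi * t) * x k else if k = n then cos (pi * t) else 0)
    (\<lambda>k. - vertex n k)"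
proof -
  let ?q = "\<lambda>(t, x) k. if k < n then sin (pi * t) * x k else if k = n then cos (pi * t) else (0 :: real)"
  let ?S = "sphere_points n" and ?T = "sphere_points (Suc n)"
  have q_in: "?q x \<in> ?T" if "x \<in> {0..1} \<times> ?S" for x
  proof -
    obtain t v where tv: "x = (t, v)" "v \<in> ?S" using \<open>x \<in> _\<close> by auto
    have "(\<Sum>k<n. (?q (t, v) k)\<^sup>2) = (\<Sum>k<n. (sin (pi * t))\<^sup>2 * (v k)\<^sup>2)"
      by (intro sum.cong) (auto simp: power_mult_distrib)
    also have "\<dots> = (sin (pi * t))\<^sup>2"
      using tv by (simp add: sphere_points_def flip: sum_distrib_left)
    finally show ?thesis using tv by (simp add: sphere_points_def)
  qed
  have qn: "?q (t, x) n = cos (pi * t)" for t x by simp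
  have cos_open: "cos (pi * t) < 1" "- 1 < cos (pi * t)" if "t \<in> {0<..<1}" for t
    using cos_monotone_0_pi[of 0 "pi * t"] cos_monotone_0_pi[of "pi * t" pi] that
    by auto
  have vertex_in: "vertex n \<in> ?T" "(\<lambda>k. - vertex n k) \<in> ?T"
    by (auto simp: sphere_points_def vertex_def)
  have wn: "w n < 1 \<and> - 1 < w n" if w: "w \<in> ?q ` ({0<..<1} \<times> ?S)" for w
  proof -
    obtain t v where "w = ?q (t, v)" "t \<in> {0<..<1}" using w by blast
    then show ?thesis using cos_open by simp
  qed
  show ?thesis
  proof
    show "compact_space (discrete_topology {()})" by (simp add: compact_space_discrete_topology)
    show "compact_space (sphere_pred n)" by (rule compact_sphere_pred)
    show "Hausdorff_space (nsphere n)" unfolding nsphere_eq by (rule Hausdorff_top_of_set_fun)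
    show "continuous_map (sphere_pred n) (discrete_topology {()}) (\<lambda>_. ())" by simp
    show "continuous_map (discrete_topology {()}) (nsphere n) (\<lambda>_. vertex n)"
      using vertex_in by (simp add: nsphere_eq)
    have "continuous_on ({0..1} \<times> ?S) ?q"
    proof (rule continuous_on_coordinatewise_then_product)
      fix k
      have "continuous_on ({0..1} \<times> ?S) (\<lambda>x. snd x k)"
        by (rule continuous_on_compose2[OF continuous_on_coordinate[of UNIV k] continuous_on_snd[OF continuous_on_id]]) simp
      then have "continuous_on ({0..1} \<times> ?S) (\<lambda>x. sin (pi * fst x) * snd x k)"
        by (intro continuous_intros)
      moreover have "continuous_on ({0..1} \<times> ?S) (\<lambda>x. cos (pi * fst x))"
        by (intro continuous_intros)
      ultimately show "continuous_on ({0..1} \<times> ?S) (\<lambda>x. ?q x k)"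
        by (cases "k < n"; cases "k = n") (simp_all add: case_prod_unfold)
    qed
    then show "continuous_map (prod_topology I01 (sphere_pred n)) (nsphere n) ?q"
      using q_in unfolding sphere_pred_eq nsphere_eq prod_I01_top_of_set
      by (simp add: continuous_map_in_subtopology)
    show "?q (0, l) = vertex n" "?q (1, l) = (\<lambda>k. - vertex n k)" for l
      by (auto simp: fun_eq_iff vertex_def)
    show "(\<lambda>k. - vertex n k) \<in> topspace (nsphere n)" using vertex_in by (simp add: nsphere_eq)
    show "inj_on ?q ({0<..<1} \<times> topspace (sphere_pred n))"
    proof (rule inj_onI)
      fix x x' assume x: "x \<in> {0<..<1} \<times> topspace (sphere_pred n)" "x' \<in> {0<..<1} \<times> topspace (sphere_pred n)"
        and eq: "?q x = ?q x'"
      obtain t l t' l' where [simp]: "x = (t, l)" "x' = (t', l')" by fastforce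
      have ll: "l \<in> ?S" "l' \<in> ?S" "0 < t" "t < 1" "0 < t'" "t' < 1" using x by (auto simp: sphere_pred_eq)
      have "cos (pi * t) = cos (pi * t')" using fun_cong[OF eq, of n] by simp
      moreover have "0 \<le> pi * t" "pi * t \<le> pi" "0 \<le> pi * t'" "pi * t' \<le> pi" using ll by simp_all
      ultimately have "pi * t = pi * t'" by (rule cos_inj_pi[rotated 4])
      then have "t = t'" by simp
      moreover have "l k = l' k" for k
      proof (cases "k < n")
        case True
        have "sin (pi * t) \<noteq> 0" using sin_gt_zero[of "pi * t"] ll by auto
        then show ?thesis using fun_cong[OF eq, of k] True \<open>t = t'\<close> by simp
      qed (use ll in \<open>simp add: sphere_points_def\<close>)
      ultimately show "x = x'" by auto
    qed
    show "(\<lambda>_. vertex n) ` topspace (discrete_topology {()}) \<inter> ?q ` ({0<..<1} \<times> topspace (sphere_pred n)) = {}"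
    proof (rule equals0I)
      fix w assume w: "w \<in> (\<lambda>_. vertex n) ` topspace (discrete_topology {()}) \<inter>
        ?q ` ({0<..<1} \<times> topspace (sphere_pred n))"
      have "w \<in> ?q ` ({0<..<1} \<times> ?S)" using IntD2[OF w] by (simp add: sphere_pred_eq)
      then have "w n < 1" using wn by blast
      moreover have "w = vertex n" using IntD1[OF w] by simp
      ultimately show False by (simp add: vertex_def)
    qed
    show "(\<lambda>k. - vertex n k) \<notin> (\<lambda>_. vertex n) ` topspace (discrete_topology {()})"
      by (auto simp: vertex_def fun_eq_iff dest: spec[of _ n])
    show "(\<lambda>k. - vertex n k) \<notin> ?q ` ({0<..<1} \<times> topspace (sphere_pred n))"
    proof
      assume "(\<lambda>k. - vertex n k) \<in> ?q ` ({0<..<1} \<times> topspace (sphere_pred n))"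
      then have "(\<lambda>k. - vertex n k) \<in> ?q ` ({0<..<1} \<times> ?S)" by (simp add: sphere_pred_eq)
      from wn[OF this] show False by (simp add: vertex_def)
    qed
    show "topspace (nsphere n) \<subseteq> insert (\<lambda>k. - vertex n k) ((\<lambda>_. vertex n) ` topspace (discrete_topology {()}) \<union>
        ?q ` ({0<..<1} \<times> topspace (sphere_pred n)))"
    proof
      fix w assume "w \<in> topspace (nsphere n)"
      then have w: "(\<Sum>k<n. (w k)\<^sup>2) + (w n)\<^sup>2 = 1" "\<And>k. n < k \<Longrightarrow> w k = 0"
        by (auto simp: nsphere_eq sphere_points_def Suc_le_eq)
      have nn: "0 \<le> (\<Sum>k<n. (w k)\<^sup>2)" by (simp add: sum_nonneg)
      then have "(w n)\<^sup>2 \<le> 1" using w by simp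
      then have wn1: "- 1 \<le> w n" "w n \<le> 1" by (auto simp: abs_square_le_1 abs_le_iff)
      have pole: "w = (\<lambda>k. c * vertex n k)" if "w n = c" "c\<^sup>2 = 1" for c
      proof -
        have "\<forall>k<n. w k = 0" using that w(1) by (simp add: sum_nonneg_eq_0_iff)
        then show ?thesis using that w(2) by (auto simp: vertex_def fun_eq_iff nat_neq_iff)
      qed
      consider "w n = 1" | "w n = - 1" | "- 1 < w n" "w n < 1" using wn1 by fastforce
      then show "w \<in> insert (\<lambda>k. - vertex n k) ((\<lambda>_. vertex n) ` topspace (discrete_topology {()}) \<union>
        ?q ` ({0<..<1} \<times> topspace (sphere_pred n)))"
      proof cases
        case 1
        then show ?thesis using pole[of 1] by simp
      next
        case 2
        then show ?thesis using pole[of "- 1"] by simp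
      next
        case 3
        define a where "a = arccos (w n)"
        have a: "0 < a" "a < pi" "cos a = w n" using 3 by (auto simp: a_def arccos_lt_bounded)
        have sa: "0 < sin a" using a by (intro sin_gt_zero) auto
        define v where "v = (\<lambda>k. if k < n then w k / sin a else 0)"
        have "(\<Sum>k<n. (v k)\<^sup>2) = (\<Sum>k<n. (w k)\<^sup>2) / (sin a)\<^sup>2"
          unfolding sum_divide_distrib by (intro sum.cong) (auto simp: v_def power_divide)
        also have "\<dots> = 1" using w(1) a sa sin_cos_squared_add[of a] by (simp add: field_simps)
        finally have "v \<in> ?S" by (simp add: sphere_points_def v_def)
        moreover have "w = ?q (a / pi, v)"
          using a sa w(2) by (auto simp: v_def fun_eq_iff nat_neq_iff)
        ultimately have "w \<in> ?q ` ({0<..<1} \<times> topspace (sphere_pred n))"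
          using a by (intro image_eqI[of _ _ "(a / pi, v)"]) (auto simp: sphere_pred_eq)
        then show ?thesis by blast
      qed
    qed
  qed auto
qed

text \<open>Reduced homology in degree \<open>m\<close> is nontrivial for the sphere of dimension
  \<open>m\<close> and trivial for every other dimension.\<close>

lemma nsphere_homotopy_equivalent_imp_eq:
  assumes "nsphere m homotopy_equivalent_space nsphere n"
  shows "m = n"
proof (rule ccontr)
  assume "m \<noteq> n"
  have "reduced_homology_group (int m) (nsphere m) \<cong> reduced_homology_group (int m) (nsphere n)"
    using assms by (rule homotopy_equivalent_space_imp_isomorphic_reduced_homology_groups)
  from isomorphic_group_triviality[OF this group_reduced_homology_group group_reduced_homology_group]
  show False using \<open>m \<noteq> n\<close> by (simp only: trivial_reduced_homology_group_nsphere) simp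
qed

section \<open>Attaching cells\<close>

context mapping_cone
begin

lemma topspace_diff_base: "topspace Y - i ` topspace Z = insert p (q ` ({0<..<1} \<times> topspace L))"
proof -
  have "q x \<in> topspace Y" if "x \<in> {0<..<1} \<times> topspace L" for x
    using that q_in[of "fst x" "snd x"] by auto
  then show ?thesis using cover disjoint p_in by blast
qed

end

text \<open>A continuous injection from a compact to a Hausdorff space is an embedding.\<close>

lemma subtopology_base:
  assumes "mapping_cone Z L \<phi> Y id q p"
  shows "subtopology Y (topspace Z) = Z"
proof -
  interpret mapping_cone Z L \<phi> Y id q p by fact
  show ?thesis
    using continuous_imp_embedding_map[OF cont_i compact_Z Hausdorff inj_i] by (simp add: embedding_map_def)
qed

text \<open>The disc is itself a cone over its boundary sphere, so the characteristic map takes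
  radii to cone lines and restricts to \<open>\<phi>\<close> on the boundary. It is injective on the
  interior because \<open>q\<close> is injective there and the apex is separate.\<close>

lemma characteristic_map_exists:
  assumes "mapping_cone Z (sphere_pred n) \<phi> Y id q p"
  obtains \<Psi> where "continuous_map (disc n) Y \<Psi>" "\<Psi> ` disc_interior n = topspace Y - topspace Z"
    "homeomorphic_map (subtopology (disc n) (disc_interior n)) (subtopology Y (\<Psi> ` disc_interior n)) \<Psi>"
    "\<And>x. x \<in> disc_boundary n \<Longrightarrow> \<Psi> x = \<phi> x"
proof -
  interpret mapping_cone Z "sphere_pred n" \<phi> Y id q p by fact
  let ?r = "\<lambda>(t, x) k. (1 - t) * x k"
  interpret D: mapping_cone "sphere_pred n" "sphere_pred n" id "disc n" id ?r "\<lambda>_. 0"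
    by (rule disc_mapping_cone)
  define \<Psi> where "\<Psi> = D.ext \<phi> q p"
  have S: "topspace (sphere_pred n) = disc_boundary n"
    by (simp add: sphere_pred_eq disc_boundary_eq)
  have int: "disc_interior n = insert (\<lambda>_. 0) (?r ` ({0<..<1} \<times> topspace (sphere_pred n)))"
    using D.topspace_diff_base S by (simp add: disc_interior_eq disc_boundary_eq disc_eq)
  have cont: "continuous_map (disc n) Y \<Psi>"
    unfolding \<Psi>_def using continuous_map_compose[OF cont_\<phi> cont_i] cont_q p_in
    by (intro D.continuous_map_ext) (simp_all add: q_0 q_1)
  have \<Psi>_S: "\<Psi> x = \<phi> x" if "x \<in> disc_boundary n" for x
    using D.ext_i[of x \<phi> q p] that S by (simp add: \<Psi>_def)
  have \<Psi>_r: "\<Psi> (?r x) = q x" if "x \<in> {0<..<1} \<times> topspace (sphere_pred n)" for x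
    using D.ext_q[of "fst x" "snd x" q \<phi> p] that q_0 q_1 by (auto simp: \<Psi>_def)
  have \<Psi>_0: "\<Psi> (\<lambda>_. 0) = p" by (simp add: \<Psi>_def D.ext_p)
  have im: "\<Psi> ` ?r ` ({0<..<1} \<times> topspace (sphere_pred n)) = q ` ({0<..<1} \<times> topspace (sphere_pred n))"
    unfolding image_image by (rule image_cong[OF refl \<Psi>_r])
  then have "\<Psi> ` disc_interior n = insert p (q ` ({0<..<1} \<times> topspace (sphere_pred n)))"
    unfolding int image_insert \<Psi>_0 by (simp only:)
  then have img: "\<Psi> ` disc_interior n = topspace Y - topspace Z"
    using topspace_diff_base by simp
  have inj: "inj_on \<Psi> (disc_interior n)"
  proof -
    have "inj_on \<Psi> (?r ` ({0<..<1} \<times> topspace (sphere_pred n)))"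
    proof (rule inj_onI)
      fix a b assume "a \<in> ?r ` ({0<..<1} \<times> topspace (sphere_pred n))" "b \<in> ?r ` ({0<..<1} \<times> topspace (sphere_pred n))"
        and eq: "\<Psi> a = \<Psi> b"
      then obtain x y where x: "x \<in> {0<..<1} \<times> topspace (sphere_pred n)" "a = ?r x"
        and y: "y \<in> {0<..<1} \<times> topspace (sphere_pred n)" "b = ?r y" by blast
      then have "q x = q y" using eq \<Psi>_r[OF x(1)] \<Psi>_r[OF y(1)] by simp
      then show "a = b" using inj_onD[OF inj_q _ x(1) y(1)] x y by simp
    qed
    moreover have "\<Psi> (\<lambda>_. 0) \<notin> \<Psi> ` (?r ` ({0<..<1} \<times> topspace (sphere_pred n)))"
      unfolding \<Psi>_0 im by (rule disjoint(3))
    ultimately show ?thesis unfolding int inj_on_insert by blast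
  qed
  have homeo: "homeomorphic_map (subtopology (disc n) (disc_interior n)) (subtopology Y (\<Psi> ` disc_interior n)) \<Psi>"
  proof (rule bijective_closed_imp_homeomorphic_map)
    have ss: "disc_interior n \<subseteq> topspace (disc n)" by (auto simp: disc_interior_def)
    show "continuous_map (subtopology (disc n) (disc_interior n)) (subtopology Y (\<Psi> ` disc_interior n)) \<Psi>"
      using cont by (auto simp: continuous_map_in_subtopology continuous_map_from_subtopology)
    \<comment> \<open>The boundary goes into the base, so the interior is a full preimage. A closed
      map restricted to a full preimage is closed, which makes the inverse on the open cell
      continuous.\<close>
    have "\<Psi> x \<in> topspace Z" if "x \<in> disc_boundary n" for x
      using \<Psi>_S[OF that] \<phi>_in[of x] that S by simp
    moreover have "topspace (disc n) - disc_interior n = disc_boundary n"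
      using sphere_subset_disc[of n] by (auto simp: disc_interior_eq disc_boundary_eq disc_eq)
    ultimately have "{x \<in> topspace (disc n). \<Psi> x \<in> \<Psi> ` disc_interior n} = disc_interior n"
      using ss img by blast
    moreover have "closed_map (disc n) Y \<Psi>"
      using cont D.compact_space Hausdorff by (rule continuous_imp_closed_map)
    ultimately show "closed_map (subtopology (disc n) (disc_interior n)) (subtopology Y (\<Psi> ` disc_interior n)) \<Psi>"
      by (simp add: closed_map_restriction)
    show "\<Psi> ` topspace (subtopology (disc n) (disc_interior n)) = topspace (subtopology Y (\<Psi> ` disc_interior n))"
      using ss img by (simp add: Int_absorb1)
    show "inj_on \<Psi> (topspace (subtopology (disc n) (disc_interior n)))"
      using inj ss by (simp add: Int_absorb1)
  qed
  show ?thesis using that[OF cont img homeo \<Psi>_S] .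
qed

text \<open>A set is the union of its parts in the closures of the cells, and a finite union of
  closed sets is closed.\<close>

lemma finite_weak_topology:
  assumes "finite I" "\<And>k. k \<in> I \<Longrightarrow> C k \<subseteq> topspace Z" "topspace Z \<subseteq> (\<Union>k\<in>I. C k)" "A \<subseteq> topspace Z"
  shows "closedin Z A \<longleftrightarrow> (\<forall>k\<in>I. closedin Z (A \<inter> Z closure_of C k))"
proof
  assume R: "\<forall>k\<in>I. closedin Z (A \<inter> Z closure_of C k)"
  have "A \<subseteq> (\<Union>k\<in>I. A \<inter> Z closure_of C k)"
  proof
    fix a assume "a \<in> A"
    then obtain k where k: "k \<in> I" "a \<in> C k" using assms(3,4) by auto
    then have "a \<in> Z closure_of C k" using closure_of_subset[OF assms(2)[OF k(1)]] by auto
    then show "a \<in> (\<Union>k\<in>I. A \<inter> Z closure_of C k)" using k \<open>a \<in> A\<close> by auto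
  qed
  then have "A = (\<Union>k\<in>I. A \<inter> Z closure_of C k)" by auto
  moreover have "closedin Z (\<Union>k\<in>I. A \<inter> Z closure_of C k)"
    using assms(1) R by (intro closedin_Union) auto
  ultimately show "closedin Z A" by simp
qed (simp add: closedin_Int)

text \<open>The old complex is a subspace, so the old cells keep their topology. The hypothesis
  \<open>skel\<close> provides closure-finiteness of the new cell with strictly smaller
  dimensions.\<close>

theorem CW_complex_attach:
  assumes CW: "CW_complex Z I dm \<Phi>" and I: "finite I" "c \<notin> I"
    and cone: "mapping_cone Z (sphere_pred (dm c)) \<phi> Y id q p"
    and skel: "\<phi> ` topspace (sphere_pred (dm c)) \<subseteq> (\<Union>j\<in>{j \<in> I. dm j < dm c}. \<Phi> j ` disc_interior (dm j))"
  obtains \<Phi>' where "CW_complex Y (insert c I) dm \<Phi>'" "\<And>j. j \<in> I \<Longrightarrow> \<Phi>' j = \<Phi> j"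
proof -
  interpret mapping_cone Z "sphere_pred (dm c)" \<phi> Y id q p by fact
  obtain \<Psi> where \<Psi>: "continuous_map (disc (dm c)) Y \<Psi>" "\<Psi> ` disc_interior (dm c) = topspace Y - topspace Z"
    "homeomorphic_map (subtopology (disc (dm c)) (disc_interior (dm c))) (subtopology Y (\<Psi> ` disc_interior (dm c))) \<Psi>"
    "\<And>x. x \<in> disc_boundary (dm c) \<Longrightarrow> \<Psi> x = \<phi> x"
    by (rule characteristic_map_exists[OF cone]) (rule that)
  define \<Phi>' where "\<Phi>' = \<Phi>(c := \<Psi>)"
  let ?cell = "\<lambda>j. \<Phi> j ` disc_interior (dm j)" and ?cell' = "\<lambda>j. \<Phi>' j ` disc_interior (dm j)"
  note cw = CW[unfolded CW_complex_def Let_def]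
  note cont = cw[THEN conjunct2, THEN conjunct1, rule_format]
    and homeo = cw[THEN conjunct2, THEN conjunct2, THEN conjunct1, rule_format]
    and disj = cw[THEN conjunct2, THEN conjunct2, THEN conjunct2, THEN conjunct1]
    and union = cw[THEN conjunct2, THEN conjunct2, THEN conjunct2, THEN conjunct2, THEN conjunct1]
    and bd = cw[THEN conjunct2, THEN conjunct2, THEN conjunct2, THEN conjunct2, THEN conjunct2, THEN conjunct1, rule_format]
  have old: "\<Phi>' j = \<Phi> j" if "j \<in> I" for j using that I by (auto simp: \<Phi>'_def)
  have new: "\<Phi>' c = \<Psi>" by (simp add: \<Phi>'_def)
  have cell': "?cell' j = ?cell j" if "j \<in> I" for j using old[OF that] by simp
  have ZY: "topspace Z \<subseteq> topspace Y"
    using continuous_map_image_subset_topspace[OF cont_i] by simp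
  have sub: "?cell j \<subseteq> topspace Z" if "j \<in> I" for j using that union by blast
  have topY: "(\<Union>j\<in>insert c I. ?cell' j) = topspace Y"
    using cell' union \<Psi>(2) ZY new by auto
  have "CW_complex Y (insert c I) dm \<Phi>'"
    unfolding CW_complex_def Let_def
  proof (intro conjI ballI allI impI)
    show "Hausdorff_space Y" by (rule Hausdorff)
    fix j assume "j \<in> insert c I"
    then consider "j = c" | "j \<in> I" by blast
    note cs = this
    show "continuous_map (disc (dm j)) Y (\<Phi>' j)"
      using cs
    proof cases
      case 2
      from continuous_map_compose[OF cont[OF 2] cont_i] show ?thesis using old[OF 2] by simp
    qed (simp add: new \<Psi>)
    show "homeomorphic_map (subtopology (disc (dm j)) (disc_interior (dm j))) (subtopology Y (?cell' j)) (\<Phi>' j)"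
      using cs
    proof cases
      case 2
      have "subtopology Y (?cell j) = subtopology (subtopology Y (topspace Z)) (?cell j)"
        using sub[OF 2] by (simp add: subtopology_subtopology Int_absorb1)
      then have "subtopology Y (?cell j) = subtopology Z (?cell j)" using subtopology_base[OF cone] by simp
      then show ?thesis using homeo[OF 2] old[OF 2] by simp
    next
      case 1
      then show ?thesis using \<Psi>(3) new by simp
    qed
    show "\<exists>J\<subseteq>insert c I. finite J \<and> (\<forall>k\<in>J. dm k < dm j) \<and> \<Phi>' j ` disc_boundary (dm j) \<subseteq> (\<Union>k\<in>J. ?cell' k)"
      using cs
    proof cases
      case 1
      have "\<Phi>' j ` disc_boundary (dm j) = \<phi> ` topspace (sphere_pred (dm c))"
        unfolding 1 new using \<Psi>(4) by (auto simp: sphere_pred_eq disc_boundary_eq)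
      also have "\<dots> \<subseteq> (\<Union>k\<in>{k \<in> I. dm k < dm c}. ?cell' k)"
        using skel cell' by simp
      finally show ?thesis using I 1 by (intro exI[of _ "{k \<in> I. dm k < dm c}"]) auto
    next
      case 2
      obtain J where J: "J \<subseteq> I" "finite J" "\<forall>k\<in>J. dm k < dm j" "\<Phi> j ` disc_boundary (dm j) \<subseteq> (\<Union>k\<in>J. ?cell k)"
        using bd[OF 2] by blast
      have "(\<Union>k\<in>J. ?cell' k) = (\<Union>k\<in>J. ?cell k)"
        using cell' J(1) by (intro SUP_cong) auto
      then show ?thesis using J old[OF 2] by (intro exI[of _ J]) auto
    qed
  next
    show "disjoint_family_on ?cell' (insert c I)"
      unfolding disjoint_family_on_def
    proof (intro ballI impI)
      fix j k assume jk: "j \<in> insert c I" "k \<in> insert c I" "j \<noteq> k"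
      have d: "?cell j \<inter> ?cell k = {}" if "j \<in> I" "k \<in> I"
        using disj jk that by (simp add: disjoint_family_on_def)
      have e: "?cell' c \<inter> ?cell' l = {}" if "l \<in> I" for l
        using sub[OF that] cell'[OF that] \<Psi>(2) new by auto
      show "?cell' j \<inter> ?cell' k = {}"
        using jk d e cell' by (metis Int_commute insert_iff)
    qed
    show "(\<Union>j\<in>insert c I. ?cell' j) = topspace Y" by (rule topY)
    fix A assume A: "A \<subseteq> topspace Y"
    show "closedin Y A = (\<forall>j\<in>insert c I. closedin Y (A \<inter> Y closure_of ?cell' j))"
      by (rule finite_weak_topology) (use I topY A in auto)
  qed
  then show ?thesis using that old by blast
qed

text \<open>The new open cell is placed in the copy of the disc labelled \<open>c\<close>. As
  \<open>c\<close> is not yet a label, it is disjoint from \<open>Z\<close>, and the whole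
  construction stays in one type.\<close>

theorem mapping_cone_cell_exists:
  fixes Z :: "('a \<times> (nat \<Rightarrow> real)) topology"
  assumes Z: "compact_space Z" "Hausdorff_space Z" "topspace Z \<subseteq> I \<times> UNIV" "c \<notin> I"
    and \<phi>: "continuous_map (sphere_pred n) Z \<phi>"
  obtains Y q p where "mapping_cone Z (sphere_pred n) \<phi> Y id q p" "topspace Y \<subseteq> insert c I \<times> UNIV"
proof -
  let ?r = "\<lambda>(t, x) k. (1 - t) * x k"
  interpret D: mapping_cone "sphere_pred n" "sphere_pred n" id "disc n" id ?r "\<lambda>_. 0"
    by (rule disc_mapping_cone)
  let ?j = "\<lambda>x. (c, ?r x)"
  have j: "inj_on ?j ({0<..<1} \<times> topspace (sphere_pred n))"
    using D.inj_q unfolding inj_on_def by blast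
  have c: "x \<notin> topspace Z" if "fst x = c" for x using Z that by auto
  have ij: "id ` topspace Z \<inter> ?j ` ({0<..<1} \<times> topspace (sphere_pred n)) = {}"
    using c by auto
  have p: "(c, \<lambda>_. 0) \<notin> id ` topspace Z" using c by auto
  have pj: "(c, \<lambda>_. 0) \<notin> ?j ` ({0<..<1} \<times> topspace (sphere_pred n))"
  proof
    assume "(c, \<lambda>_. 0) \<in> ?j ` ({0<..<1} \<times> topspace (sphere_pred n))"
    then have "(\<lambda>_. 0) \<in> ?r ` ({0<..<1} \<times> topspace (sphere_pred n))" by blast
    then show False using D.disjoint(3) by blast
  qed
  obtain Y where Y: "mapping_cone Z (sphere_pred n) \<phi> Y id
      (\<lambda>(t, l). if t = 0 then id (\<phi> l) else if t = 1 then (c, \<lambda>_. 0) else ?j (t, l)) (c, \<lambda>_. 0)"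
    "topspace Y = insert (c, \<lambda>_. 0) (id ` topspace Z \<union> ?j ` ({0<..<1} \<times> topspace (sphere_pred n)))"
    by (rule mapping_cone_exists[OF Z(1,2) compact_sphere_pred Hausdorff_sphere_pred \<phi> inj_on_id j ij p pj])
  have "topspace Y \<subseteq> insert c I \<times> UNIV" unfolding Y(2) using Z(3) by auto
  then show ?thesis using that Y(1) by blast
qed

section \<open>Attaching blocks of a matching\<close>

lemma topspace_poset_space: "finite P \<Longrightarrow> topspace (poset_space P) = poset_points P"
  by (simp add: poset_space_eq)

lemma poset_space_insert_contractible_link:
  assumes P: "finite P" "y \<notin> P" and L: "L = {z \<in> P. z < y \<or> y < z}"
    and con: "contractible_space (poset_space L)" "topspace (poset_space L) \<noteq> {}"
  obtains r where "homotopy_equivalence (poset_space (insert y P)) (poset_space P) r"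
    "\<And>t. t \<in> topspace (poset_space P) \<Longrightarrow> r t = t"
proof (rule mapping_cone_contractible[OF mapping_cone_insert[OF P L] con])
  fix r assume "homotopy_equivalence (poset_space (insert y P)) (poset_space P) r"
    "\<And>z. z \<in> topspace (poset_space P) \<Longrightarrow> r (id z) = z"
  then show thesis using that[of r] by simp
qed

section \<open>Heights along admissible edges\<close>

text \<open>A longest chain below \<open>x\<close> can be prolonged by \<open>y\<close>.\<close>

lemma elem_height_strict_mono:
  assumes X: "finite X" "x \<in> X" "y \<in> X" "x < y"
  shows "elem_height X x < elem_height X y"
proof -
  have fin: "finite (order_complex (poset_down X z))" for z
  proof (rule finite_subset)
    show "order_complex (poset_down X z) \<subseteq> Pow X" by (auto simp: order_complex_def poset_down_def)
  qed (use X in simp)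
  have "{x} \<in> order_complex (poset_down X x)"
    using X by (auto simp: order_complex_def poset_down_def chain_def)
  then have "elem_height X x \<in> (\<lambda>C. card C - 1) ` order_complex (poset_down X x)"
    unfolding elem_height_def poset_height_def using fin by (intro Max_in) auto
  then obtain C where C: "C \<in> order_complex (poset_down X x)" "elem_height X x = card C - 1" by auto
  have CX: "C \<subseteq> poset_down X x" "finite C" "C \<noteq> {}" "Complete_Partial_Order.chain (\<le>) C"
    using C(1) by (auto simp: order_complex_def)
  have below: "z < y" if "z \<in> C" for z
    using CX(1) that X(4) by (auto simp: poset_down_def)
  then have "y \<notin> C" by auto
  have "insert y C \<subseteq> poset_down X y"
    using CX(1) below[THEN less_imp_le] X(3) by (auto simp: poset_down_def)
  moreover have "Complete_Partial_Order.chain (\<le>) (insert y C)"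
    using CX(4) below[THEN less_imp_le] unfolding chain_def by auto
  ultimately have "insert y C \<in> order_complex (poset_down X y)"
    using CX(2) by (simp add: order_complex_def)
  then have "card (insert y C) - 1 \<le> elem_height X y"
    unfolding elem_height_def poset_height_def using fin by (intro Max_ge) auto
  \<comment> \<open>Since \<open>card C - 1\<close> is truncated, strictness needs \<open>C\<close>
    to be nonempty.\<close>
  moreover have "0 < card C" using CX by (simp add: card_gt_0_iff)
  ultimately show ?thesis using C(2) CX(2) \<open>y \<notin> C\<close> by simp
qed

text \<open>Inserting \<open>x\<close> into the contractible \<open>?A\<close> attaches a cone over
  a homotopy sphere of dimension h(x) - 1 to what is a point up to homotopy; the result is a sphere
  of dimension h(x). By h-regularity at \<open>y\<close> it is also a sphere of dimension h(y) -
  1.\<close>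

theorem admissible_edge_height:
  assumes X: "finite X" "h_regular X" and adm: "admissible_edge X (x, y)"
  shows "elem_height X y = Suc (elem_height X x)"
proof -
  let ?h = "elem_height X"
  let ?A = "poset_strict_down X y - {x}" and ?L = "poset_strict_down X x"
  have xy: "x \<in> X" "y \<in> X" "x < y" "\<And>z. z \<in> X \<Longrightarrow> x < z \<Longrightarrow> \<not> z < y"
    and A: "topspace (poset_space ?A) \<noteq> {}" "contractible_space (poset_space ?A)"
    using adm by (auto simp: admissible_edge_def hasse_def Let_def)
  have fin: "finite ?A" using X by (simp add: poset_strict_down_def)
  \<comment> \<open>Nothing lies strictly between \<open>x\<close> and \<open>y\<close>, so the link
    of \<open>x\<close> in \<open>?A\<close> has no part above \<open>x\<close>.\<close>
  have L: "?L = {z \<in> ?A. z < x \<or> x < z}"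
    using xy by (auto simp: poset_strict_down_def)
  have ins: "insert x ?A = poset_strict_down X y" using xy by (auto simp: poset_strict_down_def)
  have cone: "mapping_cone (poset_space ?A) (poset_space ?L) id (poset_space (poset_strict_down X y)) id
      (\<lambda>(t, l) v. (1 - t) * l v + t * vertex x v) (vertex x)"
    using mapping_cone_insert[OF fin _ L] ins by simp
  have "poset_space ?L homotopy_equivalent_space sphere_pred (?h x)"
    using X(2) xy(1) unfolding h_regular_def by (rule bspec)
  then have "sphere_pred (?h x) homotopy_equivalent_space poset_space ?L"
    by (subst homotopy_equivalent_space_sym)
  then obtain g where g: "homotopy_equivalence (sphere_pred (?h x)) (poset_space ?L) g"
    unfolding homotopy_equivalent_space_iff by blast
  obtain a where a: "htp (poset_space ?A) (poset_space ?A) id (\<lambda>_. a)"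
    using A(2) unfolding contractible_space_def by blast
  have a_in: "a \<in> topspace (poset_space ?A)"
    using homotopic_with_imp_continuous_maps[OF a] A(1) by auto
  have f: "homotopy_equivalence (poset_space ?A) (discrete_topology {()}) (\<lambda>_. ())"
    unfolding homotopy_equivalence_def
  proof (intro conjI exI)
    show "continuous_map (poset_space ?A) (discrete_topology {()}) (\<lambda>_. ())" by simp
    show "continuous_map (discrete_topology {()}) (poset_space ?A) (\<lambda>_. a)" using a_in by simp
    show "htp (poset_space ?A) (poset_space ?A) ((\<lambda>_. a) \<circ> (\<lambda>_. ())) id"
      using homotopic_with_symD[OF a] by (simp add: o_def)
    show "htp (discrete_topology {()}) (discrete_topology {()}) ((\<lambda>_. ()) \<circ> (\<lambda>_. a)) id"
      by (rule htp_eq) auto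
  qed
  have sph: "mapping_cone (discrete_topology {()}) (sphere_pred (?h x)) ((\<lambda>_. ()) \<circ> id \<circ> g) (nsphere (?h x)) (\<lambda>_. vertex (?h x))
    (\<lambda>(t, u) k. if k < ?h x then sin (pi * t) * u k else if k = ?h x then cos (pi * t) else 0)
    (\<lambda>k. - vertex (?h x) k)"
    using nsphere_mapping_cone by (simp add: o_def)
  obtain F where "homotopy_equivalence (poset_space (poset_strict_down X y)) (nsphere (?h x)) F"
    by (rule mapping_cone_homotopy_equivalence[OF cone sph f g Hausdorff_poset_space])
  then have "nsphere (?h x) homotopy_equivalent_space poset_space (poset_strict_down X y)"
    by (subst homotopy_equivalent_space_sym) (auto simp: homotopy_equivalent_space_iff)
  also have "poset_space (poset_strict_down X y) homotopy_equivalent_space sphere_pred (?h y)"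
    using X(2) xy(2) unfolding h_regular_def by (rule bspec)
  finally have "nsphere (?h x) homotopy_equivalent_space sphere_pred (?h y)" .
  \<comment> \<open>Gives \<open>?h y\<close> > 0, so that \<open>sphere_pred (?h y)\<close> is a
    genuine sphere.\<close>
  moreover have "?h x < ?h y" using X(1) xy(1-3) by (rule elem_height_strict_mono)
  ultimately have "nsphere (?h x) homotopy_equivalent_space nsphere (?h y - 1)"
    by (simp add: sphere_pred_def)
  then show ?thesis
    using nsphere_homotopy_equivalent_imp_eq \<open>?h x < ?h y\<close> by fastforce
qed

text \<open>The last clause keeps attaching maps inside the skeleton of the right dimension, so that no
  cellular approximation is needed as long as cells are attached in order of dimension.\<close>

definition cell_model :: "'a::order set \<Rightarrow> ('a \<Rightarrow> nat) \<Rightarrow> 'a set \<Rightarrow> ('a \<times> (nat \<Rightarrow> real)) topology \<Rightarrow>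
    ('a \<Rightarrow> (nat \<Rightarrow> real) \<Rightarrow> 'a \<times> (nat \<Rightarrow> real)) \<Rightarrow> (('a \<Rightarrow> real) \<Rightarrow> 'a \<times> (nat \<Rightarrow> real)) \<Rightarrow> bool" where
  "cell_model C h P Z \<Phi> f \<longleftrightarrow> CW_complex Z (C \<inter> P) h \<Phi> \<and> compact_space Z \<and>
     topspace Z \<subseteq> (C \<inter> P) \<times> UNIV \<and> homotopy_equivalence (poset_space P) Z f \<and>
     (\<forall>n. f ` topspace (poset_space {x \<in> P. h x < n}) \<subseteq>
        (\<Union>c\<in>{c \<in> C \<inter> P. h c < n}. \<Phi> c ` disc_interior (h c)))"

lemma CW_complexD:
  assumes "CW_complex Z I dm \<Phi>"
  shows "Hausdorff_space Z" "(\<Union>j\<in>I. \<Phi> j ` disc_interior (dm j)) = topspace Z"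
  using assms unfolding CW_complex_def Let_def by simp_all

text \<open>The bound \<open>m\<close> lies between the dimensions of all cells and the heights of
  the new elements. For \<open>n \<le> m\<close> no new element has height below \<open>n\<close>,
  and the skeleton clause is inherited; for \<open>n > m\<close> every cell has dimension below
  \<open>n\<close>, and the clause says nothing.\<close>

lemma cell_model_extend:
  assumes P: "finite P" "finite Q" "P \<subseteq> Q" and f: "cell_model C h P Z \<Phi> f"
    and CW: "CW_complex Z' (C \<inter> Q) h \<Phi>'" "compact_space Z'" "topspace Z' \<subseteq> (C \<inter> Q) \<times> UNIV"
    and f': "homotopy_equivalence (poset_space Q) Z' f'"
    and ff': "\<And>t. t \<in> topspace (poset_space P) \<Longrightarrow> f' t = f t"
    and \<Phi>': "\<And>c. c \<in> C \<inter> P \<Longrightarrow> \<Phi>' c = \<Phi> c"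
    and new: "\<And>x. x \<in> Q - P \<Longrightarrow> m \<le> h x" and dim: "\<And>c. c \<in> C \<inter> Q \<Longrightarrow> h c \<le> m"
  shows "cell_model C h Q Z' \<Phi>' f'"
  unfolding cell_model_def
proof (intro conjI allI CW f')
  fix n
  show "f' ` topspace (poset_space {x \<in> Q. h x < n}) \<subseteq>
        (\<Union>c\<in>{c \<in> C \<inter> Q. h c < n}. \<Phi>' c ` disc_interior (h c))"
  proof (cases "n \<le> m")
    case True
    have eq: "{x \<in> Q. h x < n} = {x \<in> P. h x < n}"
      using P new True by (auto; force)
    have "topspace (poset_space {x \<in> P. h x < n}) \<subseteq> topspace (poset_space P)"
      using P by (simp add: topspace_poset_space poset_points_mono)
    then have "f' ` topspace (poset_space {x \<in> P. h x < n}) = f ` topspace (poset_space {x \<in> P. h x < n})"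
      using ff' by (intro image_cong) auto
    also have "\<dots> \<subseteq> (\<Union>c\<in>{c \<in> C \<inter> P. h c < n}. \<Phi> c ` disc_interior (h c))"
      using f by (simp add: cell_model_def)
    also have "\<dots> \<subseteq> (\<Union>c\<in>{c \<in> C \<inter> Q. h c < n}. \<Phi>' c ` disc_interior (h c))"
      using P \<Phi>' by (intro UN_mono) auto
    finally show ?thesis unfolding eq .
  next
    case False
    have "{c \<in> C \<inter> Q. h c < n} = C \<inter> Q" using False dim by force
    then have "(\<Union>c\<in>{c \<in> C \<inter> Q. h c < n}. \<Phi>' c ` disc_interior (h c)) = topspace Z'"
      using CW_complexD(2)[OF CW(1)] by simp
    moreover have "f' ` topspace (poset_space {x \<in> Q. h x < n}) \<subseteq> f' ` topspace (poset_space Q)"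
      using P by (intro image_mono) (simp add: topspace_poset_space poset_points_mono)
    moreover have "f' ` topspace (poset_space Q) \<subseteq> topspace Z'"
      using f' unfolding homotopy_equivalence_def
      by (intro continuous_map_image_subset_topspace) (elim conjE)
    ultimately show ?thesis by (metis subset_trans)
  qed
qed

text \<open>The attaching map factors through the complex of \<open>L\<close>, whose elements have
  height below \<open>h c\<close>. The skeleton clause therefore puts its image into cells of
  dimension below \<open>h c\<close>.\<close>

lemma cell_model_insert_critical:
  assumes P: "finite P" "c \<notin> P" "c \<in> C" and f: "cell_model C h P Z \<Phi> f"
    and above: "\<And>z. z \<in> P \<Longrightarrow> \<not> c < z" and L: "L = {z \<in> P. z < c}"
    and sphere: "poset_space L homotopy_equivalent_space sphere_pred (h c)"
    and hL: "\<And>z. z \<in> L \<Longrightarrow> h z < h c" and dim: "\<And>b. b \<in> C \<inter> P \<Longrightarrow> h b \<le> h c"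
  obtains Z' \<Phi>' f' where "cell_model C h (insert c P) Z' \<Phi>' f'"
proof -
  have CW: "CW_complex Z (C \<inter> P) h \<Phi>" and cpt: "compact_space Z" and sub: "topspace Z \<subseteq> (C \<inter> P) \<times> UNIV"
    and he: "homotopy_equivalence (poset_space P) Z f"
    and skel: "f ` topspace (poset_space {x \<in> P. h x < h c}) \<subseteq>
        (\<Union>b\<in>{b \<in> C \<inter> P. h b < h c}. \<Phi> b ` disc_interior (h b))"
    using f by (simp_all add: cell_model_def)
  have L': "L = {z \<in> P. z < c \<or> c < z}" using L above by auto
  have finL: "finite L" using P L by simp
  note cone = mapping_cone_insert[OF P(1,2) L']
  obtain g where g: "homotopy_equivalence (sphere_pred (h c)) (poset_space L) g"
    using sphere homotopy_equivalent_space_iff homotopy_equivalent_space_sym by blast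
  have cf: "continuous_map (poset_space P) Z f" and cg: "continuous_map (sphere_pred (h c)) (poset_space L) g"
    using he g by (simp_all add: homotopy_equivalence_def)
  interpret mapping_cone "poset_space P" "poset_space L" id "poset_space (insert c P)" id
    "\<lambda>(t, l) v. (1 - t) * l v + t * vertex c v" "vertex c" by (rule cone)
  have \<phi>: "continuous_map (sphere_pred (h c)) Z (f \<circ> id \<circ> g)"
    using cont_\<phi> cf cg by (intro continuous_map_compose)
  obtain Y q p where Y: "mapping_cone Z (sphere_pred (h c)) (f \<circ> id \<circ> g) Y id q p"
    "topspace Y \<subseteq> insert c (C \<inter> P) \<times> UNIV"
    by (rule mapping_cone_cell_exists[OF cpt CW_complexD(1)[OF CW] sub _ \<phi>, of c]) (use P in auto)
  interpret Y: mapping_cone Z "sphere_pred (h c)" "f \<circ> id \<circ> g" Y id q p by (rule Y(1))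
  obtain F where F: "homotopy_equivalence (poset_space (insert c P)) Y F"
    "\<And>t. t \<in> topspace (poset_space P) \<Longrightarrow> F (id t) = id (f t)"
    by (rule mapping_cone_homotopy_equivalence[OF cone Y(1) he g Hausdorff_poset_space]) (rule that)
  have "(f \<circ> id \<circ> g) ` topspace (sphere_pred (h c)) \<subseteq> f ` topspace (poset_space L)"
    using continuous_map_image_subset_topspace[OF cg] by auto
  also have "\<dots> \<subseteq> f ` topspace (poset_space {x \<in> P. h x < h c})"
  proof (rule image_mono)
    have "L \<subseteq> {x \<in> P. h x < h c}" using L hL by auto
    then show "topspace (poset_space L) \<subseteq> topspace (poset_space {x \<in> P. h x < h c})"
      using P finL by (simp add: topspace_poset_space poset_points_mono)
  qed
  also note skel
  finally have att: "(f \<circ> id \<circ> g) ` topspace (sphere_pred (h c)) \<subseteq> (\<Union>b\<in>{b \<in> C \<inter> P. h b < h c}. \<Phi> b ` disc_interior (h b))" .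
  have Cins: "C \<inter> insert c P = insert c (C \<inter> P)" using P by auto
  obtain \<Phi>' where \<Phi>': "CW_complex Y (insert c (C \<inter> P)) h \<Phi>'" "\<And>b. b \<in> C \<inter> P \<Longrightarrow> \<Phi>' b = \<Phi> b"
    by (rule CW_complex_attach[OF CW _ _ Y(1) att]) (use P that in auto)
  have "cell_model C h (insert c P) Y \<Phi>' F"
    by (rule cell_model_extend[OF P(1) _ _ f, where m = "h c"])
       (use P \<Phi>' F Y(2) Y.compact_space dim Cins in auto)
  then show ?thesis by (rule that)
qed

text \<open>With \<open>y\<close> added first, its link does not contain \<open>x\<close>. The
  intermediate set \<open>insert y P\<close> is not a down-set in \<open>X\<close>, which is why
  links include elements above as well as below. Both retractions fix the old complex, so composing
  \<open>f\<close> with them extends \<open>f\<close>.\<close>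

lemma cell_model_insert_pair:
  assumes P: "finite P" "x \<notin> P" "y \<notin> P" "x \<notin> C" "y \<notin> C" "x < y" and f: "cell_model C h P Z \<Phi> f"
    and above: "\<And>z. z \<in> P \<Longrightarrow> \<not> x < z" "\<And>z. z \<in> P \<Longrightarrow> \<not> y < z"
    and L: "L = {z \<in> P. z < y}" "contractible_space (poset_space L)" "topspace (poset_space L) \<noteq> {}"
    and dim: "h x \<le> h y" "\<And>b. b \<in> C \<inter> P \<Longrightarrow> h b \<le> h x"
  obtains f' where "cell_model C h (insert x (insert y P)) Z \<Phi> f'"
proof -
  have CW: "CW_complex Z (C \<inter> P) h \<Phi>" and cpt: "compact_space Z" and sub: "topspace Z \<subseteq> (C \<inter> P) \<times> UNIV"
    and he: "homotopy_equivalence (poset_space P) Z f"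
    using f by (simp_all add: cell_model_def)
  have L': "L = {z \<in> P. z < y \<or> y < z}" using L above by auto
  obtain r where r: "homotopy_equivalence (poset_space (insert y P)) (poset_space P) r"
    "\<And>t. t \<in> topspace (poset_space P) \<Longrightarrow> r t = t"
    by (rule poset_space_insert_contractible_link[OF P(1,3) L' L(2,3)]) (rule that)
  let ?K = "insert y {z \<in> P. z < x}"
  have K: "?K = {z \<in> insert y P. z < x \<or> x < z}" using P above by auto
  have finK: "finite ?K" using P by simp
  have "contractible_space (poset_space ?K)"
    by (rule contractible_poset_space_cone[of _ y]) (use P in auto)
  moreover have "topspace (poset_space ?K) \<noteq> {}"
    using vertex_in_poset_points[OF finK, of y] finK by (auto simp: topspace_poset_space)
  moreover have "finite (insert y P)" "x \<notin> insert y P" using P by auto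
  ultimately obtain s where s: "homotopy_equivalence (poset_space (insert x (insert y P))) (poset_space (insert y P)) s"
    "\<And>t. t \<in> topspace (poset_space (insert y P)) \<Longrightarrow> s t = t"
    using poset_space_insert_contractible_link[OF _ _ K] by metis
  have PP: "topspace (poset_space P) \<subseteq> topspace (poset_space (insert y P))"
    using P poset_points_mono[of "insert y P" P] by (auto simp: topspace_poset_space)
  have "homotopy_equivalence (poset_space (insert x (insert y P))) Z (f \<circ> (r \<circ> s))"
    by (intro homotopy_equivalence_compose[OF _ he] homotopy_equivalence_compose[OF s(1) r(1)])
  moreover have "C \<inter> insert x (insert y P) = C \<inter> P" using P by auto
  moreover have "(f \<circ> (r \<circ> s)) t = f t" if "t \<in> topspace (poset_space P)" for t
    using that PP r(2) s(2) by auto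
  ultimately have "cell_model C h (insert x (insert y P)) Z \<Phi> (f \<circ> (r \<circ> s))"
    by (intro cell_model_extend[OF P(1) _ _ f, where m = "h x"]) (use P CW cpt sub dim in auto)
  then show ?thesis by (rule that)
qed

lemma cell_model_empty: "cell_model C h {} trivial_topology \<Phi> f"
proof -
  have emp: "poset_space ({} :: 'a set) = trivial_topology"
    by (simp add: poset_space_eq poset_points_def)
  have "CW_complex trivial_topology {} h \<Phi>"
    by (simp add: CW_complex_def Hausdorff_space_def disjoint_family_on_def)
  moreover have "homotopy_equivalence (poset_space {}) trivial_topology f"
    unfolding homotopy_equivalence_def emp
    \<comment> \<open>On the empty space every function is continuous, so \<open>undefined\<close>
      serves as inverse.\<close>
    by (intro conjI exI[of _ undefined] htp_eq) (simp_all add: continuous_map_on_empty)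
  ultimately show ?thesis
    by (simp add: cell_model_def emp)
qed

section \<open>The order in which blocks are attached\<close>

locale admissible_matching =
  fixes X :: "'a::order set" and M :: "('a \<times> 'a) set"
  assumes fin: "finite X" and reg: "h_regular X" and adm: "admissible_morse_matching X M"
begin

abbreviation ht :: "'a \<Rightarrow> nat" where "ht \<equiv> elem_height X"
abbreviation crit :: "'a set" where "crit \<equiv> critical_points X M"

text \<open>Blocks are critical points and matched pairs; cells are attached block by block in order of rank,
  which makes their dimensions weakly increase.  Truncated subtraction is harmless: upper elements of
  pairs have positive height.\<close>

definition rank :: "'a \<Rightarrow> nat" where
  "rank x = (if x \<in> crit then 2 * ht x else if x \<in> fst ` M then 2 * ht x + 1 else 2 * ht x - 1)"

lemma ht_less: "x \<in> X \<Longrightarrow> y \<in> X \<Longrightarrow> x < y \<Longrightarrow> ht x < ht y"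
  using fin by (rule elem_height_strict_mono)

lemma matched:
  assumes "(a, b) \<in> M"
  shows "a \<in> X" "b \<in> X" "a < b" "ht b = Suc (ht a)" "(a, b) \<in> hasse X" "admissible_edge X (a, b)"
    "a \<notin> crit" "b \<notin> crit"
proof -
  show e: "admissible_edge X (a, b)" using adm assms by (auto simp: admissible_morse_matching_def)
  then show "(a, b) \<in> hasse X" by (simp add: admissible_edge_def)
  then show "a \<in> X" "b \<in> X" "a < b" by (auto simp: hasse_def)
  show "ht b = Suc (ht a)" using fin reg e by (rule admissible_edge_height)
  show "a \<notin> crit" "b \<notin> crit" using assms by (force simp: critical_points_def)+
qed

lemma matching_disjoint:
  assumes "(a, b) \<in> M" "(c, d) \<in> M" "{a, b} \<inter> {c, d} \<noteq> {}"
  shows "a = c \<and> b = d"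
proof (rule ccontr)
  assume "\<not> (a = c \<and> b = d)"
  then have "(a, b) \<noteq> (c, d)" by simp
  then have "{fst (a, b), snd (a, b)} \<inter> {fst (c, d), snd (c, d)} = {}"
    using adm assms(1,2) unfolding admissible_morse_matching_def morse_matching_def hasse_matching_def by blast
  with assms(3) show False by simp
qed

lemma noncritical:
  assumes "x \<in> X" "x \<notin> crit"
  obtains y where "(x, y) \<in> M" | y where "(y, x) \<in> M"
  using assms by (fastforce simp: critical_points_def)

lemma rank_critical: "x \<in> crit \<Longrightarrow> rank x = 2 * ht x"
  by (simp add: rank_def)

lemma rank_lower:
  assumes "(a, b) \<in> M"
  shows "rank a = 2 * ht a + 1"
proof -
  have "a \<in> fst ` M" using assms by force
  then show ?thesis using matched(7)[OF assms] by (simp add: rank_def)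
qed

lemma rank_upper:
  assumes "(a, b) \<in> M"
  shows "rank b = 2 * ht a + 1"
proof -
  have "b \<notin> fst ` M"
  proof
    assume "b \<in> fst ` M"
    then obtain c where "(b, c) \<in> M" by auto
    then have "a = b" using matching_disjoint[OF assms] by auto
    then show False using matched(3)[OF assms] by simp
  qed
  then show ?thesis using matched(4,8)[OF assms] by (simp add: rank_def)
qed

lemma rank_le: "rank x \<le> 2 * ht x + 1"
  unfolding rank_def by auto

text \<open>At height at most \<open>m\<close>, critical points have rank at most
  \<open>2 * m\<close> and upper ends at most \<open>2 * m - 1\<close>, so only a lower end of
  height exactly \<open>m\<close> can reach \<open>2 * m + 1\<close>.\<close>

lemma rank_ge_imp:
  assumes "x \<in> X" "ht x \<le> m" "2 * m + 1 \<le> rank x"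
  obtains y where "(x, y) \<in> M" "ht x = m"
proof (cases "x \<in> crit")
  case True
  then show ?thesis using assms rank_critical by simp
next
  case False
  from assms(1) False show ?thesis
  proof (cases rule: noncritical)
    case (1 y)
    then show ?thesis using rank_lower[OF 1] assms that by simp
  next
    case (2 y)
    then show ?thesis using rank_upper[OF 2] matched(4)[OF 2] assms by simp
  qed
qed

text \<open>Being a down-set is a separate clause, since comparable elements of different pairs may
  have equal rank. The rank clause bounds the dimensions of the cells already present.\<close>

definition initial :: "'a set \<Rightarrow> bool" where
  "initial P \<longleftrightarrow> P \<subseteq> X \<and> (\<forall>x\<in>P. \<forall>z\<in>X. z < x \<longrightarrow> z \<in> P) \<and> (\<forall>(a, b)\<in>M. a \<in> P \<longleftrightarrow> b \<in> P) \<and>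
     (\<forall>x\<in>P. \<forall>y\<in>X - P. rank x \<le> rank y)"

lemma initialD:
  assumes "initial P"
  shows "P \<subseteq> X" "\<And>x z. x \<in> P \<Longrightarrow> z \<in> X \<Longrightarrow> z < x \<Longrightarrow> z \<in> P"
    "\<And>a b. (a, b) \<in> M \<Longrightarrow> a \<in> P \<longleftrightarrow> b \<in> P" "\<And>x y. x \<in> P \<Longrightarrow> y \<in> X \<Longrightarrow> y \<notin> P \<Longrightarrow> rank x \<le> rank y"
  using assms unfolding initial_def by auto

lemma acyclic_reversed: "acyclic (hasse_reversed X M)"
  using adm by (simp add: admissible_morse_matching_def morse_matching_def)

text \<open>Anything below \<open>c\<close> has rank at most \<open>2 * ht c - 1\<close>, less than
  the least rank outside \<open>P\<close>, hence is already in \<open>P\<close>. The link of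
  \<open>c\<close> is therefore its full strict down-set, a homotopy sphere by h-regularity.\<close>

lemma extend_critical:
  assumes P: "initial P" and c: "c \<in> crit" "c \<in> X - P" and min: "\<And>x. x \<in> X - P \<Longrightarrow> rank c \<le> rank x"
    and f: "cell_model crit ht P Z \<Phi> f"
  shows "initial (insert c P) \<and> (\<exists>Z \<Phi> f. cell_model crit ht (insert c P) Z \<Phi> f)"
proof
  note P = initialD[OF P]
  have below: "z \<in> P" if "z \<in> X" "z < c" for z
  proof (rule ccontr)
    assume "z \<notin> P"
    then have "2 * ht c \<le> rank z" using min[of z] that rank_critical[OF c(1)] by simp
    then show False using rank_le[of z] ht_less[of z c] that c by simp
  qed
  have nM: "c \<noteq> a \<and> c \<noteq> b" if "(a, b) \<in> M" for a b using matched(7,8)[OF that] c by auto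
  show "initial (insert c P)"
    unfolding initial_def
  proof (intro conjI)
    show "insert c P \<subseteq> X" using P(1) c by auto
    show "\<forall>x\<in>insert c P. \<forall>z\<in>X. z < x \<longrightarrow> z \<in> insert c P" using P(2) below by auto
    show "\<forall>(a, b)\<in>M. a \<in> insert c P \<longleftrightarrow> b \<in> insert c P" using P(3) nM by auto
    show "\<forall>x\<in>insert c P. \<forall>y\<in>X - insert c P. rank x \<le> rank y" using P(4) min by auto
  qed
  have L: "poset_strict_down X c = {z \<in> P. z < c}"
    using below P(1) by (auto simp: poset_strict_down_def)
  have finP: "finite P" using P(1) fin finite_subset by blast
  have above: "\<not> c < z" if "z \<in> P" for z using P(2)[OF that, of c] c by auto
  have sphere: "poset_space (poset_strict_down X c) homotopy_equivalent_space sphere_pred (ht c)"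
    using reg c unfolding h_regular_def by blast
  have hL: "ht z < ht c" if "z \<in> poset_strict_down X c" for z
    using that c by (intro ht_less) (auto simp: poset_strict_down_def)
  have dim: "ht b \<le> ht c" if "b \<in> crit \<inter> P" for b
    using P(4)[of b c] that c rank_critical by auto
  show "\<exists>Z \<Phi> f. cell_model crit ht (insert c P) Z \<Phi> f"
    by (rule cell_model_insert_critical[OF finP _ c(1) f above L sphere hL dim]) (use c in auto)
qed

text \<open>An element \<open>z \<noteq> a\<close> below \<open>b\<close> that is missing from
  \<open>P\<close> must be a lower end with the height and rank of \<open>a\<close>. It is then
  covered by \<open>b\<close>, so a \<rightarrow> b \<rightarrow> z is a path in the modified
  diagram, contrary to \<open>last\<close>.\<close>

lemma extend_pair:
  assumes P: "initial P" and ab: "(a, b) \<in> M" "a \<notin> P" and min: "\<And>x. x \<in> X - P \<Longrightarrow> rank a \<le> rank x"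
    and last: "\<And>a' b'. (a', b') \<in> M \<Longrightarrow> a' \<notin> P \<Longrightarrow> rank a' = rank a \<Longrightarrow> (a, a') \<notin> (hasse_reversed X M)\<^sup>+"
    and f: "cell_model crit ht P Z \<Phi> f"
  shows "initial (insert a (insert b P)) \<and> (\<exists>Z \<Phi> f. cell_model crit ht (insert a (insert b P)) Z \<Phi> f)"
proof
  note P = initialD[OF P]
  note m = matched[OF ab(1)]
  have ra: "rank a = 2 * ht a + 1" by (rule rank_lower[OF ab(1)])
  have rb: "rank b = rank a" using rank_upper[OF ab(1)] ra by simp
  have b: "b \<notin> P" using P(3)[OF ab(1)] ab by simp
  have below: "z \<in> P" if z: "z \<in> X" "z < b" "z \<noteq> a" for z
  proof (rule ccontr)
    assume zP: "z \<notin> P"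
    have hz: "ht z \<le> ht a" using ht_less[OF z(1) m(2) z(2)] m(4) by simp
    have "2 * ht a + 1 \<le> rank z" using min[of z] z zP ra by simp
    with z(1) hz obtain y where y: "(z, y) \<in> M" "ht z = ht a" by (rule rank_ge_imp)
    have "\<not> (\<exists>w\<in>X. z < w \<and> w < b)"
    proof
      assume "\<exists>w\<in>X. z < w \<and> w < b"
      then obtain w where w: "w \<in> X" "z < w" "w < b" by blast
      show False using ht_less[OF z(1) w(1,2)] ht_less[OF w(1) m(2) w(3)] y(2) m(4) by simp
    qed
    then have "(z, b) \<in> hasse X" using z m by (auto simp: hasse_def)
    moreover have "(z, b) \<notin> M" using matching_disjoint[OF ab(1), of z b] z by auto
    ultimately have "(b, z) \<in> hasse_reversed X M" by (simp add: hasse_reversed_def)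
    moreover have "(a, b) \<in> hasse_reversed X M" using m ab by (simp add: hasse_reversed_def)
    ultimately have "(a, z) \<in> (hasse_reversed X M)\<^sup>+" by auto
    moreover have "rank z = rank a" using rank_lower[OF y(1)] y(2) ra by simp
    ultimately show False using last[OF y(1) zP] by simp
  qed
  have below': "z \<in> P" if "z \<in> X" "z < a" for z
    using below[of z] that m(3) by auto
  have dj: "(c \<in> {a, b}) = (d \<in> {a, b})" if "(c, d) \<in> M" for c d
    using matching_disjoint[OF ab(1) that] by auto
  show "initial (insert a (insert b P))"
    unfolding initial_def
  proof (intro conjI)
    show "insert a (insert b P) \<subseteq> X" using P(1) m by auto
    show "\<forall>x\<in>insert a (insert b P). \<forall>z\<in>X. z < x \<longrightarrow> z \<in> insert a (insert b P)"
      using P(2) below below' by auto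
    show "\<forall>(c, d)\<in>M. c \<in> insert a (insert b P) \<longleftrightarrow> d \<in> insert a (insert b P)"
      using P(3) dj by auto
    show "\<forall>x\<in>insert a (insert b P). \<forall>y\<in>X - insert a (insert b P). rank x \<le> rank y"
      using P(4) min rb by auto
  qed
  have L: "poset_strict_down X b - {a} = {z \<in> P. z < b}"
    using below P(1) ab(2) by (auto simp: poset_strict_down_def)
  have finP: "finite P" using P(1) fin finite_subset by blast
  have above: "\<not> a < z" "\<not> b < z" if "z \<in> P" for z
    using P(2)[OF that, of a] P(2)[OF that, of b] m ab(2) b by auto
  have con: "contractible_space (poset_space (poset_strict_down X b - {a}))"
    "topspace (poset_space (poset_strict_down X b - {a})) \<noteq> {}"
    using m(6) by (simp_all add: admissible_edge_def Let_def)
  \<comment> \<open>From \<open>2 * ht c \<le> 2 * ht a + 1\<close>, by parity.\<close>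
  have dim: "ht c \<le> ht a" if "c \<in> crit \<inter> P" for c
    using P(4)[of c a] that m ab(2) rank_critical[of c] ra by auto
  obtain f' where "cell_model crit ht (insert a (insert b P)) Z \<Phi> f'"
    by (rule cell_model_insert_pair[OF finP ab(2) b m(7,8,3) f above L con _ dim]) (use m in simp_all)
  then show "\<exists>Z \<Phi> f. cell_model crit ht (insert a (insert b P)) Z \<Phi> f" by blast
qed

lemma extend:
  assumes P: "initial P" "P \<noteq> X" and f: "cell_model crit ht P Z \<Phi> f"
  obtains Q where "P \<subset> Q" "initial Q" "\<exists>Z \<Phi> f. cell_model crit ht Q Z \<Phi> f"
proof -
  note PD = initialD[OF P(1)]
  have "X - P \<noteq> {}" using P(2) PD(1) by auto
  then obtain s where s: "s \<in> X - P" "\<And>x. x \<in> X - P \<Longrightarrow> rank s \<le> rank x"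
    using ex_has_least_nat[of "\<lambda>x. x \<in> X - P" _ rank] by blast
  show ?thesis
  proof (cases "\<exists>c\<in>crit \<inter> (X - P). rank c = rank s")
    case True
    then obtain c where c: "c \<in> crit" "c \<in> X - P" "rank c = rank s" by blast
    have "initial (insert c P) \<and> (\<exists>Z \<Phi> f. cell_model crit ht (insert c P) Z \<Phi> f)"
      by (rule extend_critical[OF P(1) c(1,2) _ f]) (use s c in simp)
    moreover have "P \<subset> insert c P" using c by auto
    ultimately show ?thesis using that by blast
  next
    case False
    \<comment> \<open>The lower ends of the remaining pairs of least rank. A member from which no
      other member is reachable is minimal for the converse of reachability, which is well-founded
      because the diagram is finite and acyclic.\<close>
    define T where "T = {a \<in> fst ` M. a \<notin> P \<and> rank a = rank s}"
    have "s \<in> X" "s \<notin> crit" using s False by auto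
    then obtain t where "t \<in> T"
    proof (cases rule: noncritical)
      case (1 y)
      then show ?thesis using that[of s] s(1) by (force simp: T_def)
    next
      case (2 y)
      then show ?thesis using that[of y] s(1) PD(3)[OF 2] rank_upper[OF 2] rank_lower[OF 2] by (force simp: T_def)
    qed
    have "finite (hasse_reversed X M)"
      by (rule finite_subset[of _ "X \<times> X"]) (use fin in \<open>auto simp: hasse_reversed_def hasse_def\<close>)
    then have wf: "wf (((hasse_reversed X M)\<inverse>)\<^sup>+)"
      using acyclic_reversed by (intro wf_trancl finite_acyclic_wf_converse)
    obtain a where a: "a \<in> T" "\<And>a'. (a', a) \<in> ((hasse_reversed X M)\<inverse>)\<^sup>+ \<Longrightarrow> a' \<notin> T"
      by (rule wfE_min[OF wf \<open>t \<in> T\<close>]) blast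
    obtain b where b: "(a, b) \<in> M" using a(1) by (auto simp: T_def)
    have "initial (insert a (insert b P)) \<and> (\<exists>Z \<Phi> f. cell_model crit ht (insert a (insert b P)) Z \<Phi> f)"
    proof (rule extend_pair[OF P(1) b _ _ _ f])
      show "a \<notin> P" using a(1) by (simp add: T_def)
      show "rank a \<le> rank x" if "x \<in> X - P" for x using s(2)[OF that] a(1) by (simp add: T_def)
      show "(a, a') \<notin> (hasse_reversed X M)\<^sup>+" if "(a', b') \<in> M" "a' \<notin> P" "rank a' = rank a" for a' b'
      proof
        assume "(a, a') \<in> (hasse_reversed X M)\<^sup>+"
        then have "(a', a) \<in> ((hasse_reversed X M)\<inverse>)\<^sup>+" by (simp add: trancl_converse)
        moreover have "a' \<in> T" using that a(1) by (force simp: T_def)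
        ultimately show False using a(2) by blast
      qed
    qed
    moreover have "P \<subset> insert a (insert b P)" using a(1) by (auto simp: T_def)
    ultimately show ?thesis using that by blast
  qed
qed

lemma cell_model_exists: "\<exists>Z \<Phi> f. cell_model crit ht X Z \<Phi> f"
proof -
  have "\<exists>Z \<Phi> f. cell_model crit ht X Z \<Phi> f"
    if "initial P" "\<exists>Z \<Phi> f. cell_model crit ht P Z \<Phi> f" for P
    using that
  proof (induction "card (X - P)" arbitrary: P rule: less_induct)
    case less
    show ?case
    proof (cases "P = X")
      case False
      from less.prems(2) obtain Z \<Phi> f where "cell_model crit ht P Z \<Phi> f" by blast
      with less.prems(1) False obtain Q where Q: "P \<subset> Q" "initial Q" "\<exists>Z \<Phi> f. cell_model crit ht Q Z \<Phi> f"
        by (rule extend)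
      have "X - Q \<subset> X - P" using Q(1) initialD(1)[OF Q(2)] by auto
      then have "card (X - Q) < card (X - P)" using fin by (intro psubset_card_mono) auto
      then show ?thesis using less.hyps Q by blast
    qed (use less in simp)
  qed
  moreover have "initial {}" by (auto simp: initial_def)
  ultimately show ?thesis using cell_model_empty by blast
qed

end

theorem theorem2p12:
  fixes X :: "'a::order set" and M :: "('a \<times> 'a) set"
  assumes "finite X"
    and "h_regular X"
    and "admissible_morse_matching X M"
  shows "\<exists>(Z :: ('a \<times> (nat \<Rightarrow> real)) topology) \<Phi>.
           CW_complex Z (critical_points X M) (elem_height X) \<Phi> \<and>
           realization (order_complex X) homotopy_equivalent_space Z"
proof -
  interpret admissible_matching X M using assms by unfold_locales
  obtain Z \<Phi> f where f: "cell_model crit ht X Z \<Phi> f" using cell_model_exists by blast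
  have "crit \<inter> X = crit" by (auto simp: critical_points_def)
  with f have "CW_complex Z crit ht \<Phi>" "homotopy_equivalence (poset_space X) Z f"
    by (simp_all add: cell_model_def)
  then show ?thesis unfolding homotopy_equivalent_space_iff by blast
qed

end
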